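(* Let $G=(G_n)$ be one of $O^+,S^+,H^+,B^+$, and let $k\leq n$. Let $C_+(G_n/G_k)$ be the universal unital $C^*$-algebra generated by the entries of a transposed orthogonal (if $G=O^+$), magic (if $G=S^+$), cubic (if $G=H^+$), respectively stochastic (if $G=B^+$) isometry $p=(p_{ij})_{k<i\leq n,\,1\leq j\leq n}$. Then $C_+(G_n/G_k)$ and $C_\times(G_n/G_k)$ have isomorphic abelianizations and isomorphic reduced versions.
   Context: $C(O_n^+)$, $C(S_n^+)$, $C(H_n^+)$, $C(B_n^+)$ are the universal unital $C^*$-algebras generated by the entries of an $n\times n$ matrix $u=(u_{ij})$ which is respectively: orthogonal ($u_{ij}=u_{ij}^*$, $u^t=u^{-1}$); magic (orthogonal, with all $u_{ij}$ projections); cubic (orthogonal, with $xy=0$ for any distinct entries $x,y$ on the same row or the same column); bistochastic (orthogonal, with sum $1$ on each row and column). They are compact quantum groups with $\Delta(u_{ij})=\sum_k u_{ik}\otimes u_{kj}$. For $k\leq n$, $G_k\subset G_n$ is given by $\pi:C(G_n)\to C(G_k)$, $u\mapsto\mathrm{diag}(v,1_{n-k})$, where $v$ is the fundamental corepresentation of $G_k$. $C_\times(G_n/G_k)\subset C(G_n)$ is the unital $C^*$-subalgebra generated by $\{u_{ij}\mid i>k,\ 1\leq j\leq n\}$ (it is contained in $C(G_n/G_k)=\{f\in C(G_n)\mid(\pi\otimes id)\Delta f=1\otimes f\}$). A rectangular matrix $p=(p_{ij})_{k<i\leq n,\,1\leq j\leq n}$ over a unital $C^*$-algebra is called: - a transposed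 orthogonal isometry, if the $p_{ij}$ are self-adjoint and $pp^t=1$; - a transposed magic isometry, if it is a transposed orthogonal isometry, and the $p_{ij}$ are projections, pairwise orthogonal on each column of $p$; - a transposed cubic isometry, if it is a transposed orthogonal isometry, and $xy=0$ for any $x\neq y$ (distinct entries) on the same row of $p$; - a transposed stochastic isometry, if it is a transposed orthogonal isometry, and the sum is $1$ on each row of $p$. There is a canonical surjection $C_+(G_n/G_k)\to C_\times(G_n/G_k)$, $p_{ij}\mapsto u_{ij}$. The abelianization of a $C^*$-algebra is its quotient by its (closed two-sided) commutator ideal. The reduced version of an algebra $A$ with respect to a tracial state $\varphi$ is the quotient of $A$ by the null ideal $\{x\mid\varphi(x^*x)=0\}$. Reduced versions here are taken with respect to the $G_n$-invariant tracial states: on $C_\times(G_n/G_k)$ this is the restriction of the Haar state of $C(G_n)$, and on $C_+(G_n/G_k)$ it is the composition of $C_+(G_n/G_k)\to C_\times(G_n/G_k)\subset C(G_n)$ with the Haar state. *)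

theory Defs
  imports Complex_Main "HOL-Library.Nonpos_Ints" "HOL-Algebra.QuotRing" "HOL-Algebra.Module"
begin

section \<open>Complex *-algebras with a (semi)norm\<close>

record 'a star_algebra = "(complex, 'a) module" +
  adj :: "'a \<Rightarrow> 'a"
  anorm :: "'a \<Rightarrow> real"

definition has_cstar_seminorm :: "('a, 'm) star_algebra_scheme \<Rightarrow> bool" where
  "has_cstar_seminorm A \<longleftrightarrow>
     (\<forall>x\<in>carrier A. 0 \<le> anorm A x) \<and>
     (\<forall>x\<in>carrier A. \<forall>y\<in>carrier A. anorm A (x \<oplus>\<^bsub>A\<^esub> y) \<le> anorm A x + anorm A y) \<and>
     (\<forall>c. \<forall>x\<in>carrier A. anorm A (c \<odot>\<^bsub>A\<^esub> x) = cmod c * anorm A x) \<and>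
     (\<forall>x\<in>carrier A. \<forall>y\<in>carrier A. anorm A (x \<otimes>\<^bsub>A\<^esub> y) \<le> anorm A x * anorm A y) \<and>
     (\<forall>x\<in>carrier A. anorm A (adj A x \<otimes>\<^bsub>A\<^esub> x) = (anorm A x)\<^sup>2)"

definition star_hom :: "('a, 'm) star_algebra_scheme \<Rightarrow> ('b, 'l) star_algebra_scheme \<Rightarrow> ('a \<Rightarrow> 'b) set" where
  "star_hom A B = {f \<in> ring_hom A B.
     (\<forall>c. \<forall>x\<in>carrier A. f (c \<odot>\<^bsub>A\<^esub> x) = c \<odot>\<^bsub>B\<^esub> f x) \<and>
     (\<forall>x\<in>carrier A. f (adj A x) = adj B (f x))}"

text \<open>Bijective unital *-homomorphisms between C*-algebras are automatically isometric.\<close>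

definition cstar_isomorphic :: "('a, 'm) star_algebra_scheme \<Rightarrow> ('b, 'l) star_algebra_scheme \<Rightarrow> bool" where
  "cstar_isomorphic A B \<longleftrightarrow> (\<exists>f\<in>star_hom A B. bij_betw f (carrier A) (carrier B))"

definition bounded_linear_map ::
  "('a, 'm) star_algebra_scheme \<Rightarrow> ('b, 'l) star_algebra_scheme \<Rightarrow> ('a \<Rightarrow> 'b) \<Rightarrow> bool" where
  "bounded_linear_map A B f \<longleftrightarrow>
     f \<in> carrier A \<rightarrow> carrier B \<and>
     (\<forall>x\<in>carrier A. \<forall>y\<in>carrier A. f (x \<oplus>\<^bsub>A\<^esub> y) = f x \<oplus>\<^bsub>B\<^esub> f y) \<and>
     (\<forall>c. \<forall>x\<in>carrier A. f (c \<odot>\<^bsub>A\<^esub> x) = c \<odot>\<^bsub>B\<^esub> f x) \<and>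
     (\<exists>K. \<forall>x\<in>carrier A. anorm B (f x) \<le> K * anorm A x)"

definition state :: "('a, 'm) star_algebra_scheme \<Rightarrow> ('a \<Rightarrow> complex) \<Rightarrow> bool" where
  "state A \<phi> \<longleftrightarrow>
     (\<forall>x\<in>carrier A. \<forall>y\<in>carrier A. \<phi> (x \<oplus>\<^bsub>A\<^esub> y) = \<phi> x + \<phi> y) \<and>
     (\<forall>c. \<forall>x\<in>carrier A. \<phi> (c \<odot>\<^bsub>A\<^esub> x) = c * \<phi> x) \<and>
     (\<forall>x\<in>carrier A. \<phi> (adj A x \<otimes>\<^bsub>A\<^esub> x) \<in> \<real>\<^sub>\<ge>\<^sub>0) \<and>
     \<phi> \<one>\<^bsub>A\<^esub> = 1"


section \<open>Subalgebras, ideals and quotients\<close>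

definition norm_closed :: "('a, 'm) star_algebra_scheme \<Rightarrow> 'a set \<Rightarrow> bool" where
  "norm_closed A S \<longleftrightarrow>
     (\<forall>x\<in>carrier A. (\<forall>e>0. \<exists>y\<in>S. anorm A (x \<ominus>\<^bsub>A\<^esub> y) < e) \<longrightarrow> x \<in> S)"

definition cstar_subalgebra :: "('a, 'm) star_algebra_scheme \<Rightarrow> 'a set \<Rightarrow> bool" where
  "cstar_subalgebra A S \<longleftrightarrow>
     S \<subseteq> carrier A \<and> \<one>\<^bsub>A\<^esub> \<in> S \<and>
     (\<forall>x\<in>S. \<forall>y\<in>S. x \<oplus>\<^bsub>A\<^esub> y \<in> S \<and> x \<otimes>\<^bsub>A\<^esub> y \<in> S) \<and>
     (\<forall>c. \<forall>x\<in>S. c \<odot>\<^bsub>A\<^esub> x \<in> S) \<and>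
     (\<forall>x\<in>S. adj A x \<in> S) \<and>
     norm_closed A S"

definition generated_cstar_subalgebra :: "'a star_algebra \<Rightarrow> 'a set \<Rightarrow> 'a star_algebra" where
  "generated_cstar_subalgebra A X = A\<lparr>carrier := \<Inter>{S. cstar_subalgebra A S \<and> X \<subseteq> S}\<rparr>"

definition quotient_star_algebra :: "'a star_algebra \<Rightarrow> 'a set \<Rightarrow> 'a set star_algebra" where
  "quotient_star_algebra A I =
     \<lparr>carrier = carrier (A Quot I),
      monoid.mult = monoid.mult (A Quot I),
      one = one (A Quot I),
      zero = zero (A Quot I),
      add = add (A Quot I),
      smult = (\<lambda>c U. \<Union>x\<in>U. I +>\<^bsub>A\<^esub> (c \<odot>\<^bsub>A\<^esub> x)),
      adj = (\<lambda>U. \<Union>x\<in>U. I +>\<^bsub>A\<^esub> adj A x),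
      anorm = (\<lambda>U. INF x\<in>U. anorm A x)\<rparr>"

definition commutator_ideal :: "('a, 'm) star_algebra_scheme \<Rightarrow> 'a set" where
  "commutator_ideal A = \<Inter>{I. ideal I A \<and> norm_closed A I \<and>
     (\<forall>x\<in>carrier A. \<forall>y\<in>carrier A. x \<otimes>\<^bsub>A\<^esub> y \<ominus>\<^bsub>A\<^esub> y \<otimes>\<^bsub>A\<^esub> x \<in> I)}"

definition abelianization :: "'a star_algebra \<Rightarrow> 'a set star_algebra" where
  "abelianization A = quotient_star_algebra A (commutator_ideal A)"

text \<open>
  For a tracial state the null set below is a closed two-sided ideal. The definition is only
  applied to the Haar state of the quantum groups below, which is tracial, and to its pullbacks.
\<close>

definition null_ideal :: "('a, 'm) star_algebra_scheme \<Rightarrow> ('a \<Rightarrow> complex) \<Rightarrow> 'a set" where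
  "null_ideal A \<phi> = {x \<in> carrier A. \<phi> (adj A x \<otimes>\<^bsub>A\<^esub> x) = 0}"

definition reduced_version :: "'a star_algebra \<Rightarrow> ('a \<Rightarrow> complex) \<Rightarrow> 'a set star_algebra" where
  "reduced_version A \<phi> = quotient_star_algebra A (null_ideal A \<phi>)"


section \<open>Hausdorff completion of a seminormed *-algebra\<close>

definition cauchy_seqs :: "('a, 'm) star_algebra_scheme \<Rightarrow> (nat \<Rightarrow> 'a) set" where
  "cauchy_seqs A = {X. range X \<subseteq> carrier A \<and>
     (\<forall>e>0. \<exists>N. \<forall>m\<ge>N. \<forall>n\<ge>N. anorm A (X m \<ominus>\<^bsub>A\<^esub> X n) < e)}"

definition cauchy_rel :: "('a, 'm) star_algebra_scheme \<Rightarrow> (nat \<Rightarrow> 'a) rel" where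
  "cauchy_rel A = {(X, Y). X \<in> cauchy_seqs A \<and> Y \<in> cauchy_seqs A \<and>
     (\<lambda>n. anorm A (X n \<ominus>\<^bsub>A\<^esub> Y n)) \<longlonglongrightarrow> 0}"

abbreviation cauchy_class :: "('a, 'm) star_algebra_scheme \<Rightarrow> (nat \<Rightarrow> 'a) \<Rightarrow> (nat \<Rightarrow> 'a) set" where
  "cauchy_class A X \<equiv> cauchy_rel A `` {X}"

definition completion :: "('a, 'm) star_algebra_scheme \<Rightarrow> (nat \<Rightarrow> 'a) set star_algebra" where
  "completion A =
     \<lparr>carrier = cauchy_seqs A // cauchy_rel A,
      monoid.mult = (\<lambda>U V. \<Union>X\<in>U. \<Union>Y\<in>V. cauchy_class A (\<lambda>n. X n \<otimes>\<^bsub>A\<^esub> Y n)),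
      one = cauchy_class A (\<lambda>_. \<one>\<^bsub>A\<^esub>),
      zero = cauchy_class A (\<lambda>_. \<zero>\<^bsub>A\<^esub>),
      add = (\<lambda>U V. \<Union>X\<in>U. \<Union>Y\<in>V. cauchy_class A (\<lambda>n. X n \<oplus>\<^bsub>A\<^esub> Y n)),
      smult = (\<lambda>c U. \<Union>X\<in>U. cauchy_class A (\<lambda>n. c \<odot>\<^bsub>A\<^esub> X n)),
      adj = (\<lambda>U. \<Union>X\<in>U. cauchy_class A (\<lambda>n. adj A (X n))),
      anorm = (\<lambda>U. THE r. \<exists>X\<in>U. (\<lambda>n. anorm A (X n)) \<longlonglongrightarrow> r)\<rparr>"

definition completion_embed :: "('a, 'm) star_algebra_scheme \<Rightarrow> 'a \<Rightarrow> (nat \<Rightarrow> 'a) set" where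
  "completion_embed A x = cauchy_class A (\<lambda>_. x)"


section \<open>Universal unital C*-algebras\<close>

text \<open>
  The free unital *-algebra on a set \<open>X\<close> of generators, equipped with a function \<open>s\<close> as its
  seminorm: finitely supported functions on words in the letters \<open>(x, False)\<close> (standing for \<open>x\<close>)
  and \<open>(x, True)\<close> (standing for the adjoint of \<open>x\<close>), with the convolution product.
\<close>

type_synonym 'g free_poly = "('g \<times> bool) list \<Rightarrow> complex"

definition free_star_algebra :: "'g set \<Rightarrow> ('g free_poly \<Rightarrow> real) \<Rightarrow> 'g free_poly star_algebra" where
  "free_star_algebra X s =
     \<lparr>carrier = {f. finite {w. f w \<noteq> 0} \<and> (\<forall>w. f w \<noteq> 0 \<longrightarrow> fst ` set w \<subseteq> X)},
      monoid.mult = (\<lambda>f g w. \<Sum>l\<le>length w. f (take l w) * g (drop l w)),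
      one = (\<lambda>w. if w = [] then 1 else 0),
      zero = (\<lambda>w. 0),
      add = (\<lambda>f g w. f w + g w),
      smult = (\<lambda>c f w. c * f w),
      adj = (\<lambda>f w. cnj (f (rev (map (\<lambda>(x, b). (x, \<not> b)) w)))),
      anorm = s\<rparr>"

definition free_gen :: "'g \<Rightarrow> 'g free_poly" where
  "free_gen x = (\<lambda>w. if w = [(x, False)] then 1 else 0)"

text \<open>
  A unital C*-algebra generated by a family \<open>u\<close> indexed by \<open>X\<close> is, up to isomorphism, the
  completion of the free *-algebra on \<open>X\<close> in a C*-seminorm. The universal one, among those in
  which \<open>u\<close> satisfies the relations \<open>P\<close>, is the completion in the largest such seminorm. The
  supremum is only meaningful if the relations \<open>P\<close> bound the norms of the generators; here
  \<open>\<parallel>u\<^sub>i\<^sub>j\<parallel> \<le> 1\<close> always follows from self-adjointness and \<open>\<Sum>\<^sub>j u\<^sub>i\<^sub>j\<^sup>2 = 1\<close>.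
\<close>

type_synonym entry = "nat \<times> nat"
type_synonym ualg = "(nat \<Rightarrow> entry free_poly) set"
type_synonym matrix_relations = "ualg star_algebra \<Rightarrow> (nat \<Rightarrow> nat \<Rightarrow> ualg) \<Rightarrow> bool"

definition generator_matrix :: "entry set \<Rightarrow> (entry free_poly \<Rightarrow> real) \<Rightarrow> nat \<Rightarrow> nat \<Rightarrow> ualg" where
  "generator_matrix X s i j = completion_embed (free_star_algebra X s) (free_gen (i, j))"

definition universal_norm :: "entry set \<Rightarrow> matrix_relations \<Rightarrow> entry free_poly \<Rightarrow> real" where
  "universal_norm X P f =
     Sup {s f | s. has_cstar_seminorm (free_star_algebra X s) \<and>
                   P (completion (free_star_algebra X s)) (generator_matrix X s)}"

definition universal_cstar_algebra :: "entry set \<Rightarrow> matrix_relations \<Rightarrow> ualg star_algebra" where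
  "universal_cstar_algebra X P = completion (free_star_algebra X (universal_norm X P))"

definition universal_matrix :: "entry set \<Rightarrow> matrix_relations \<Rightarrow> nat \<Rightarrow> nat \<Rightarrow> ualg" where
  "universal_matrix X P = generator_matrix X (universal_norm X P)"


section \<open>Matrices over unital C*-algebras\<close>

definition projection :: "('a, 'm) star_algebra_scheme \<Rightarrow> 'a \<Rightarrow> bool" where
  "projection A p \<longleftrightarrow> p \<in> carrier A \<and> adj A p = p \<and> p \<otimes>\<^bsub>A\<^esub> p = p"

definition orthogonal_matrix :: "nat \<Rightarrow> ('a, 'm) star_algebra_scheme \<Rightarrow> (nat \<Rightarrow> nat \<Rightarrow> 'a) \<Rightarrow> bool" where
  "orthogonal_matrix n A u \<longleftrightarrow>
     (\<forall>i\<in>{1..n}. \<forall>j\<in>{1..n}. u i j \<in> carrier A \<and> adj A (u i j) = u i j) \<and>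
     (\<forall>i\<in>{1..n}. \<forall>l\<in>{1..n}.
        (\<Oplus>\<^bsub>A\<^esub>j\<in>{1..n}. u i j \<otimes>\<^bsub>A\<^esub> u l j) = (if i = l then \<one>\<^bsub>A\<^esub> else \<zero>\<^bsub>A\<^esub>)) \<and>
     (\<forall>j\<in>{1..n}. \<forall>l\<in>{1..n}.
        (\<Oplus>\<^bsub>A\<^esub>i\<in>{1..n}. u i j \<otimes>\<^bsub>A\<^esub> u i l) = (if j = l then \<one>\<^bsub>A\<^esub> else \<zero>\<^bsub>A\<^esub>))"

definition magic_matrix :: "nat \<Rightarrow> ('a, 'm) star_algebra_scheme \<Rightarrow> (nat \<Rightarrow> nat \<Rightarrow> 'a) \<Rightarrow> bool" where
  "magic_matrix n A u \<longleftrightarrow> orthogonal_matrix n A u \<and>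
     (\<forall>i\<in>{1..n}. \<forall>j\<in>{1..n}. projection A (u i j))"

text \<open>In the cubic conditions, distinct entries are entries at distinct positions.\<close>

definition cubic_matrix :: "nat \<Rightarrow> ('a, 'm) star_algebra_scheme \<Rightarrow> (nat \<Rightarrow> nat \<Rightarrow> 'a) \<Rightarrow> bool" where
  "cubic_matrix n A u \<longleftrightarrow> orthogonal_matrix n A u \<and>
     (\<forall>i\<in>{1..n}. \<forall>j\<in>{1..n}. \<forall>l\<in>{1..n}. j \<noteq> l \<longrightarrow>
        u i j \<otimes>\<^bsub>A\<^esub> u i l = \<zero>\<^bsub>A\<^esub> \<and> u j i \<otimes>\<^bsub>A\<^esub> u l i = \<zero>\<^bsub>A\<^esub>)"

definition bistochastic_matrix :: "nat \<Rightarrow> ('a, 'm) star_algebra_scheme \<Rightarrow> (nat \<Rightarrow> nat \<Rightarrow> 'a) \<Rightarrow> bool" where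
  "bistochastic_matrix n A u \<longleftrightarrow> orthogonal_matrix n A u \<and>
     (\<forall>i\<in>{1..n}. (\<Oplus>\<^bsub>A\<^esub>j\<in>{1..n}. u i j) = \<one>\<^bsub>A\<^esub>) \<and>
     (\<forall>j\<in>{1..n}. (\<Oplus>\<^bsub>A\<^esub>i\<in>{1..n}. u i j) = \<one>\<^bsub>A\<^esub>)"

definition transposed_orthogonal_isometry ::
  "nat \<Rightarrow> nat \<Rightarrow> ('a, 'm) star_algebra_scheme \<Rightarrow> (nat \<Rightarrow> nat \<Rightarrow> 'a) \<Rightarrow> bool" where
  "transposed_orthogonal_isometry k n A p \<longleftrightarrow>
     (\<forall>i\<in>{k<..n}. \<forall>j\<in>{1..n}. p i j \<in> carrier A \<and> adj A (p i j) = p i j) \<and>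
     (\<forall>i\<in>{k<..n}. \<forall>l\<in>{k<..n}.
        (\<Oplus>\<^bsub>A\<^esub>j\<in>{1..n}. p i j \<otimes>\<^bsub>A\<^esub> p l j) = (if i = l then \<one>\<^bsub>A\<^esub> else \<zero>\<^bsub>A\<^esub>))"

definition transposed_magic_isometry ::
  "nat \<Rightarrow> nat \<Rightarrow> ('a, 'm) star_algebra_scheme \<Rightarrow> (nat \<Rightarrow> nat \<Rightarrow> 'a) \<Rightarrow> bool" where
  "transposed_magic_isometry k n A p \<longleftrightarrow> transposed_orthogonal_isometry k n A p \<and>
     (\<forall>i\<in>{k<..n}. \<forall>j\<in>{1..n}. projection A (p i j)) \<and>
     (\<forall>j\<in>{1..n}. \<forall>i\<in>{k<..n}. \<forall>l\<in>{k<..n}. i \<noteq> l \<longrightarrow> p i j \<otimes>\<^bsub>A\<^esub> p l j = \<zero>\<^bsub>A\<^esub>)"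

definition transposed_cubic_isometry ::
  "nat \<Rightarrow> nat \<Rightarrow> ('a, 'm) star_algebra_scheme \<Rightarrow> (nat \<Rightarrow> nat \<Rightarrow> 'a) \<Rightarrow> bool" where
  "transposed_cubic_isometry k n A p \<longleftrightarrow> transposed_orthogonal_isometry k n A p \<and>
     (\<forall>i\<in>{k<..n}. \<forall>j\<in>{1..n}. \<forall>l\<in>{1..n}. j \<noteq> l \<longrightarrow> p i j \<otimes>\<^bsub>A\<^esub> p i l = \<zero>\<^bsub>A\<^esub>)"

definition transposed_stochastic_isometry ::
  "nat \<Rightarrow> nat \<Rightarrow> ('a, 'm) star_algebra_scheme \<Rightarrow> (nat \<Rightarrow> nat \<Rightarrow> 'a) \<Rightarrow> bool" where
  "transposed_stochastic_isometry k n A p \<longleftrightarrow> transposed_orthogonal_isometry k n A p \<and>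
     (\<forall>i\<in>{k<..n}. (\<Oplus>\<^bsub>A\<^esub>j\<in>{1..n}. p i j) = \<one>\<^bsub>A\<^esub>)"


section \<open>The quantum groups and their homogeneous spaces\<close>

datatype quantum_family = O_plus | S_plus | H_plus | B_plus

fun group_relations :: "quantum_family \<Rightarrow> nat \<Rightarrow> matrix_relations" where
  "group_relations O_plus n = orthogonal_matrix n"
| "group_relations S_plus n = magic_matrix n"
| "group_relations H_plus n = cubic_matrix n"
| "group_relations B_plus n = bistochastic_matrix n"

fun isometry_relations :: "quantum_family \<Rightarrow> nat \<Rightarrow> nat \<Rightarrow> matrix_relations" where
  "isometry_relations O_plus k n = transposed_orthogonal_isometry k n"
| "isometry_relations S_plus k n = transposed_magic_isometry k n"
| "isometry_relations H_plus k n = transposed_cubic_isometry k n"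
| "isometry_relations B_plus k n = transposed_stochastic_isometry k n"

definition C_group :: "quantum_family \<Rightarrow> nat \<Rightarrow> ualg star_algebra" where
  "C_group G n = universal_cstar_algebra ({1..n} \<times> {1..n}) (group_relations G n)"

definition u_mat :: "quantum_family \<Rightarrow> nat \<Rightarrow> nat \<Rightarrow> nat \<Rightarrow> ualg" where
  "u_mat G n = universal_matrix ({1..n} \<times> {1..n}) (group_relations G n)"

definition C_times :: "quantum_family \<Rightarrow> nat \<Rightarrow> nat \<Rightarrow> ualg star_algebra" where
  "C_times G n k =
     generated_cstar_subalgebra (C_group G n) {u_mat G n i j | i j. i \<in> {k<..n} \<and> j \<in> {1..n}}"

definition C_plus :: "quantum_family \<Rightarrow> nat \<Rightarrow> nat \<Rightarrow> ualg star_algebra" where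
  "C_plus G n k = universal_cstar_algebra ({k<..n} \<times> {1..n}) (isometry_relations G k n)"

definition p_mat :: "quantum_family \<Rightarrow> nat \<Rightarrow> nat \<Rightarrow> nat \<Rightarrow> nat \<Rightarrow> ualg" where
  "p_mat G n k = universal_matrix ({k<..n} \<times> {1..n}) (isometry_relations G k n)"

definition canonical_surjection :: "quantum_family \<Rightarrow> nat \<Rightarrow> nat \<Rightarrow> (ualg \<Rightarrow> ualg) \<Rightarrow> bool" where
  "canonical_surjection G n k \<pi> \<longleftrightarrow>
     \<pi> \<in> star_hom (C_plus G n k) (C_times G n k) \<and>
     \<pi> ` carrier (C_plus G n k) = carrier (C_times G n k) \<and>
     (\<forall>i\<in>{k<..n}. \<forall>j\<in>{1..n}. \<pi> (p_mat G n k i j) = u_mat G n i j)"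


section \<open>Minimal tensor products and the Haar state\<close>

text \<open>
  Formal linear combinations of elementary tensors \<open>a \<otimes> b\<close>. The minimal C*-seminorm vanishes on
  the bilinearity relations, so these disappear in the Hausdorff completion.
\<close>

definition supp :: "('c \<Rightarrow> complex) \<Rightarrow> 'c set" where
  "supp F = {p. F p \<noteq> 0}"

definition elementary_tensor :: "'a \<Rightarrow> 'b \<Rightarrow> 'a \<times> 'b \<Rightarrow> complex" where
  "elementary_tensor a b = (\<lambda>p. if p = (a, b) then 1 else 0)"

definition formal_tensors :: "('a, 'm) star_algebra_scheme \<Rightarrow> ('b, 'l) star_algebra_scheme \<Rightarrow>
    (('a \<times> 'b \<Rightarrow> complex) \<Rightarrow> real) \<Rightarrow> ('a \<times> 'b \<Rightarrow> complex) star_algebra" where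
  "formal_tensors A B s =
     \<lparr>carrier = {F. finite (supp F) \<and> supp F \<subseteq> carrier A \<times> carrier B},
      monoid.mult = (\<lambda>F G r. \<Sum>(a, b)\<in>supp F. \<Sum>(a', b')\<in>supp G.
        if (a \<otimes>\<^bsub>A\<^esub> a', b \<otimes>\<^bsub>B\<^esub> b') = r then F (a, b) * G (a', b') else 0),
      one = elementary_tensor \<one>\<^bsub>A\<^esub> \<one>\<^bsub>B\<^esub>,
      zero = (\<lambda>r. 0),
      add = (\<lambda>F G r. F r + G r),
      smult = (\<lambda>c F r. c * F r),
      adj = (\<lambda>F r. \<Sum>(a, b)\<in>supp F. if (adj A a, adj B b) = r then cnj (F (a, b)) else 0),
      anorm = s\<rparr>"

definition product_functional ::
  "('a \<Rightarrow> complex) \<Rightarrow> ('b \<Rightarrow> complex) \<Rightarrow> ('a \<times> 'b \<Rightarrow> complex) \<Rightarrow> complex" where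
  "product_functional \<phi> \<psi> F = (\<Sum>(a, b)\<in>supp F. F (a, b) * \<phi> a * \<psi> b)"

text \<open>
  For states \<open>\<phi>\<close> and \<open>\<psi>\<close> with cyclic GNS vectors \<open>\<xi>\<close> and \<open>\<eta>\<close>, one has
  \<open>\<parallel>(\<pi>\<^sub>\<phi> \<otimes> \<pi>\<^sub>\<psi>)(x)(\<xi> \<otimes> \<eta>)\<parallel>\<^sup>2 = (\<phi> \<otimes> \<psi>)(x\<^sup>*x)\<close>, and the vectors obtained from elements \<open>x\<close> of the
  algebraic tensor product are dense. So the following is the supremum of
  \<open>\<parallel>(\<pi>\<^sub>\<phi> \<otimes> \<pi>\<^sub>\<psi>)(F)\<parallel>\<close> over all pairs of states, that is, the spatial norm of \<open>F\<close>.
\<close>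

definition min_tensor_norm ::
  "('a, 'm) star_algebra_scheme \<Rightarrow> ('b, 'l) star_algebra_scheme \<Rightarrow> ('a \<times> 'b \<Rightarrow> complex) \<Rightarrow> real" where
  "min_tensor_norm A B F = (let T = formal_tensors A B (\<lambda>_. 0) in
     Sup {sqrt (Re (product_functional \<phi> \<psi> (adj T (F \<otimes>\<^bsub>T\<^esub> G) \<otimes>\<^bsub>T\<^esub> (F \<otimes>\<^bsub>T\<^esub> G)))) | \<phi> \<psi> G.
          state A \<phi> \<and> state B \<psi> \<and> G \<in> carrier T \<and>
          Re (product_functional \<phi> \<psi> (adj T G \<otimes>\<^bsub>T\<^esub> G)) \<le> 1})"

definition min_tensor :: "('a, 'm) star_algebra_scheme \<Rightarrow> ('b, 'l) star_algebra_scheme \<Rightarrow>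
    (nat \<Rightarrow> 'a \<times> 'b \<Rightarrow> complex) set star_algebra" where
  "min_tensor A B = completion (formal_tensors A B (min_tensor_norm A B))"

definition tensor :: "('a, 'm) star_algebra_scheme \<Rightarrow> ('b, 'l) star_algebra_scheme \<Rightarrow>
    'a \<Rightarrow> 'b \<Rightarrow> (nat \<Rightarrow> 'a \<times> 'b \<Rightarrow> complex) set" where
  "tensor A B a b =
     completion_embed (formal_tensors A B (min_tensor_norm A B)) (elementary_tensor a b)"

type_synonym ualg_tensor = "(nat \<Rightarrow> ualg \<times> ualg \<Rightarrow> complex) set"

definition comultiplication :: "quantum_family \<Rightarrow> nat \<Rightarrow> (ualg \<Rightarrow> ualg_tensor) \<Rightarrow> bool" where
  "comultiplication G n \<Delta> \<longleftrightarrow> (let A = C_group G n; u = u_mat G n in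
     \<Delta> \<in> star_hom A (min_tensor A A) \<and>
     (\<forall>i\<in>{1..n}. \<forall>j\<in>{1..n}.
        \<Delta> (u i j) = (\<Oplus>\<^bsub>min_tensor A A\<^esub>l\<in>{1..n}. tensor A A (u i l) (u l j))))"

text \<open>
  The slice maps \<open>\<phi> \<otimes> id\<close> and \<open>id \<otimes> \<phi>\<close>, determined by their values on elementary tensors
  since these have dense linear span.
\<close>

definition left_slice :: "('a, 'm) star_algebra_scheme \<Rightarrow> ('a \<Rightarrow> complex) \<Rightarrow>
    ((nat \<Rightarrow> 'a \<times> 'a \<Rightarrow> complex) set \<Rightarrow> 'a) \<Rightarrow> bool" where
  "left_slice A \<phi> E \<longleftrightarrow> bounded_linear_map (min_tensor A A) A E \<and>
     (\<forall>a\<in>carrier A. \<forall>b\<in>carrier A. E (tensor A A a b) = \<phi> a \<odot>\<^bsub>A\<^esub> b)"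

definition right_slice :: "('a, 'm) star_algebra_scheme \<Rightarrow> ('a \<Rightarrow> complex) \<Rightarrow>
    ((nat \<Rightarrow> 'a \<times> 'a \<Rightarrow> complex) set \<Rightarrow> 'a) \<Rightarrow> bool" where
  "right_slice A \<phi> E \<longleftrightarrow> bounded_linear_map (min_tensor A A) A E \<and>
     (\<forall>a\<in>carrier A. \<forall>b\<in>carrier A. E (tensor A A a b) = \<phi> b \<odot>\<^bsub>A\<^esub> a)"

definition haar_state :: "quantum_family \<Rightarrow> nat \<Rightarrow> (ualg \<Rightarrow> complex) \<Rightarrow> bool" where
  "haar_state G n h \<longleftrightarrow> (let A = C_group G n in
     state A h \<and>
     (\<exists>\<Delta> L R. comultiplication G n \<Delta> \<and> left_slice A h L \<and> right_slice A h R \<and>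
        (\<forall>x\<in>carrier A. L (\<Delta> x) = h x \<odot>\<^bsub>A\<^esub> \<one>\<^bsub>A\<^esub> \<and> R (\<Delta> x) = h x \<odot>\<^bsub>A\<^esub> \<one>\<^bsub>A\<^esub>)))"

end

theory Submission
  imports Defs
begin

text \<open>
  Both algebras come from the same free *-algebra, on the letters
  \<open>p\<^sub>i\<^sub>j\<close> with \<open>k < i\<close>. The algebra \<open>C\<^sub>+\<close> is its completion in the largest C*-seminorm \<open>s\<close> that
  kills the isometry relations. The letters \<open>u\<^sub>i\<^sub>j\<close> generate a larger free *-algebra with the largest
  C*-seminorm \<open>t\<close> that kills the relations of the quantum group, and \<open>C\<^sub>\<times>\<close> is the closure of the smaller
  free *-algebra with respect to \<open>t\<close>. The lower rows of a group matrix form an isometry, so \<open>t \<le> s\<close> on the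
  smaller algebra (\<open>isometry_rel_if_group_rel\<close>; the one relation that needs an argument is that
  projections with sum \<open>1\<close> are orthogonal, \<open>projections_orthogonal\<close>). This gives the canonical map
  \<open>C\<^sub>+ \<rightarrow> C\<^sub>\<times>\<close>, and it is onto because *-homomorphisms of C*-algebras have closed range
  (\<open>lift_bounded\<close>, \<open>closed_range\<close>).

  The reduced versions are isomorphic for a formal reason: the null ideal of a state pulled back
  along a surjection is the preimage of the null ideal of the state, and a surjection identifies the
  quotient by such a preimage with the quotient of the target (\<open>quotient_isomorphic\<close>).

  The same principle settles the abelianizations as soon as the commutator ideal of \<open>C\<^sub>+\<close> is the
  preimage of that of \<open>C\<^sub>\<times>\<close>, for which the kernel of the canonical map has to be contained in the commutator
  ideal. Let \<open>q\<close> be the quotient seminorm of \<open>s\<close> by the algebraic commutator ideal. What is needed is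
  \<open>q \<le> t\<close> (\<open>quotient_le_universal_norm\<close>). Now \<open>q\<close> is a commutative C*-seminorm, so by Gelfand duality its value at
  a given element is \<open>\<bar>\<chi>\<bar>\<close> for a character \<open>\<chi>\<close> dominated by \<open>q\<close> (\<open>norming_scalar_points\<close>), that is, for a real
  matrix that satisfies the isometry relations. Such a matrix can be completed to a real \<open>n \<times> n\<close> matrix
  that satisfies the group relations (\<open>extend_isometry_point\<close>): this expresses that the classical version
  of \<open>G\<^sub>n\<close> acts transitively on the real isometries. The completed matrix is a character of \<open>C(G\<^sub>n)\<close>, hence
  \<open>\<bar>\<chi>\<bar> \<le> t\<close>.

  Everything about C*-algebras is proved for C*-seminorms on a *-algebra that
  need not be complete, so that elements stay polynomials. Spectra and functional calculus are replaced
  by one fact: if \<open>z\<close> is self-adjoint and \<open>\<parallel>z\<parallel> \<le> 1\<close>, then \<open>1 - z\<close> is a limit of squares of self-adjoint polynomials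
  in \<open>z\<close> (\<open>approx_root_one_minus\<close>). It makes the self-adjoint \<open>a\<close> with \<open>\<parallel>r - a\<parallel> \<le> r\<close> for some \<open>r\<close> into a positive cone, and
  the polynomial \<open>1 - b\<^sup>2\<close>, with \<open>b\<close> a multiple of \<open>x\<^sup>*x\<close>, serves as a damping factor that shrinks \<open>x\<close>
  without changing it much where it is already small (\<open>halving\<close>).
\<close>

section \<open>Complex *-algebras and C*-seminorms\<close>

text \<open>
  Scalars are real, and the complex structure is carried by a central imaginary unit. Real scalars give
  the algebraic simplification rules of real algebras, and the imaginary unit is only needed to form
  \<open>f + i g\<close> from self-adjoint \<open>f\<close> and \<open>g\<close>.
\<close>

class complex_star_algebra = real_algebra_1 +
  fixes star :: "'a \<Rightarrow> 'a" and iunit :: 'a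
  assumes star_add: "star (x + y) = star x + star y"
    and star_mult: "star (x * y) = star y * star x"
    and star_star [simp]: "star (star x) = x"
    and star_scaleR: "star (r *\<^sub>R x) = r *\<^sub>R star x"
    and iunit_squared: "iunit * iunit = - 1"
    and iunit_central: "iunit * x = x * iunit"
    and star_iunit: "star iunit = - iunit"

lemma star_zero [simp]: "star (0::'a::complex_star_algebra) = 0"
  using star_scaleR[of 0 "0::'a::complex_star_algebra"] by simp

lemma star_minus [simp]: "star (- x) = - star (x::'a::complex_star_algebra)"
  using star_scaleR[of "-1" x] by simp

lemma star_diff: "star (x - y) = star x - star (y::'a::complex_star_algebra)"
  using star_add[of x "- y"] by simp

lemma star_one [simp]: "star (1::'a::complex_star_algebra) = 1"
  by (metis mult_1_right star_mult star_star mult_1_left)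

lemma star_power: "star (x ^ n) = star (x::'a::complex_star_algebra) ^ n"
  by (induction n) (simp_all add: star_mult power_commutes)

text \<open>
  Homogeneity for complex scalars and invariance under the adjoint follow from the C*-identity.
\<close>

locale cstar_seminorm =
  fixes N :: "'a::complex_star_algebra \<Rightarrow> real"
  assumes triangle: "N (x + y) \<le> N x + N y"
    and scale [simp]: "N (r *\<^sub>R x) = \<bar>r\<bar> * N x"
    and submult: "N (x * y) \<le> N x * N y"
    and cstar: "N (star x * x) = (N x)\<^sup>2"
begin

lemma zero [simp]: "N 0 = 0"
  using scale[of 0 0] by simp

lemma minus [simp]: "N (- x) = N x"
  using scale[of "-1" x] by simp

lemma nonneg [simp]: "0 \<le> N x"
  using triangle[of x "- x"] by simp

lemma minus_commute: "N (x - y) = N (y - x)"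
  by (metis minus minus_diff_eq)

lemma triangle_diff: "N (x - y) \<le> N x + N y"
  using triangle[of x "- y"] by simp

lemma le_diff: "N x \<le> N y + N (x - y)"
  using triangle[of y "x - y"] by simp

lemma eq_if_null_diff: "N (x - y) = 0 \<Longrightarrow> N x = N y"
  using le_diff[of x y] le_diff[of y x] minus_commute[of x y] by simp

lemma null_trans: "N (x - y) = 0 \<Longrightarrow> N (y - z) = 0 \<Longrightarrow> N (x - z) = 0"
  using triangle[of "x - y" "y - z"] nonneg[of "x - z"] by simp

lemma null_add: "N x = 0 \<Longrightarrow> N y = 0 \<Longrightarrow> N (x + y) = 0"
  using triangle[of x y] nonneg[of "x + y"] by simp

lemma null_mult_left: "N x = 0 \<Longrightarrow> N (y * x) = 0"
  using submult[of y x] nonneg[of "y * x"] by simp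

lemma null_mult_right: "N x = 0 \<Longrightarrow> N (x * y) = 0"
  using submult[of x y] nonneg[of "x * y"] by simp

lemma null_sum: "(\<And>i. i \<in> I \<Longrightarrow> N (f i) = 0) \<Longrightarrow> N (sum f I) = 0"
  by (induction I rule: infinite_finite_induct) (auto intro: null_add)

lemma star_eq [simp]: "N (star x) = N x"
proof -
  have *: "N y \<le> N (star y)" for y
  proof (cases "N y = 0")
    case False
    have "N y * N y \<le> N (star y) * N y"
      using cstar[of y] submult[of "star y" y] by (simp add: power2_eq_square)
    then show ?thesis using False nonneg[of y] by simp
  qed simp
  show ?thesis using *[of x] *[of "star x"] by simp
qed

lemma square: "star x = x \<Longrightarrow> N (x * x) = (N x)\<^sup>2"
  using cstar[of x] by simp

lemma one_le: "N 1 \<le> 1"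
proof -
  have "N 1 * (N 1 - 1) = 0" using square[of 1] by (simp add: power2_eq_square algebra_simps)
  then show ?thesis by auto
qed


text \<open>
  With \<open>u = f + i g\<close> one has \<open>u\<^sup>*u = f\<^sup>2 + g\<^sup>2\<close> and \<open>u\<^sup>2 + (u\<^sup>*)\<^sup>2 = 2 (f\<^sup>2 - g\<^sup>2)\<close>.
\<close>

lemma commuting_squares_diff:
  assumes "star f = f" "star g = g" "f * g = g * f"
  shows "N (f * f - g * g) \<le> N (f * f + g * g)"
proof -
  define u where "u = f + iunit * g"
  have su: "star u = f - iunit * g"
    using assms by (simp add: u_def star_add star_mult star_iunit iunit_central)
  have i2: "iunit * g * (iunit * g) = - (g * g)"
    by (simp add: iunit_central[of g] mult.assoc) (simp add: mult.assoc[symmetric] iunit_central[of g, symmetric] iunit_squared)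
  have i1: "f * (iunit * g) = iunit * (f * g)" "iunit * g * f = iunit * (f * g)"
  proof -
    show "f * (iunit * g) = iunit * (f * g)"
      unfolding mult.assoc[symmetric] iunit_central[of f] ..
    show "iunit * g * f = iunit * (f * g)" unfolding assms(3) by (rule mult.assoc)
  qed
  have "star u * u = f * f + f * (iunit * g) - iunit * g * f - iunit * g * (iunit * g)"
    unfolding su unfolding u_def by (simp only: distrib_left distrib_right left_diff_distrib right_diff_distrib) simp
  then have uu: "star u * u = f * f + g * g" using i1 i2 assms(3) by simp
  have "u * u = f * f + f * (iunit * g) + iunit * g * f + iunit * g * (iunit * g)"
    unfolding u_def by (simp only: distrib_left distrib_right) simp
  moreover have "star u * star u = f * f - f * (iunit * g) - iunit * g * f + iunit * g * (iunit * g)"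
    unfolding su by (simp only: left_diff_distrib right_diff_distrib) simp
  ultimately have "u * u + star u * star u = 2 *\<^sub>R (f * f - g * g)"
    using i2 by (simp add: scaleR_2)
  then have "2 * N (f * f - g * g) = N (u * u + star u * star u)" by simp
  also have "\<dots> \<le> N u * N u + N (star u) * N (star u)"
    by (meson add_mono order_trans submult triangle)
  also have "\<dots> = 2 * N (star u * u)" by (simp add: cstar power2_eq_square)
  finally show ?thesis using uu by simp
qed

lemma commuting_square_le:
  assumes "star f = f" "star g = g" "f * g = g * f"
  shows "(N f)\<^sup>2 \<le> N (f * f + g * g)"
proof -
  have "2 * (N f)\<^sup>2 = N ((f * f - g * g) + (f * f + g * g))"
    using square[OF assms(1)] scale[of 2 "f * f"] by (simp add: scaleR_2)
  also have "\<dots> \<le> 2 * N (f * f + g * g)"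
    using triangle[of "f * f - g * g" "f * f + g * g"] commuting_squares_diff[OF assms] by simp
  finally show ?thesis by simp
qed

text \<open>
  The iteration \<open>c \<leftarrow> (z + c\<^sup>2)/2\<close> has the fixed point \<open>1 - \<surd>(1 - z)\<close>. Its polynomials have nonnegative
  coefficients, so for \<open>\<parallel>z\<parallel> \<le> 1\<close> it is majorised by the numerical iteration at \<open>z = 1\<close>, which increases to \<open>1\<close>.
\<close>

primrec root_iter :: "'a \<Rightarrow> nat \<Rightarrow> 'a" where
  "root_iter z 0 = 0"
| "root_iter z (Suc n) = (1/2) *\<^sub>R (z + root_iter z n * root_iter z n)"

primrec root_bound :: "nat \<Rightarrow> real" where
  "root_bound 0 = 0"
| "root_bound (Suc n) = (1 + (root_bound n)\<^sup>2) / 2"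

lemma root_bound_le: "0 \<le> root_bound n \<and> root_bound n \<le> 1"
proof (induction n)
  case (Suc n)
  then have "(root_bound n)\<^sup>2 \<le> 1" by (simp add: power_le_one)
  then show ?case by simp
qed simp

lemma root_bound_mono: "root_bound n \<le> root_bound (Suc n)"
proof -
  have "0 \<le> (1 - root_bound n)\<^sup>2" by simp
  then show ?thesis by (simp add: power2_eq_square algebra_simps)
qed

lemma root_bound_steps: "(\<lambda>n. root_bound (Suc n) - root_bound n) \<longlonglongrightarrow> 0"
proof -
  have "incseq root_bound" by (intro incseq_SucI root_bound_mono)
  then have "convergent root_bound"
    using root_bound_le by (intro Bseq_monoseq_convergent BseqI'[of _ 1] incseq_imp_monoseq) auto
  then obtain L where L: "root_bound \<longlonglongrightarrow> L" by (auto simp: convergent_def)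
  show ?thesis using tendsto_diff[OF LIMSEQ_Suc[OF L] L] by simp
qed

lemma root_iter_commute: "y * z = z * y \<Longrightarrow> y * root_iter z n = root_iter z n * y"
proof (induction n)
  case (Suc n)
  then have "y * (root_iter z n * root_iter z n) = root_iter z n * root_iter z n * y"
    by (metis mult.assoc)
  then show ?case using Suc by (simp add: algebra_simps)
qed simp

lemma root_iter_star: "star z = z \<Longrightarrow> star (root_iter z n) = root_iter z n"
  by (induction n) (simp_all add: star_scaleR star_add star_mult)

lemma root_iter_le: "N z \<le> 1 \<Longrightarrow> N (root_iter z n) \<le> root_bound n"
proof (induction n)
  case (Suc n)
  have "N (root_iter z n * root_iter z n) \<le> (root_bound n)\<^sup>2"
    using submult[of "root_iter z n" "root_iter z n"] mult_mono[OF Suc.IH Suc.IH]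
      Suc.prems root_bound_le[of n]
    by (simp add: power2_eq_square)
  then show ?case using triangle[of z "root_iter z n * root_iter z n"] Suc.prems by simp
qed simp

lemma root_iter_step_le:
  "N z \<le> 1 \<Longrightarrow> N (root_iter z (Suc n) - root_iter z n) \<le> root_bound (Suc n) - root_bound n"
proof (induction n)
  case 0
  then show ?case by simp
next
  case (Suc n)
  let ?c = "root_iter z n" and ?d = "root_iter z (Suc n)"
  have comm: "?d * ?c = ?c * ?d"
    by (intro root_iter_commute root_iter_commute[symmetric]) simp
  have "root_iter z (Suc (Suc n)) - ?d = (1/2) *\<^sub>R (?d * ?d - ?c * ?c)"
    by (simp add: algebra_simps)
  also have "\<dots> = (1/2) *\<^sub>R ((?d - ?c) * (?d + ?c))"
    using comm by (simp del: root_iter.simps add: algebra_simps)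
  finally have "N (root_iter z (Suc (Suc n)) - ?d) = N ((?d - ?c) * (?d + ?c)) / 2" by simp
  also have "\<dots> \<le> (root_bound (Suc n) - root_bound n) * (root_bound (Suc n) + root_bound n) / 2"
    using submult[of "?d - ?c" "?d + ?c"] Suc.IH[OF Suc.prems] triangle[of ?d ?c]
      root_iter_le[OF Suc.prems, of n] root_iter_le[OF Suc.prems, of "Suc n"]
      mult_mono[of "N (?d - ?c)" "root_bound (Suc n) - root_bound n" "N (?d + ?c)" "root_bound (Suc n) + root_bound n"]
      root_bound_mono[of n]
    by (simp del: root_iter.simps root_bound.simps)
  also have "\<dots> = root_bound (Suc (Suc n)) - root_bound (Suc n)"
    by (simp add: power2_eq_square field_simps)
  finally show ?case .
qed

text \<open>
  The square of \<open>g = 1 - c\<close>, for \<open>c\<close> an iterate, misses \<open>1 - z\<close> by twice the next step of the iteration. The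
  last conclusion holds because \<open>g\<close> is a polynomial in \<open>z\<close>; it makes roots of commuting elements commute.
\<close>

lemma approx_root_one_minus:
  assumes "star z = z" "N z \<le> 1" "0 < e"
  obtains g where "star g = g" "N (g * g - (1 - z)) < e" "\<And>y. y * z = z * y \<Longrightarrow> y * g = g * y"
proof -
  obtain n where n: "root_bound (Suc n) - root_bound n < e / 2"
    using LIMSEQ_D[OF root_bound_steps, of "e/2"] assms(3) root_bound_mono
    by (metis diff_zero half_gt_zero le_refl norm_ge_zero real_norm_def abs_of_nonneg diff_ge_0_iff_ge)
  let ?c = "root_iter z n"
  define g where "g = 1 - ?c"
  have "star g = g" by (simp add: g_def star_diff root_iter_star assms)
  moreover have "g * g - (1 - z) = 2 *\<^sub>R (root_iter z (Suc n) - ?c)"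
    by (simp add: g_def algebra_simps scaleR_2)
  then have "N (g * g - (1 - z)) < e"
    using n root_iter_step_le[OF assms(2), of n] by (simp del: root_iter.simps root_bound.simps)
  moreover have "y * g = g * y" if "y * z = z * y" for y
    using root_iter_commute[OF that, of n] by (simp add: g_def algebra_simps)
  ultimately show ?thesis using that by blast
qed

text \<open>
  This is the usual description of positive elements by norms alone: the spectrum lies in \<open>[0, 2r]\<close>.
  With it the sum of positive elements is positive by the triangle inequality, and they have approximate
  square roots by the lemma above.
\<close>

definition pos :: "'a \<Rightarrow> bool" where
  "pos a \<longleftrightarrow> star a = a \<and> (\<exists>r>0. N (r *\<^sub>R 1 - a) \<le> r)"

lemma pos_star: "pos a \<Longrightarrow> star a = a"
  by (simp add: pos_def)

lemma pos_approx_root: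
  assumes "pos a" "0 < e"
  obtains g where "star g = g" "N (g * g - a) < e" "\<And>y. y * a = a * y \<Longrightarrow> y * g = g * y"
proof -
  obtain r where r: "0 < r" "N (r *\<^sub>R 1 - a) \<le> r" and sa: "star a = a"
    using assms by (auto simp: pos_def)
  define z where "z = 1 - (1/r) *\<^sub>R a"
  have rz: "r *\<^sub>R z = r *\<^sub>R 1 - a" using r by (simp add: z_def scaleR_diff_right)
  have "r * N z \<le> r" using r scale[of r z] unfolding rz by simp
  then have z: "N z \<le> 1" "star z = z" using r sa by (simp_all add: z_def star_diff star_scaleR)
  obtain g where g: "star g = g" "N (g * g - (1 - z)) < e / r" "\<And>y. y * z = z * y \<Longrightarrow> y * g = g * y"
    by (rule approx_root_one_minus[OF z(2,1) divide_pos_pos[OF assms(2) r(1)]]) blast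
  let ?h = "sqrt r *\<^sub>R g"
  have "?h * ?h - a = r *\<^sub>R (g * g - (1 - z))"
    using r by (simp add: z_def scaleR_diff_right)
  then have "N (?h * ?h - a) < e" using g(2) r(1) by (simp only: scale) (simp add: field_simps)
  moreover have "y * ?h = ?h * y" if "y * a = a * y" for y
    using g(3)[of y] that by (simp add: z_def algebra_simps)
  ultimately show ?thesis using that[of ?h] g(1) by (simp add: star_scaleR)
qed

lemma pos_real_minus: "star a = a \<Longrightarrow> N a \<le> r \<Longrightarrow> pos (r *\<^sub>R 1 - a)"
  unfolding pos_def
  by (rule conjI, simp add: star_diff star_scaleR, rule exI[of _ "r + 1"])
    (use triangle[of 1 a] nonneg[of a] one_le in \<open>auto simp: algebra_simps simp del: nonneg\<close>)

text \<open>
  After scaling, \<open>z = b\<^sup>2\<close> has norm at most \<open>1\<close>, and \<open>1 - z\<close> is close to \<open>g\<^sup>2\<close> with \<open>g\<close> commuting with \<open>b\<close>. Since \<open>g\<^sup>2 + b\<^sup>2\<close>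
  is close to \<open>1\<close>, the norm of \<open>g\<^sup>2\<close> is at most about \<open>1\<close>.
\<close>

lemma pos_square:
  assumes "star b = b"
  shows "pos (b * b)"
proof -
  define r where "r = (N b)\<^sup>2 + 1"
  have r: "r > 0" by (simp add: r_def add_nonneg_pos)
  define z where "z = (1/r) *\<^sub>R (b * b)"
  have "N (b * b) \<le> r" unfolding r_def square[OF assms] by simp
  then have z: "star z = z" "N z \<le> 1"
    using r by (simp_all add: z_def star_scaleR star_mult assms)
  have "N (1 - z) \<le> 1 + e" if e: "e > 0" for e
  proof -
    obtain g where g: "star g = g" "N (g * g - (1 - z)) < e/2" "\<And>y. y * z = z * y \<Longrightarrow> y * g = g * y"
      by (rule approx_root_one_minus[OF z half_gt_zero[OF e]]) blast
    define c where "c = (1 / sqrt r) *\<^sub>R b"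
    have cc: "c * c = z" using r by (simp add: c_def z_def)
    have "g * c = c * g" using g(3)[of c] unfolding cc[symmetric] mult.assoc by simp
    then have "(N g)\<^sup>2 \<le> N (g * g + c * c)"
      using commuting_square_le[of g c] g(1) assms by (simp add: c_def star_scaleR)
    also have "\<dots> \<le> N 1 + N (g * g - (1 - z))"
      using triangle[of 1 "g * g - (1 - z)"] cc by simp
    finally have "N (g * g) \<le> 1 + e/2" using one_le g(1,2) by (simp add: square)
    then show ?thesis using le_diff[of "1 - z" "g * g"] g(2) by (simp add: minus_commute)
  qed
  then have "N (1 - z) \<le> 1" by (rule field_le_epsilon)
  moreover have "r *\<^sub>R 1 - b * b = r *\<^sub>R (1 - z)" using r by (simp add: z_def scaleR_diff_right)
  ultimately have "N (r *\<^sub>R 1 - b * b) \<le> r" using r by simp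
  then show ?thesis using r assms by (auto simp: pos_def star_mult)
qed

lemma pos_add:
  assumes "pos a" "pos b"
  shows "pos (a + b)"
proof -
  obtain r q where "r > 0" "N (r *\<^sub>R 1 - a) \<le> r" "q > 0" "N (q *\<^sub>R 1 - b) \<le> q"
    using assms by (auto simp: pos_def)
  then show ?thesis
    using assms triangle[of "r *\<^sub>R 1 - a" "q *\<^sub>R 1 - b"]
    unfolding pos_def by (intro conjI exI[of _ "r + q"]) (simp_all add: star_add algebra_simps)
qed

lemma pos_zero: "pos 0"
  using pos_square[of 0] by simp

lemma pos_sum: "(\<And>i. i \<in> I \<Longrightarrow> pos (f i)) \<Longrightarrow> pos (sum f I)"
  by (induction I rule: infinite_finite_induct) (auto intro: pos_add pos_zero)

lemma pos_scale:
  assumes "pos a" "0 \<le> r"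
  shows "pos (r *\<^sub>R a)"
proof (cases "r = 0")
  case False
  obtain q where q: "q > 0" "N (q *\<^sub>R 1 - a) \<le> q" using assms by (auto simp: pos_def)
  have "(r * q) *\<^sub>R 1 - r *\<^sub>R a = r *\<^sub>R (q *\<^sub>R 1 - a)" by (simp add: scaleR_diff_right)
  then have "N ((r * q) *\<^sub>R 1 - r *\<^sub>R a) \<le> r * q" using q assms by (simp add: mult_left_mono)
  then show ?thesis using assms False q unfolding pos_def
    by (intro conjI exI[of _ "r * q"]) (auto simp: star_scaleR)
qed (simp add: pos_zero)

lemma pos_real: "0 \<le> r \<Longrightarrow> pos (r *\<^sub>R 1)"
  using pos_scale[OF pos_square[of 1], of r] by simp

text \<open>
  Approximate roots \<open>f\<^sup>2 \<approx> r - m\<close> and \<open>g\<^sup>2 \<approx> r + m\<close> commute, and \<open>2m \<approx> g\<^sup>2 - f\<^sup>2\<close> while \<open>g\<^sup>2 + f\<^sup>2 \<approx> 2r\<close>.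
\<close>

lemma le_if_pos_between:
  assumes "pos (r *\<^sub>R 1 - m)" "pos (r *\<^sub>R 1 + m)" "0 \<le> r"
  shows "N m \<le> r"
proof (rule field_le_epsilon)
  fix e :: real assume e: "0 < e"
  obtain f where f: "star f = f" "N (f * f - (r *\<^sub>R 1 - m)) < e/2"
    "\<And>y. y * (r *\<^sub>R 1 - m) = (r *\<^sub>R 1 - m) * y \<Longrightarrow> y * f = f * y"
    by (rule pos_approx_root[OF assms(1) half_gt_zero[OF e]]) blast
  obtain g where g: "star g = g" "N (g * g - (r *\<^sub>R 1 + m)) < e/2"
    "\<And>y. y * (r *\<^sub>R 1 + m) = (r *\<^sub>R 1 + m) * y \<Longrightarrow> y * g = g * y"
    by (rule pos_approx_root[OF assms(2) half_gt_zero[OF e]]) blast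
  have "m * f = f * m" using f(3)[of m] by (simp add: algebra_simps)
  then have comm: "f * g = g * f" using g(3)[of f] by (simp add: algebra_simps)
  define d where "d = (f * f - (r *\<^sub>R 1 - m)) - (g * g - (r *\<^sub>R 1 + m))"
  define d' where "d' = (f * f - (r *\<^sub>R 1 - m)) + (g * g - (r *\<^sub>R 1 + m))"
  have d: "N d \<le> e" "N d' \<le> e"
    using triangle_diff[of "f * f - (r *\<^sub>R 1 - m)" "g * g - (r *\<^sub>R 1 + m)"]
      triangle[of "f * f - (r *\<^sub>R 1 - m)" "g * g - (r *\<^sub>R 1 + m)"] f(2) g(2)
    by (simp_all add: d_def d'_def)
  have "2 *\<^sub>R m = (g * g - f * f) + d" by (simp add: scaleR_2 d_def)
  then have "2 * N m \<le> N (g * g - f * f) + N d"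
    using triangle[of "g * g - f * f" d] scale[of 2 m] by simp
  moreover have "N (g * g - f * f) \<le> N (g * g + f * f)"
    using commuting_squares_diff[of g f] f(1) g(1) comm by simp
  moreover have "g * g + f * f = (2 * r) *\<^sub>R 1 + d'"
    unfolding d'_def mult_2 scaleR_left_distrib by simp
  then have "N (g * g + f * f) \<le> 2 * r * N 1 + N d'"
    using triangle[of "(2 * r) *\<^sub>R 1" d'] assms(3) by simp
  moreover have "r * N 1 \<le> r" using one_le assms(3) by (simp add: mult_left_le)
  ultimately show "N m \<le> r + e" using d by simp
qed

text \<open>
  With \<open>M = \<parallel>a + b\<parallel>\<close> the element \<open>M - a = (M - (a + b)) + b\<close> is positive.
\<close>

lemma pos_le_add:
  assumes "pos a" "pos b"
  shows "N a \<le> N (a + b)"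
proof (rule le_if_pos_between)
  have "pos ((N (a + b) *\<^sub>R 1 - (a + b)) + b)"
    using assms by (intro pos_add pos_real_minus) (simp_all add: pos_star star_add)
  then show "pos (N (a + b) *\<^sub>R 1 - a)" by (simp add: algebra_simps)
  show "pos (N (a + b) *\<^sub>R 1 + a)" by (intro pos_add pos_real assms) simp
qed simp

lemma one_minus_square_le:
  assumes "star b = b" "N b \<le> 1"
  shows "N (1 - b * b) \<le> 1"
proof -
  have "N (b * b) \<le> 1" using square[OF assms(1)] assms(2) by (simp add: power_le_one)
  then have "pos (1 - b * b)" using pos_real_minus[of "b * b" 1] assms(1) by (simp add: star_mult)
  then show ?thesis using pos_le_add[OF _ pos_square[OF assms(1)], of "1 - b * b"] one_le by simp
qed

text \<open>
  This is \<open>y (1 - y) \<le> 1/4\<close> for \<open>y = b\<^sup>2\<close>, read off from \<open>4 y (1 - y) = 1 - (1 - 2y)\<^sup>2\<close>.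
\<close>

lemma quarter_bound:
  assumes "star b = b" "N b \<le> 1"
  shows "N (b * b * (1 - b * b)) \<le> 1/4"
proof -
  define m where "m = 1 - 2 *\<^sub>R (b * b)"
  have bb: "N (b * b) \<le> 1" using square[OF assms(1)] assms(2) by (simp add: power_le_one)
  have sm: "star m = m" by (simp add: m_def star_diff star_scaleR star_mult assms)
  have "pos (2 *\<^sub>R (b * b))" by (intro pos_scale pos_square assms) simp
  moreover have "pos (2 *\<^sub>R (1 - b * b))"
    using pos_scale[OF pos_real_minus[of "b * b" 1], of 2] bb assms(1) by (simp add: star_mult)
  ultimately have "N m \<le> 1"
    by (intro le_if_pos_between) (simp_all add: m_def algebra_simps scaleR_2)
  then have "N (1 - m * m) \<le> 1" using one_minus_square_le[OF sm] by simp
  moreover have "1 - m * m = 4 *\<^sub>R (b * b * (1 - b * b))"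
  proof -
    have four: "4 *\<^sub>R x = x + x + (x + x)" for x :: 'a
      using scaleR_left_distrib[of 2 2 x] scaleR_2[of x] by simp
    show ?thesis unfolding four by (simp add: m_def algebra_simps scaleR_2)
  qed
  ultimately show ?thesis by simp
qed

text \<open>
  The damping step. In terms of \<open>b \<in> [0,1]\<close> the square of the damped element has size
  \<open>R\<^sup>2 b (1 - b\<^sup>2)\<^sup>2\<close>, and \<open>b (1 - b\<^sup>2) \<le> 1/2\<close>.
\<close>

lemma halving:
  assumes "N x \<le> R" "0 < R"
  defines "b \<equiv> (1 / R\<^sup>2) *\<^sub>R (star x * x)"
  shows "star b = b" "N b \<le> 1" "N (1 - b * b) \<le> 1" "N (x * (1 - b * b)) \<le> R / sqrt 2"
proof -
  show sb: "star b = b" by (simp add: b_def star_scaleR star_mult)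
  have "N b = (N x)\<^sup>2 / R\<^sup>2" by (simp add: b_def cstar)
  also have "\<dots> \<le> 1" using assms by (simp add: power_mono)
  finally show b: "N b \<le> 1" .
  define y where "y = 1 - b * b"
  show y: "N (1 - b * b) \<le> 1" by (rule one_minus_square_le[OF sb b])
  have sy: "star y = y" by (simp add: y_def star_diff star_mult sb)
  have byy: "b * y = y * b" by (simp add: y_def algebra_simps)
  have "star (b * y) * (b * y) = (b * b * y) * y"
    by (simp add: star_mult sb sy) (metis byy mult.assoc)
  then have "(N (b * y))\<^sup>2 = N (b * b * y * y)" by (metis cstar)
  also have "\<dots> \<le> N (b * b * y) * N y" by (rule submult)
  also have "\<dots> \<le> 1/4 * 1"
    using quarter_bound[OF sb b] y by (intro mult_mono) (simp_all add: y_def)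
  finally have "(N (b * y))\<^sup>2 \<le> (1/2)\<^sup>2" by (simp add: power2_eq_square)
  then have by2: "N (b * y) \<le> 1/2" by (rule power2_le_imp_le) simp
  have "star (x * y) * (x * y) = R\<^sup>2 *\<^sub>R (y * (b * y))"
    using assms(2) by (simp add: b_def star_mult sy mult.assoc)
  then have "(N (x * y))\<^sup>2 = R\<^sup>2 * N (y * (b * y))" by (metis cstar scale abs_power2)
  moreover have "N (y * (b * y)) \<le> 1/2"
    using submult[of y "b * y"] mult_mono[of "N y" 1 "N (b * y)" "1/2"] y by2 by (simp add: y_def)
  ultimately have "(N (x * y))\<^sup>2 \<le> (R / sqrt 2)\<^sup>2"
    using mult_left_mono[of "N (y * (b * y))" "1/2" "R\<^sup>2"] by (simp add: power_divide)
  then show "N (x * (1 - b * b)) \<le> R / sqrt 2"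
    unfolding y_def by (rule power2_le_imp_le) (use assms(2) in simp)
qed

end

section \<open>Lifting and quotients\<close>

text \<open>
  This is why *-homomorphisms have closed range: an element of size \<open>1\<close> in the smaller seminorm \<open>M\<close> agrees up
  to a small \<open>M\<close>-error with an element that is bounded in the larger seminorm \<open>N\<close>. The element is damped until
  its \<open>N\<close>-norm is at most \<open>2\<close>. A damping step at level \<open>R\<close> changes it by at most \<open>R\<^sup>-\<^sup>4\<close> in \<open>M\<close>, since there
  \<open>\<parallel>b\<parallel> \<le> R\<^sup>-\<^sup>2\<close>, and divides \<open>R\<close> by \<open>\<surd>2\<close>; for levels \<open>R = 2 \<surd>2\<^sup>m\<close> these errors form a geometric series with sum at
  most \<open>1/48\<close>.
\<close>

lemma lift_bounded:
  assumes "cstar_seminorm N" "cstar_seminorm M" "\<And>x. M x \<le> N x" "M x \<le> 1"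
  obtains x' where "N x' \<le> 2" "M (x - x') \<le> 1/48"
proof -
  interpret N: cstar_seminorm N by fact
  interpret M: cstar_seminorm M by fact
  have step: "\<exists>x'. N x' \<le> 2 \<and> M (x - x') \<le> (1 - (1/4)^m) / 48"
    if "M x \<le> 1" "N x \<le> 2 * sqrt 2 ^ m" for m x
    using that
  proof (induction m arbitrary: x)
    case 0
    then show ?case by (intro exI[of _ x]) simp
  next
    case (Suc m)
    define R :: real where "R = 2 * sqrt 2 ^ Suc m"
    have R0: "0 < R" by (simp add: R_def)
    have R2: "R\<^sup>2 = 4 * 2 ^ Suc m"
      by (simp add: R_def power_mult_distrib power2_eq_square[of "sqrt 2 ^ m"] power_add[symmetric] mult_2[symmetric] power_mult)
    have R1: "1 \<le> R" using R2 R0 by (smt (verit) one_le_power power2_eq_square mult_le_one)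
    define b where "b = (1 / R\<^sup>2) *\<^sub>R (star x * x)"
    define y where "y = 1 - b * b"
    have NR: "N x \<le> R" using Suc.prems by (simp add: R_def)
    have MR: "M x \<le> R" using assms(3)[of x] NR by simp
    note hN = N.halving[OF NR R0, folded b_def, folded y_def]
    note hM = M.halving[OF MR R0, folded b_def, folded y_def]
    have "N (x * y) \<le> 2 * sqrt 2 ^ m" using hN(4) by (simp add: R_def field_simps)
    moreover have "M (x * y) \<le> 1"
      using M.submult[of x y] mult_mono[of "M x" 1 "M y" 1] Suc.prems(1) hM(3) by simp
    ultimately obtain x' where x': "N x' \<le> 2" "M (x * y - x') \<le> (1 - (1/4)^m) / 48"
      using Suc.IH by blast
    have "M b \<le> 1 / R\<^sup>2"
      using Suc.prems(1) by (simp add: b_def M.cstar divide_right_mono power_le_one)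
    moreover have "1 / R\<^sup>2 = (1/2)^m / 8" by (simp add: R2 field_simps)
    ultimately have "M b \<le> (1/2)^m / 8" by simp
    then have "M b * M b \<le> ((1/2)^m / 8) * ((1/2)^m / 8)" by (intro mult_mono) simp_all
    also have "\<dots> = (1/4)^m / 64" by (simp add: power_mult_distrib[symmetric])
    finally have "M (b * b) \<le> (1/4)^m / 64" using M.submult[of b b] by simp
    moreover have "x - x * y = x * (b * b)" by (simp add: y_def algebra_simps)
    then have "M (x - x * y) \<le> M (b * b)"
      using M.submult[of x "b * b"] mult_right_mono[OF Suc.prems(1), of "M (b * b)"] by simp
    moreover have "M (x - x') \<le> M (x - x * y) + M (x * y - x')"
      using M.triangle[of "x - x * y" "x * y - x'"] by simp
    ultimately have "M (x - x') \<le> (1/4)^m / 64 + (1 - (1/4)^m) / 48"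
      using x'(2) by linarith
    also have "\<dots> = (1 - (1/4)^Suc m) / 48" by (simp add: field_simps)
    finally show ?case using x'(1) by blast
  qed
  obtain m where "N x / 2 < sqrt 2 ^ m" using real_arch_pow[of "sqrt 2" "N x / 2"] by auto
  then obtain x' where "N x' \<le> 2" "M (x - x') \<le> (1 - (1/4)^m) / 48"
    using step[of x m] assms(4) by auto
  moreover have "(1 - (1/4)^m) / 48 \<le> (1/48::real)" by simp
  ultimately show ?thesis using that by (meson order_trans)
qed

lemma lift_scaled:
  assumes "cstar_seminorm N" "cstar_seminorm M" "\<And>x. M x \<le> N x" "M x \<le> d" "0 < d"
  obtains x' where "N x' \<le> 2 * d" "M (x - x') \<le> d/48"
proof -
  interpret N: cstar_seminorm N by fact
  interpret M: cstar_seminorm M by fact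
  have "M ((1/d) *\<^sub>R x) \<le> 1" using assms(4,5) by simp
  then obtain z where z: "N z \<le> 2" "M ((1/d) *\<^sub>R x - z) \<le> 1/48"
    using lift_bounded[OF assms(1-3)] by blast
  have "x - d *\<^sub>R z = d *\<^sub>R ((1/d) *\<^sub>R x - z)" using assms(5) by (simp add: scaleR_diff_right)
  then have "M (x - d *\<^sub>R z) \<le> d/48" using z(2) assms(5) by simp
  moreover have "N (d *\<^sub>R z) \<le> 2 * d" using z(1) assms(5) by simp
  ultimately show ?thesis using that by blast
qed

definition star_ideal :: "'a::complex_star_algebra set \<Rightarrow> bool" where
  "star_ideal I \<longleftrightarrow> 0 \<in> I \<and> (\<forall>x\<in>I. \<forall>y\<in>I. x + y \<in> I) \<and> (\<forall>x\<in>I. star x \<in> I) \<and>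
     (\<forall>x\<in>I. \<forall>y. x * y \<in> I \<and> y * x \<in> I)"

lemma star_idealD:
  assumes "star_ideal I"
  shows "0 \<in> I" "x \<in> I \<Longrightarrow> y \<in> I \<Longrightarrow> x + y \<in> I" "x \<in> I \<Longrightarrow> star x \<in> I"
    "x \<in> I \<Longrightarrow> x * y \<in> I" "x \<in> I \<Longrightarrow> y * x \<in> I"
  using assms by (auto simp: star_ideal_def)

lemma star_ideal_scaleR: "star_ideal I \<Longrightarrow> x \<in> I \<Longrightarrow> r *\<^sub>R x \<in> I"
  unfolding star_ideal_def by (metis mult_scaleR_left mult_1_left)

lemma star_ideal_minus: "star_ideal I \<Longrightarrow> x \<in> I \<Longrightarrow> - x \<in> I"
  using star_ideal_scaleR[of I x "-1"] by simp

context cstar_seminorm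
begin

text \<open>
  The product of the damping factors is an element \<open>y\<close> that is \<open>1\<close> modulo the ideal and almost annihilates \<open>x\<close>; \<open>1 - y\<close>
  plays the role of an approximate unit of the ideal.
\<close>

lemma damping:
  assumes "star_ideal I" "x \<in> I" "0 < e"
  obtains y where "N y \<le> 1" "1 - y \<in> I" "N (x * y) \<le> e"
proof -
  have step: "\<exists>y. N y \<le> 1 \<and> 1 - y \<in> I \<and> N (x * y) \<le> R / sqrt 2 ^ m" if "N x \<le> R" "0 < R" "x \<in> I" for m R x
    using that
  proof (induction m arbitrary: x R)
    case 0
    then show ?case using assms(1) one_le by (intro exI[of _ 1]) (auto simp: star_ideal_def)
  next
    case (Suc m)
    define b where "b = (1 / R\<^sup>2) *\<^sub>R (star x * x)"
    define y where "y = 1 - b * b"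
    note h = halving[OF Suc.prems(1,2), folded b_def, folded y_def]
    have "b \<in> I" unfolding b_def using assms(1) Suc.prems(3)
      by (intro star_ideal_scaleR) (auto simp: star_ideal_def)
    then have yI: "1 - y \<in> I" using assms(1) by (auto simp: y_def star_ideal_def)
    have "x * y \<in> I" using assms(1) Suc.prems(3) by (auto simp: star_ideal_def)
    then obtain z where z: "N z \<le> 1" "1 - z \<in> I" "N (x * y * z) \<le> R / sqrt 2 / sqrt 2 ^ m"
      using Suc.IH[OF h(4)] Suc.prems(2) by auto
    have "1 - y * z = (1 - y) + y * (1 - z)" by (simp add: algebra_simps)
    then have "1 - y * z \<in> I" using star_idealD[OF assms(1)] yI z(2) by metis
    moreover have "N (y * z) \<le> 1"
      using submult[of y z] mult_mono[of "N y" 1 "N z" 1] h(3) z(1) by simp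
    ultimately show ?case using z(3) by (intro exI[of _ "y * z"]) (simp add: mult.assoc)
  qed
  obtain m where "(N x + 1) / e < sqrt 2 ^ m" using real_arch_pow[of "sqrt 2" "(N x + 1) / e"] by auto
  then have "(N x + 1) / sqrt 2 ^ m \<le> e" using assms(3) by (simp add: field_simps)
  then show ?thesis using step[of x "N x + 1" m] assms(2) that
    by (smt (verit) nonneg)
qed

definition quotient_seminorm :: "'a set \<Rightarrow> 'a \<Rightarrow> real" where
  "quotient_seminorm I x = (INF i\<in>I. N (x + i))"

lemma quotient_seminorm_le: "i \<in> I \<Longrightarrow> quotient_seminorm I x \<le> N (x + i)"
  unfolding quotient_seminorm_def by (rule cINF_lower) (auto intro: bdd_belowI[of _ 0])

lemma quotient_seminorm_witness:
  assumes "star_ideal I" "quotient_seminorm I x < r"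
  obtains i where "i \<in> I" "N (x + i) < r"
proof -
  have "I \<noteq> {}" using assms(1) by (auto simp: star_ideal_def)
  then show ?thesis using assms(2) that unfolding quotient_seminorm_def
    by (subst (asm) cINF_less_iff) (auto intro: bdd_belowI[of _ 0])
qed

lemma quotient_seminorm_nonneg: "star_ideal I \<Longrightarrow> 0 \<le> quotient_seminorm I x"
  unfolding quotient_seminorm_def by (rule cINF_greatest) (auto simp: star_ideal_def)

lemma quotient_seminorm_le_self: "star_ideal I \<Longrightarrow> quotient_seminorm I x \<le> N x"
  using quotient_seminorm_le[of 0 I x] by (simp add: star_ideal_def)

lemma quotient_seminorm_null:
  assumes "star_ideal I" "x \<in> I"
  shows "quotient_seminorm I x = 0"
  using quotient_seminorm_le[OF star_ideal_minus[OF assms], of x] quotient_seminorm_nonneg[OF assms(1), of x]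
  by simp

text \<open>
  If \<open>\<parallel>x\<^sup>*x + i\<parallel>\<close> is almost minimal and \<open>y\<close> damps \<open>i\<close>, then \<open>x y\<close> represents the class of \<open>x\<close>, and
  \<open>\<parallel>x y\<parallel>\<^sup>2 = \<parallel>y\<^sup>* (x\<^sup>*x + i) y - y\<^sup>* i y\<parallel>\<close> is at most \<open>\<parallel>x\<^sup>*x + i\<parallel>\<close> up to a small error.
\<close>

lemma quotient_seminorm_cstar_le:
  assumes I: "star_ideal I"
  shows "(quotient_seminorm I x)\<^sup>2 \<le> quotient_seminorm I (star x * x)"
proof (rule field_le_epsilon)
  let ?Q = "quotient_seminorm I"
  fix e :: real assume e: "0 < e"
  obtain i where i: "i \<in> I" "N (star x * x + i) < ?Q (star x * x) + e/2"
    using quotient_seminorm_witness[OF I, of "star x * x" "?Q (star x * x) + e/2"] e by auto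
  obtain y where y: "N y \<le> 1" "1 - y \<in> I" "N (i * y) \<le> e/2"
    using damping[OF I i(1), of "e/2"] e by auto
  have "x * y = x + - (x * (1 - y))" by (simp add: algebra_simps)
  moreover have "- (x * (1 - y)) \<in> I"
    by (intro star_ideal_minus star_idealD I y)
  ultimately have "?Q x \<le> N (x * y)" by (metis quotient_seminorm_le)
  then have "(?Q x)\<^sup>2 \<le> (N (x * y))\<^sup>2"
    by (intro power_mono quotient_seminorm_nonneg[OF I])
  also have "\<dots> = N (star y * (star x * x + i) * y - star y * (i * y))"
    unfolding cstar[symmetric] by (simp add: star_mult algebra_simps)
  also have "\<dots> \<le> N (star y * (star x * x + i) * y) + N (star y * (i * y))"
    by (rule triangle_diff)
  also have "\<dots> \<le> N (star x * x + i) + N (i * y)"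
  proof (rule add_mono)
    have "N (star y * (star x * x + i) * y) \<le> N (star y) * N (star x * x + i) * N y"
      by (meson mult_right_mono nonneg order_trans submult)
    also have "\<dots> \<le> 1 * N (star x * x + i) * 1"
      using y(1) by (intro mult_mono) simp_all
    finally show "N (star y * (star x * x + i) * y) \<le> N (star x * x + i)" by simp
    show "N (star y * (i * y)) \<le> N (i * y)"
      using submult[of "star y" "i * y"] mult_right_mono[OF y(1), of "N (i * y)"] by simp
  qed
  also have "\<dots> \<le> ?Q (star x * x) + e" using i(2) y(3) by simp
  finally show "(?Q x)\<^sup>2 \<le> ?Q (star x * x) + e" .
qed

lemma cstar_quotient_seminorm:
  assumes I: "star_ideal I"
  shows "cstar_seminorm (quotient_seminorm I)"
proof
  let ?Q = "quotient_seminorm I"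
  note nn = quotient_seminorm_nonneg[OF I]
  show add: "?Q (x + y) \<le> ?Q x + ?Q y" for x y
  proof (rule field_le_epsilon)
    fix e :: real assume e: "0 < e"
    obtain i where i: "i \<in> I" "N (x + i) < ?Q x + e/2"
      using quotient_seminorm_witness[OF I, of x "?Q x + e/2"] e by auto
    obtain j where j: "j \<in> I" "N (y + j) < ?Q y + e/2"
      using quotient_seminorm_witness[OF I, of y "?Q y + e/2"] e by auto
    have "?Q (x + y) \<le> N ((x + y) + (i + j))"
      by (rule quotient_seminorm_le) (use I i(1) j(1) in \<open>auto simp: star_ideal_def\<close>)
    also have "\<dots> = N ((x + i) + (y + j))" by (simp add: algebra_simps)
    also have "\<dots> \<le> N (x + i) + N (y + j)" by (rule triangle)
    finally show "?Q (x + y) \<le> ?Q x + ?Q y + e" using i(2) j(2) by simp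
  qed
  have scale_le: "?Q (r *\<^sub>R x) \<le> \<bar>r\<bar> * ?Q x" for r x
  proof (rule field_le_epsilon)
    fix e :: real assume e: "0 < e"
    obtain i where i: "i \<in> I" "N (x + i) < ?Q x + e / (\<bar>r\<bar> + 1)"
      using quotient_seminorm_witness[OF I, of x "?Q x + e / (\<bar>r\<bar> + 1)"] e by auto
    have "?Q (r *\<^sub>R x) \<le> N (r *\<^sub>R x + r *\<^sub>R i)"
      by (intro quotient_seminorm_le star_ideal_scaleR I i)
    also have "\<dots> = \<bar>r\<bar> * N (x + i)" by (simp add: scaleR_add_right[symmetric])
    also have "\<dots> \<le> \<bar>r\<bar> * (?Q x + e / (\<bar>r\<bar> + 1))" using i(2) by (intro mult_left_mono) auto
    also have "\<dots> \<le> \<bar>r\<bar> * ?Q x + e" using e by (simp add: field_simps)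
    finally show "?Q (r *\<^sub>R x) \<le> \<bar>r\<bar> * ?Q x + e" .
  qed
  show "?Q (r *\<^sub>R x) = \<bar>r\<bar> * ?Q x" for r x
  proof (cases "r = 0")
    case True
    then show ?thesis using quotient_seminorm_null[OF I, of 0] I by (simp add: star_ideal_def)
  next
    case False
    have "\<bar>r\<bar> * ?Q x = \<bar>r\<bar> * ?Q ((1/r) *\<^sub>R (r *\<^sub>R x))" using False by simp
    also have "\<dots> \<le> \<bar>r\<bar> * (\<bar>1/r\<bar> * ?Q (r *\<^sub>R x))"
      by (intro mult_left_mono scale_le) simp
    also have "\<dots> = ?Q (r *\<^sub>R x)" using False by simp
    finally show ?thesis using scale_le[of r x] by simp
  qed
  show mult: "?Q (x * y) \<le> ?Q x * ?Q y" for x y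
  proof (rule field_le_epsilon)
    fix e :: real assume e: "0 < e"
    \<comment> \<open>\<open>d\<close> is chosen such that \<open>(Q x + d) (Q y + d) \<le> Q x Q y + e\<close>.\<close>
    define c where "c = ?Q x + ?Q y + 1"
    define d where "d = min 1 (e / c)"
    have c: "0 < c" using nn[of x] nn[of y] by (simp add: c_def)
    then have d: "0 < d" "d \<le> 1" "d * c \<le> e"
      using e by (auto simp: d_def min_def field_simps)
    obtain i where i: "i \<in> I" "N (x + i) < ?Q x + d"
      using quotient_seminorm_witness[OF I, of x "?Q x + d"] d(1) by auto
    obtain j where j: "j \<in> I" "N (y + j) < ?Q y + d"
      using quotient_seminorm_witness[OF I, of y "?Q y + d"] d(1) by auto
    have "?Q (x * y) \<le> N (x * y + (x * j + i * (y + j)))"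
      by (rule quotient_seminorm_le) (use I i(1) j(1) in \<open>auto simp: star_ideal_def\<close>)
    also have "\<dots> = N ((x + i) * (y + j))" by (simp add: algebra_simps)
    also have "\<dots> \<le> N (x + i) * N (y + j)" by (rule submult)
    also have "\<dots> \<le> (?Q x + d) * (?Q y + d)"
      using i(2) j(2) nn[of x] d by (intro mult_mono) auto
    also have "\<dots> = ?Q x * ?Q y + d * (?Q x + ?Q y + d)" by (simp add: algebra_simps)
    also have "\<dots> \<le> ?Q x * ?Q y + d * (?Q x + ?Q y + 1)"
      using d by (intro add_left_mono mult_left_mono) auto
    finally show "?Q (x * y) \<le> ?Q x * ?Q y + e" using d(3) by (simp add: c_def)
  qed
  have st: "?Q (star x) \<le> ?Q x" for x
  proof (rule field_le_epsilon)
    fix e :: real assume e: "0 < e"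
    obtain i where i: "i \<in> I" "N (x + i) < ?Q x + e"
      using quotient_seminorm_witness[OF I, of x "?Q x + e"] e by auto
    have "?Q (star x) \<le> N (star x + star i)"
      by (rule quotient_seminorm_le) (use I i(1) in \<open>auto simp: star_ideal_def\<close>)
    also have "\<dots> = N (x + i)" by (metis star_add star_eq)
    finally show "?Q (star x) \<le> ?Q x + e" using i(2) by simp
  qed
  show "?Q (star x * x) = (?Q x)\<^sup>2" for x
  proof (rule antisym)
    show "?Q (star x * x) \<le> (?Q x)\<^sup>2"
      using mult[of "star x" x] mult_right_mono[OF st[of x] nn[of x]] by (simp add: power2_eq_square)
  qed (rule quotient_seminorm_cstar_le[OF I])
qed

end

section \<open>Projections and generators of norm one\<close>

context cstar_seminorm
begin

definition null_eq :: "'a \<Rightarrow> 'a \<Rightarrow> bool" (infix "\<approx>" 50) where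
  "x \<approx> y \<longleftrightarrow> N (x - y) = 0"

lemma null_eq_refl [simp]: "x \<approx> x" by (simp add: null_eq_def)

lemma null_eq_sym: "x \<approx> y \<Longrightarrow> y \<approx> x" by (simp add: null_eq_def minus_commute)

lemma null_eq_trans [trans]: "x \<approx> y \<Longrightarrow> y \<approx> z \<Longrightarrow> x \<approx> z"
  unfolding null_eq_def by (rule null_trans)

lemma null_eq_add: "x \<approx> x' \<Longrightarrow> y \<approx> y' \<Longrightarrow> x + y \<approx> x' + y'"
  using null_add[of "x - x'" "y - y'"] by (simp add: null_eq_def algebra_simps)

lemma null_eq_scaleR: "x \<approx> x' \<Longrightarrow> r *\<^sub>R x \<approx> r *\<^sub>R x'"
  by (simp add: null_eq_def scaleR_diff_right[symmetric])

lemma null_eq_minus: "x \<approx> x' \<Longrightarrow> - x \<approx> - x'"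
  using null_eq_scaleR[of x x' "-1"] by simp

lemma null_eq_diff: "x \<approx> x' \<Longrightarrow> y \<approx> y' \<Longrightarrow> x - y \<approx> x' - y'"
  using null_eq_add[of x x' "- y" "- y'"] null_eq_minus[of y y'] by simp

lemma null_eq_mult:
  assumes "x \<approx> x'" "y \<approx> y'"
  shows "x * y \<approx> x' * y'"
proof -
  have "x * y - x' * y' = (x - x') * y + x' * (y - y')" by (simp add: algebra_simps)
  then show ?thesis using assms null_add null_mult_left null_mult_right
    by (simp add: null_eq_def)
qed

lemma null_eq_star: "x \<approx> y \<Longrightarrow> star x \<approx> star y"
  unfolding null_eq_def star_diff[symmetric] by simp

lemma null_eq_sum: "(\<And>i. i \<in> I \<Longrightarrow> f i \<approx> g i) \<Longrightarrow> sum f I \<approx> sum g I"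
  unfolding null_eq_def sum_subtractf[symmetric] by (rule null_sum)

lemma null_eq_norm: "x \<approx> y \<Longrightarrow> N x = N y"
  unfolding null_eq_def by (rule eq_if_null_diff)

lemma projection_le_one:
  assumes "star p = p" "p * p \<approx> p"
  shows "N p \<le> 1"
proof -
  have "(N p)\<^sup>2 = N p" using square[OF assms(1)] null_eq_norm[OF assms(2)] by simp
  then have "N p * (N p - 1) = 0" by (simp add: power2_eq_square algebra_simps)
  then show ?thesis by auto
qed

text \<open>
  From \<open>p + q + s = 1\<close> with \<open>s\<close> positive one gets \<open>\<parallel>p + q\<parallel> \<le> 1\<close>. Compressing \<open>(p + q)\<^sup>2\<close> and \<open>1 - q\<close> by \<open>p\<close> gives, for
  \<open>w = p q p\<close>, the bounds \<open>\<parallel>p + 3w\<parallel> \<le> 1\<close> and \<open>\<parallel>p - w\<parallel> \<le> 1\<close>: the eigenvalues of \<open>w\<close> are both \<open>\<le> 0\<close> and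
  \<open>\<ge> 0\<close>. To conclude without spectra, the squares of the two bounds combine to \<open>\<parallel>p + 3w\<^sup>2\<parallel> \<le> 1\<close>, and squaring this
  repeatedly, each time dropping a positive summand, gives \<open>\<parallel>p + 2\<^sup>m 3w\<^sup>2\<parallel> \<le> 1\<close> for all \<open>m\<close>.
\<close>

lemma two_projections_orthogonal:
  assumes p: "star p = p" "p * p \<approx> p" and q: "star q = q" "q * q \<approx> q"
    and s: "pos s" "p + q + s \<approx> 1"
  shows "N (p * q) = 0"
proof -
  define z where "z = p * p + q * q"
  have z_eq: "z \<approx> p + q" unfolding z_def by (intro null_eq_add p q)
  have "z + s \<approx> 1" using null_eq_trans[OF null_eq_add[OF z_eq null_eq_refl[of s]] s(2)] .
  then have "N z \<le> 1"
    using pos_le_add[OF _ s(1), of z] pos_add[OF pos_square[OF p(1)] pos_square[OF q(1)]] one_le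
    by (simp add: z_def null_eq_norm)
  define w where "w = p * q * p"
  have sw: "star w = w" by (simp add: w_def star_mult p q mult.assoc)
  have p1: "N p \<le> 1" by (rule projection_le_one[OF p])
  have pw: "p * w \<approx> w"
    using null_eq_mult[OF p(2) null_eq_refl[of "q * p"]] by (simp add: w_def mult.assoc)
  have wp: "w * p \<approx> w"
    using null_eq_mult[OF null_eq_refl[of "p * q"] p(2)] by (simp add: w_def mult.assoc)
  have a: "N (p + 3 *\<^sub>R w) \<le> 1"
  proof -
    have sz: "star z = z" by (simp add: z_def star_add star_mult p q)
    have "star (z * p) * (z * p) = p * (z * z) * p" by (simp add: star_mult sz p mult.assoc)
    also have "\<dots> \<approx> p * ((p + q) * (p + q)) * p" by (intro null_eq_mult z_eq) simp_all
    also have "p * ((p + q) * (p + q)) * p = p * p * (p * p) + p * w + w * p + p * (q * q) * p"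
      by (simp add: w_def algebra_simps)
    also have "\<dots> \<approx> p * p + w + w + p * q * p"
      by (intro null_eq_add null_eq_mult p q pw wp) simp_all
    also have "\<dots> \<approx> p + w + w + w" unfolding w_def[symmetric] by (intro null_eq_add p) simp_all
    also have "\<dots> = p + 3 *\<^sub>R w" using scaleR_left_distrib[of 1 2 w] by (simp add: scaleR_2)
    finally have "N (p + 3 *\<^sub>R w) = (N (z * p))\<^sup>2" by (metis cstar null_eq_norm)
    moreover have "N (z * p) \<le> 1"
      using submult[of z p] mult_mono[of "N z" 1 "N p" 1] \<open>N z \<le> 1\<close> p1 by simp
    ultimately show ?thesis by (simp add: power_le_one)
  qed
  have b: "N (p - w) \<le> 1"
  proof -
    have "(1 - q) * (1 - q) = 1 - q - q + q * q" by (simp add: algebra_simps)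
    also have "\<dots> \<approx> 1 - q - q + q" by (intro null_eq_add null_eq_refl q)
    finally have "N (1 - q) \<le> 1" by (intro projection_le_one) (simp_all add: star_diff q)
    then have "N (p * (1 - q)) \<le> 1"
      using submult[of p "1 - q"] mult_mono[of "N p" 1 "N (1 - q)" 1] p1 by simp
    then have "N (p * (1 - q) * p) \<le> 1"
      using submult[of "p * (1 - q)" p] mult_mono[of "N (p * (1 - q))" 1 "N p" 1] p1 by simp
    moreover have "p * (1 - q) * p = p * p - w" by (simp add: w_def algebra_simps)
    moreover have "p * p - w \<approx> p - w" by (intro null_eq_diff p null_eq_refl)
    ultimately show ?thesis using null_eq_norm by metis
  qed
  define v where "v = sqrt 3 *\<^sub>R w"
  have sv: "star v = v" by (simp add: v_def star_scaleR sw)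
  have vv: "v * v = 3 *\<^sub>R (w * w)" by (simp add: v_def)
  have pvv: "p * (v * v) \<approx> v * v"
    using null_eq_mult[OF pw null_eq_refl[of w]] unfolding vv by (simp add: null_eq_scaleR mult.assoc)
  have vvp: "v * v * p \<approx> v * v"
    using null_eq_mult[OF null_eq_refl[of w] wp] unfolding vv by (simp add: null_eq_scaleR mult.assoc)
  have base: "N (p + v * v) \<le> 1"
  proof -
    have "(p + 3 *\<^sub>R w) * (p + 3 *\<^sub>R w) + 3 *\<^sub>R ((p - w) * (p - w)) =
      4 *\<^sub>R (p * p) + 12 *\<^sub>R (w * w)"
      using scaleR_left_distrib[of 1 3 "p * p"] scaleR_left_distrib[of 9 3 "w * w"]
      by (simp add: algebra_simps)
    also have "\<dots> \<approx> 4 *\<^sub>R p + 12 *\<^sub>R (w * w)" by (intro null_eq_add null_eq_scaleR p null_eq_refl)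
    also have "\<dots> = 4 *\<^sub>R (p + v * v)" by (simp add: vv scaleR_add_right)
    finally have "4 * N (p + v * v) = N ((p + 3 *\<^sub>R w) * (p + 3 *\<^sub>R w) + 3 *\<^sub>R ((p - w) * (p - w)))"
      using null_eq_norm by fastforce
    also have "\<dots> \<le> N ((p + 3 *\<^sub>R w) * (p + 3 *\<^sub>R w)) + 3 * N ((p - w) * (p - w))"
      using triangle[of "(p + 3 *\<^sub>R w) * (p + 3 *\<^sub>R w)" "3 *\<^sub>R ((p - w) * (p - w))"] by simp
    also have "\<dots> \<le> 1 * 1 + 3 * (1 * 1)"
      using order_trans[OF submult mult_mono[OF a a]] order_trans[OF submult mult_mono[OF b b]]
      by (intro add_mono mult_left_mono) simp_all
    finally show ?thesis by simp
  qed
  \<comment> \<open>The square of \<open>p + 2\<^sup>m v\<^sup>2\<close> is \<open>p + 2\<^sup>m\<^sup>+\<^sup>1 v\<^sup>2\<close> plus a square.\<close>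
  have growth: "N (p + 2 ^ m *\<^sub>R (v * v)) \<le> 1" for m
  proof (induction m)
    case (Suc m)
    let ?t = "2 ^ m :: real"
    define A where "A = p * p + 2 ^ Suc m *\<^sub>R (v * v)"
    define B where "B = (?t *\<^sub>R (v * v)) * (?t *\<^sub>R (v * v))"
    have "A \<approx> p + 2 ^ Suc m *\<^sub>R (v * v)" unfolding A_def by (intro null_eq_add p null_eq_refl)
    moreover have "pos A" unfolding A_def by (intro pos_add pos_scale pos_square p sv) simp
    moreover have "pos B" unfolding B_def by (rule pos_square) (simp add: star_scaleR star_mult sv)
    moreover have "(p + ?t *\<^sub>R (v * v)) * (p + ?t *\<^sub>R (v * v)) \<approx> A + B"
    proof -
      have "(p + ?t *\<^sub>R (v * v)) * (p + ?t *\<^sub>R (v * v)) =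
        p * p + ?t *\<^sub>R (p * (v * v)) + ?t *\<^sub>R (v * v * p) + B"
        by (simp add: B_def distrib_left distrib_right add.assoc scaleR_add_right)
      also have "\<dots> \<approx> p * p + ?t *\<^sub>R (v * v) + ?t *\<^sub>R (v * v) + B"
        by (intro null_eq_add null_eq_scaleR pvv vvp null_eq_refl)
      also have "\<dots> = A + B"
        using scaleR_left_distrib[of ?t ?t "v * v"] by (simp add: A_def add.assoc)
      finally show ?thesis .
    qed
    ultimately have "N (p + 2 ^ Suc m *\<^sub>R (v * v)) \<le> N ((p + ?t *\<^sub>R (v * v)) * (p + ?t *\<^sub>R (v * v)))"
      using pos_le_add null_eq_norm by metis
    also have "\<dots> \<le> 1 * 1" using order_trans[OF submult mult_mono[OF Suc.IH Suc.IH]] by simp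
    finally show ?case by simp
  qed (use base in simp)
  have "N (v * v) = 0"
  proof (rule ccontr)
    assume "N (v * v) \<noteq> 0"
    then have pos: "0 < N (v * v)" using nonneg[of "v * v"] by linarith
    obtain m where m: "2 / N (v * v) < 2 ^ m" using real_arch_pow[of 2 "2 / N (v * v)"] by auto
    have "2 ^ m * N (v * v) \<le> N (p + 2 ^ m *\<^sub>R (v * v)) + N p"
      using triangle_diff[of "p + 2 ^ m *\<^sub>R (v * v)" p] by simp
    also have "\<dots> \<le> 2" using growth[of m] p1 by simp
    finally show False using m pos by (simp add: field_simps)
  qed
  then have "N w = 0" unfolding vv using square[OF sw] by simp
  moreover have "star (q * p) * (q * p) = p * (q * q) * p" by (simp add: star_mult p q mult.assoc)
  moreover have "p * (q * q) * p \<approx> w" unfolding w_def by (intro null_eq_mult q null_eq_refl)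
  ultimately have "(N (q * p))\<^sup>2 = 0" by (metis cstar null_eq_norm)
  then show ?thesis using star_eq[of "q * p"] by (simp add: star_mult p q)
qed

text \<open>
  Generators of a free *-algebra are self-adjoint only modulo null elements, while the positive cone
  consists of elements that are exactly self-adjoint.
\<close>

lemma hermitian_part:
  assumes "star x \<approx> x"
  obtains h where "star h = h" "h \<approx> x"
proof
  let ?h = "(1/2) *\<^sub>R (x + star x)"
  show "star ?h = ?h" by (simp add: star_scaleR star_add add.commute)
  have "?h \<approx> (1/2) *\<^sub>R (x + x)" by (intro null_eq_scaleR null_eq_add assms null_eq_refl)
  also have "(1/2) *\<^sub>R (x + x) = x" by (simp add: scaleR_2[symmetric])
  finally show "?h \<approx> x" .
qed

lemma projections_orthogonal:
  assumes "finite I" "\<And>i. i \<in> I \<Longrightarrow> star (p i) \<approx> p i" "\<And>i. i \<in> I \<Longrightarrow> p i * p i \<approx> p i"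
    and "(\<Sum>i\<in>I. p i) \<approx> 1" "i \<in> I" "j \<in> I" "i \<noteq> j"
  shows "p i * p j \<approx> 0"
proof -
  have "\<forall>i\<in>I. \<exists>h. star h = h \<and> h \<approx> p i" using hermitian_part assms(2) by metis
  then obtain h where h: "\<And>i. i \<in> I \<Longrightarrow> star (h i) = h i" "\<And>i. i \<in> I \<Longrightarrow> h i \<approx> p i" by metis
  have hh: "h i * h i \<approx> h i" if "i \<in> I" for i
    using null_eq_trans[OF null_eq_trans[OF null_eq_mult[OF h(2)[OF that] h(2)[OF that]] assms(3)[OF that]]
      null_eq_sym[OF h(2)[OF that]]] .
  define s where "s = (\<Sum>l\<in>I - {i, j}. h l * h l)"
  have "pos s" unfolding s_def by (intro pos_sum pos_square h) auto
  have "h i + h j + s \<approx> h i + h j + (\<Sum>l\<in>I - {i, j}. h l)"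
    unfolding s_def by (intro null_eq_add null_eq_sum null_eq_refl hh) auto
  also have "\<dots> = (\<Sum>l\<in>I. h l)"
    using sum.subset_diff[of "{i, j}" I h] assms(1,5-7) by (simp add: add.commute)
  also have "\<dots> \<approx> (\<Sum>l\<in>I. p l)" by (intro null_eq_sum h)
  also have "\<dots> \<approx> 1" by fact
  finally have "N (h i * h j) = 0"
    using two_projections_orthogonal[of "h i" "h j" s] h(1) hh assms(5,6) \<open>pos s\<close> by simp
  moreover have "h i * h j \<approx> p i * p j" using h(2) assms(5,6) by (intro null_eq_mult) auto
  ultimately show ?thesis using null_eq_norm by (simp add: null_eq_def)
qed

text \<open>
  The relations bound the generators: \<open>x\<^sub>j\<^sup>2\<close> is dominated by \<open>\<Sum>\<^sub>i x\<^sub>i\<^sup>2\<close>. Without this the universal seminorm would not be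
  finite.
\<close>

lemma generator_le_one:
  assumes "finite J" "\<And>j. j \<in> J \<Longrightarrow> star (x j) \<approx> x j" "(\<Sum>j\<in>J. x j * x j) \<approx> 1" "j \<in> J"
  shows "N (x j) \<le> 1"
proof -
  have "\<forall>i\<in>J. \<exists>h. star h = h \<and> h \<approx> x i" using hermitian_part assms(2) by metis
  then obtain h where h: "\<And>i. i \<in> J \<Longrightarrow> star (h i) = h i" "\<And>i. i \<in> J \<Longrightarrow> h i \<approx> x i" by metis
  have "N (h j * h j) \<le> N (h j * h j + (\<Sum>i\<in>J - {j}. h i * h i))"
    using h(1) assms(4) by (intro pos_le_add pos_sum pos_square) auto
  also have "\<dots> = N (\<Sum>i\<in>J. h i * h i)" using sum.remove[OF assms(1,4), of "\<lambda>i. h i * h i"] by simp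
  also have "\<dots> = N 1"
    using null_eq_trans[OF null_eq_sum assms(3), of "\<lambda>i. h i * h i"] null_eq_mult h(2) null_eq_norm by metis
  finally have "(N (h j))\<^sup>2 \<le> 1\<^sup>2" using square h(1) assms(4) one_le by simp
  then have "N (h j) \<le> 1" by (rule power2_le_imp_le) simp
  then show ?thesis using null_eq_norm[OF h(2)[OF assms(4)]] by simp
qed

end

section \<open>Characters of commutative C*-seminorms\<close>

context cstar_seminorm
begin

definition commutes :: bool where
  "commutes \<longleftrightarrow> (\<forall>x y. x * y \<approx> y * x)"

lemma commutesD: "commutes \<Longrightarrow> x * y \<approx> y * x"
  by (simp add: commutes_def)

text \<open>
  If \<open>N\<close> is commutative, seen as the supremum over a compact space, and \<open>f\<close> is self-adjoint of norm \<open>1\<close>, then this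
  is the supremum over the subset where \<open>\<bar>f\<bar> = 1\<close>.
\<close>

definition peak :: "'a \<Rightarrow> 'a \<Rightarrow> real" where
  "peak f x = lim (\<lambda>n. N (x * f ^ n))"

lemma peak_step: "N f = 1 \<Longrightarrow> N (x * f ^ Suc n) \<le> N (x * f ^ n)"
  using submult[of "x * f ^ n" f] by (simp add: power_commutes mult.assoc)

lemma peak_limit:
  assumes "N f = 1"
  shows "(\<lambda>n. N (x * f ^ n)) \<longlonglongrightarrow> peak f x"
proof -
  have dec: "decseq (\<lambda>n. N (x * f ^ n))" by (intro decseq_SucI peak_step assms)
  have "convergent (\<lambda>n. N (x * f ^ n))"
  proof (intro Bseq_monoseq_convergent decseq_imp_monoseq dec)
    show "Bseq (\<lambda>n. N (x * f ^ n))"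
      using decseqD[OF dec, of 0] by (intro BseqI'[of _ "N x"]) simp
  qed
  then show ?thesis by (simp add: peak_def convergent_LIMSEQ_iff)
qed

lemma peak_le: "N f = 1 \<Longrightarrow> peak f x \<le> N x"
  using peak_step by (intro LIMSEQ_le_const2[OF peak_limit])
    (auto intro!: exI[of _ 0] decseqD[of "\<lambda>n. N (x * f ^ n)" 0, simplified] decseq_SucI)

lemma peak_mult:
  assumes "N f = 1"
  shows "peak f (x * f) = peak f x"
  using LIMSEQ_unique[OF LIMSEQ_Suc[OF peak_limit[OF assms, of x]]] peak_limit[OF assms, of "x * f"]
  by (simp add: mult.assoc)

lemma peak_limit_even:
  assumes "N f = 1"
  shows "(\<lambda>n. N (x * (f ^ n * f ^ n))) \<longlonglongrightarrow> peak f x"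
  using LIMSEQ_subseq_LIMSEQ[OF peak_limit[OF assms, of x], of "\<lambda>n. n + n"]
  by (simp add: strict_mono_def comp_def power_add)

lemma cstar_peak:
  assumes c: commutes and f: "star f = f" "N f = 1"
  shows "cstar_seminorm (peak f)"
proof
  note lim = peak_limit[OF f(2)] and lim2 = peak_limit_even[OF f(2)]
  show "peak f (x + y) \<le> peak f x + peak f y" for x y
    by (rule LIMSEQ_le[OF lim tendsto_add[OF lim[of x] lim[of y]]]) (simp add: distrib_right triangle)
  show "peak f (r *\<^sub>R x) = \<bar>r\<bar> * peak f x" for r x
    using LIMSEQ_unique[OF lim[of "r *\<^sub>R x"]] tendsto_mult[OF tendsto_const lim[of x], of "\<bar>r\<bar>"] by simp
  show "peak f (x * y) \<le> peak f x * peak f y" for x y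
  proof (rule LIMSEQ_le[OF lim2 tendsto_mult[OF lim[of x] lim[of y]]], intro exI allI impI)
    fix n
    have "x * y * (f ^ n * f ^ n) = x * (y * f ^ n) * f ^ n" by (simp add: mult.assoc)
    also have "\<dots> \<approx> x * (f ^ n * y) * f ^ n" by (intro null_eq_mult commutesD[OF c] null_eq_refl)
    also have "\<dots> = (x * f ^ n) * (y * f ^ n)" by (simp add: mult.assoc)
    finally show "N (x * y * (f ^ n * f ^ n)) \<le> N (x * f ^ n) * N (y * f ^ n)"
      using submult null_eq_norm by metis
  qed
  show "peak f (star x * x) = (peak f x)\<^sup>2" for x
  proof (rule LIMSEQ_unique[OF lim2])
    have "N (star x * x * (f ^ n * f ^ n)) = (N (x * f ^ n))\<^sup>2" for n
    proof -
      have "star (x * f ^ n) * (x * f ^ n) = (f ^ n * (star x * x)) * f ^ n"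
        by (simp add: star_mult star_power f mult.assoc)
      also have "\<dots> \<approx> ((star x * x) * f ^ n) * f ^ n" by (intro null_eq_mult commutesD[OF c] null_eq_refl)
      also have "\<dots> = star x * x * (f ^ n * f ^ n)" by (simp add: mult.assoc)
      finally show ?thesis using cstar null_eq_norm by metis
    qed
    then show "(\<lambda>n. N (star x * x * (f ^ n * f ^ n))) \<longlonglongrightarrow> (peak f x)\<^sup>2"
      using tendsto_power[OF lim[of x], of 2] by simp
  qed
qed

lemma norm_power_self_adjoint:
  assumes "star f = f" "N f = 1"
  shows "N (f ^ n) = 1"
proof -
  have two: "N (f ^ (2 ^ k)) = 1" for k
  proof (induction k)
    case (Suc k)
    have "f ^ (2 ^ Suc k) = f ^ (2 ^ k) * f ^ (2 ^ k)" by (simp add: power_add[symmetric] mult_2)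
    then show ?case using square[of "f ^ (2 ^ k)"] Suc assms by (simp add: star_power)
  qed (use assms in simp)
  have dec: "decseq (\<lambda>n. N (1 * f ^ n))" by (intro decseq_SucI peak_step assms)
  have "1 \<le> N (f ^ n)" using decseqD[OF dec, of n "2 ^ n"] two[of n] by simp
  moreover have "N 1 \<le> 1" by (rule one_le)
  then have "N (f ^ n) \<le> 1" using decseqD[OF dec, of 0 n] by simp
  ultimately show ?thesis by simp
qed

lemma peak_one:
  assumes "star f = f" "N f = 1"
  shows "peak f 1 = 1"
  using peak_limit[OF assms(2), of 1] norm_power_self_adjoint[OF assms] by (simp add: LIMSEQ_const_iff)

text \<open>
  On the peak set \<open>f\<^sup>2 = 1\<close>. Put \<open>y = 1 - f\<^sup>2\<close> and let \<open>r\<close> be its size there, which is at most \<open>1/4\<close> by \<open>quarter_bound\<close>.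
  Multiplication by \<open>f\<close> does not change sizes, so \<open>r\<close> is also the size of \<open>f\<^sup>2 y = y - y\<^sup>2\<close>. As \<open>r \<mapsto> r (1 - r)\<close>
  increases up to \<open>1/2\<close>, that size is at most \<open>r - r\<^sup>2\<close>, which forces \<open>r = 0\<close>.
\<close>

lemma peak_square:
  assumes c: commutes and f: "star f = f" "N f = 1"
  shows "peak f (1 - f * f) = 0"
proof -
  interpret M: cstar_seminorm "peak f" by (rule cstar_peak[OF assms])
  define y where "y = 1 - f * f"
  define r where "r = peak f y"
  have sy: "star y = y" by (simp add: y_def star_diff star_mult f)
  have Mf: "peak f f \<le> 1" using peak_le[OF f(2), of f] f(2) by simp
  have "peak f (f * f * y) \<le> 1/4" unfolding y_def by (rule M.quarter_bound[OF f(1) Mf])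
  moreover have "f * f * y = y * f * f" by (simp add: y_def algebra_simps)
  then have eq: "peak f (f * f * y) = r" by (simp add: peak_mult[OF f(2)] r_def)
  ultimately have r: "0 \<le> r" "r \<le> 1/4" unfolding r_def by simp_all
  have fy: "f * f * y = y - y * y" by (simp add: y_def algebra_simps)
  have "peak f (f * f) \<le> 1"
    using M.submult[of f f] mult_mono[OF Mf Mf] by simp
  then have "M.pos y"
    using M.pos_real_minus[of "f * f" 1] f by (simp add: y_def star_mult)
  have "r \<le> r * (1 - r)"
  proof -
    have "peak f (y - y * y) \<le> r * (1 - r)"
    proof (rule M.le_if_pos_between)
      \<comment> \<open>\<open>r (1 - r) - y (1 - y) = (r - y) (1 - r - y)\<close>, written as a sum of positive terms\<close>
      have "M.pos ((r *\<^sub>R 1 - y) * (r *\<^sub>R 1 - y) + (1 - 2 * r) *\<^sub>R (r *\<^sub>R 1 - y))"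
        using r sy by (intro M.pos_add M.pos_square M.pos_scale M.pos_real_minus)
          (simp_all add: star_diff star_scaleR r_def)
      moreover have "(r *\<^sub>R 1 - y) * (r *\<^sub>R 1 - y) + (1 - 2 * r) *\<^sub>R (r *\<^sub>R 1 - y)
          = (r * (1 - r)) *\<^sub>R 1 - (y - y * y)"
        by (simp add: algebra_simps scaleR_2[symmetric])
      ultimately show "M.pos ((r * (1 - r)) *\<^sub>R 1 - (y - y * y))" by simp
      have "M.pos ((r\<^sup>2 *\<^sub>R 1 - y * y) + y + (r - (r\<^sup>2 + r\<^sup>2)) *\<^sub>R 1)"
        using r sy M.square[OF sy] mult_right_mono[of r "1/4" r] mult_nonneg_nonneg[of r r]
        by (intro M.pos_add M.pos_real_minus M.pos_real \<open>M.pos y\<close>)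
          (simp_all add: star_mult power2_eq_square r_def[symmetric])
      moreover have "(r\<^sup>2 *\<^sub>R 1 - y * y) + y + (r - (r\<^sup>2 + r\<^sup>2)) *\<^sub>R 1 = (r * (1 - r)) *\<^sub>R 1 + (y - y * y)"
      proof -
        have "r * (1 - r) = r\<^sup>2 + (r - (r\<^sup>2 + r\<^sup>2))"
          by (simp add: algebra_simps power2_eq_square)
        then show ?thesis by (simp only: scaleR_left_distrib) (simp add: algebra_simps)
      qed
      ultimately show "M.pos ((r * (1 - r)) *\<^sub>R 1 + (y - y * y))" by (simp only:)
    qed (use r in simp)
    then show ?thesis using eq fy by simp
  qed
  then have "r * r \<le> 0" by (simp add: algebra_simps)
  then have "r = 0" using zero_le_square[of r] by (metis antisym mult_eq_0_iff)
  then show ?thesis by (simp add: r_def y_def)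
qed

text \<open>
  Restriction to the open and closed subset on which the projection \<open>e\<close> is \<open>1\<close>.
\<close>

lemma cstar_corner:
  assumes c: commutes and e: "star e = e" "e * e \<approx> e"
  shows "cstar_seminorm (\<lambda>x. N (x * e))"
proof
  show "N ((x + y) * e) \<le> N (x * e) + N (y * e)" for x y by (simp add: distrib_right triangle)
  show "N (r *\<^sub>R x * e) = \<bar>r\<bar> * N (x * e)" for r x by simp
  show "N (x * y * e) \<le> N (x * e) * N (y * e)" for x y
  proof -
    have "x * y * e \<approx> x * y * (e * e)" by (intro null_eq_mult null_eq_sym[OF e(2)] null_eq_refl)
    also have "\<dots> = x * (y * e) * e" by (simp add: mult.assoc)
    also have "\<dots> \<approx> x * (e * y) * e" by (intro null_eq_mult commutesD[OF c] null_eq_refl)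
    also have "\<dots> = (x * e) * (y * e)" by (simp add: mult.assoc)
    finally show ?thesis using submult null_eq_norm by metis
  qed
  show "N (star x * x * e) = (N (x * e))\<^sup>2" for x
  proof -
    have "star (x * e) * (x * e) = (e * (star x * x)) * e" by (simp add: star_mult e mult.assoc)
    also have "\<dots> \<approx> ((star x * x) * e) * e" by (intro null_eq_mult commutesD[OF c] null_eq_refl)
    also have "\<dots> = star x * x * (e * e)" by (simp add: mult.assoc)
    also have "\<dots> \<approx> star x * x * e" by (intro null_eq_mult e null_eq_refl)
    finally show ?thesis using cstar null_eq_norm by metis
  qed
qed

end

lemma commutes_mono:
  assumes "cstar_seminorm N" "cstar_seminorm M" "\<And>x. M x \<le> N x" "cstar_seminorm.commutes N"
  shows "cstar_seminorm.commutes M"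
proof -
  interpret N: cstar_seminorm N by fact
  interpret M: cstar_seminorm M by fact
  have "M (x * y - y * x) = 0" for x y
    using N.commutesD[OF assms(4), of x y] assms(3)[of "x * y - y * x"] M.nonneg[of "x * y - y * x"]
    unfolding N.null_eq_def by simp
  then show ?thesis unfolding M.commutes_def M.null_eq_def by simp
qed

text \<open>
  Restrict to the set where \<open>f = x/\<parallel>x\<parallel>\<close> peaks. There \<open>f\<^sup>2 = 1\<close>, so \<open>e = (1 - f)/2\<close> is a projection: either it vanishes and
  \<open>f = 1\<close>, or a further restriction to the corner of \<open>e\<close> makes \<open>f = -1\<close>.
\<close>

lemma scalar_point:
  assumes "cstar_seminorm N" "cstar_seminorm.commutes N" "N 1 = 1" "star x = x"
  obtains M r where "cstar_seminorm M" "\<And>y. M y \<le> N y" "M 1 = 1" "M (x - r *\<^sub>R 1) = 0"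
proof -
  interpret N: cstar_seminorm N by fact
  show ?thesis
  proof (cases "N x = 0")
    case True
    then show ?thesis using that[of N 0] assms by simp
  next
    case False
    define r where "r = N x"
    have r: "r > 0" using False N.nonneg[of x] by (simp add: r_def less_le)
    define f where "f = (1/r) *\<^sub>R x"
    have f: "star f = f" "N f = 1" using r assms(4) by (simp_all add: f_def star_scaleR r_def)
    have xf: "x = r *\<^sub>R f" using r by (simp add: f_def)
    define M where "M = N.peak f"
    have M: "cstar_seminorm M" unfolding M_def by (rule N.cstar_peak[OF assms(2) f])
    then interpret M: cstar_seminorm M .
    have MN: "M y \<le> N y" for y unfolding M_def by (rule N.peak_le[OF f(2)])
    have M1: "M 1 = 1" unfolding M_def by (rule N.peak_one[OF f])
    have ff: "M.null_eq 1 (f * f)" unfolding M.null_eq_def unfolding M_def by (rule N.peak_square[OF assms(2) f])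
    note Mc = commutes_mono[OF assms(1) M MN assms(2)]
    define e where "e = (1/2) *\<^sub>R (1 - f)"
    have se: "star e = e" by (simp add: e_def star_scaleR star_diff f)
    have "e * e = (1/4) *\<^sub>R (f * f - 2 *\<^sub>R f + 1)"
      by (simp add: e_def algebra_simps scaleR_2)
    also have "M.null_eq \<dots> ((1/4) *\<^sub>R (1 - 2 *\<^sub>R f + 1))"
      by (intro M.null_eq_scaleR M.null_eq_add M.null_eq_diff M.null_eq_sym[OF ff] M.null_eq_refl)
    also have "(1/4) *\<^sub>R (1 - 2 *\<^sub>R f + 1) = e"
      using scaleR_left_distrib[of "1/4" "1/4" "1::'a"] by (simp add: e_def scaleR_diff_right scaleR_add_right)
    finally have ee: "M.null_eq (e * e) e" .
    show ?thesis
    proof (cases "M e = 0")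
      case True
      have "x - r *\<^sub>R 1 = (- 2 * r) *\<^sub>R e" using r by (simp add: xf e_def scaleR_diff_right)
      then have "M (x - r *\<^sub>R 1) = 0" using True by simp
      then show ?thesis using that[of M r] M MN M1 by blast
    next
      case False
      have "M e = 1"
        using M.square[OF se] M.null_eq_norm[OF ee] False by (simp add: power2_eq_square)
      define M' where "M' = (\<lambda>y. M (y * e))"
      have M': "cstar_seminorm M'" unfolding M'_def by (rule M.cstar_corner[OF Mc se ee])
      have "M' y \<le> N y" for y
        using M.submult[of y e] MN[of y] \<open>M e = 1\<close> by (simp add: M'_def)
      moreover have "M' 1 = 1" by (simp add: M'_def \<open>M e = 1\<close>)
      moreover have "M' (x - (- r) *\<^sub>R 1) = 0"
      proof -
        have "(x - (- r) *\<^sub>R 1) * e = (r / 2) *\<^sub>R (1 - f * f)"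
          by (simp add: xf e_def algebra_simps)
        then show ?thesis using ff by (simp add: M'_def M.null_eq_def)
      qed
      ultimately show ?thesis using that[of M' "- r"] M' by blast
    qed
  qed
qed

lemma scalar_points:
  assumes "finite B" "cstar_seminorm N" "cstar_seminorm.commutes N" "N 1 = 1" "\<forall>x\<in>B. star x = x"
  shows "\<exists>M r. cstar_seminorm M \<and> (\<forall>y. M y \<le> N y) \<and> M 1 = 1 \<and> (\<forall>x\<in>B. M (x - r x *\<^sub>R 1) = 0)"
  using assms(1,5)
proof (induction B rule: finite_induct)
  case empty
  then show ?case using assms(2,4) by (intro exI[of _ N]) simp
next
  case (insert x B)
  then obtain M r where M: "cstar_seminorm M" "\<And>y. M y \<le> N y" "M 1 = 1" "\<forall>x\<in>B. M (x - r x *\<^sub>R 1) = 0"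
    by auto
  then obtain M' s where M': "cstar_seminorm M'" "\<And>y. M' y \<le> M y" "M' 1 = 1" "M' (x - s *\<^sub>R 1) = 0"
    using scalar_point[OF M(1) commutes_mono[OF assms(2) M(1,2) assms(3)] M(3), of x] insert.prems
    by (metis insertI1)
  interpret M': cstar_seminorm M' by fact
  have "M' (y - r y *\<^sub>R 1) = 0" if "y \<in> B" for y
    using M(4) that M'(2)[of "y - r y *\<^sub>R 1"] M'.nonneg[of "y - r y *\<^sub>R 1"] by simp
  then have "\<forall>y\<in>insert x B. M' (y - (r(x := s)) y *\<^sub>R 1) = 0"
    using M'(4) insert.hyps(2) by auto
  moreover have "M' y \<le> N y" for y using M'(2)[of y] M(2)[of y] by simp
  ultimately show ?case using M'(1,3) by blast
qed

text \<open>
  Gelfand duality for finitely many self-adjoint elements. First restrict to the set where \<open>\<bar>f\<bar>\<close> attains its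
  maximum, so that every seminorm below still sees the full size of \<open>f\<close>, and then make the elements scalar one
  after the other.
\<close>

theorem norming_scalar_points:
  assumes "cstar_seminorm N" "cstar_seminorm.commutes N" "N f \<noteq> 0" "finite B" "\<forall>x\<in>B. star x = x"
  obtains M r where "cstar_seminorm M" "\<And>y. M y \<le> N y" "M 1 = 1" "M f = N f"
    "\<And>x. x \<in> B \<Longrightarrow> M (x - r x *\<^sub>R 1) = 0"
proof -
  interpret N: cstar_seminorm N by fact
  have pos: "0 < N f" using assms(3) N.nonneg[of f] by linarith
  define g where "g = (1 / (N f)\<^sup>2) *\<^sub>R (star f * f)"
  have g: "star g = g" "N g = 1" using pos by (simp_all add: g_def star_scaleR star_mult N.cstar)
  define P where "P = N.peak g"
  have P: "cstar_seminorm P" unfolding P_def by (rule N.cstar_peak[OF assms(2) g])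
  have PN: "P y \<le> N y" for y unfolding P_def by (rule N.peak_le[OF g(2)])
  have P1: "P 1 = 1" unfolding P_def by (rule N.peak_one[OF g])
  obtain M r where M: "cstar_seminorm M" "\<And>y. M y \<le> P y" "M 1 = 1" "\<forall>x\<in>B. M (x - r x *\<^sub>R 1) = 0"
    using scalar_points[OF assms(4) P commutes_mono[OF assms(1) P PN assms(2)] P1 assms(5)] by auto
  interpret M: cstar_seminorm M by fact
  have "M (1 - g * g) = 0"
    using M(2)[of "1 - g * g"] N.peak_square[OF assms(2) g] M.nonneg[of "1 - g * g"] by (simp add: P_def)
  then have "(M g)\<^sup>2 = 1" using M.eq_if_null_diff[of 1 "g * g"] M.square[OF g(1)] M(3) by simp
  then have "M g = 1" using M.nonneg[of g] by (simp add: power2_eq_1_iff)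
  then have "(M f)\<^sup>2 = (N f)\<^sup>2" using pos by (simp add: g_def M.cstar field_simps)
  then have "M f = N f" by (simp add: power2_eq_iff_nonneg)
  moreover have "M y \<le> N y" for y using M(2)[of y] PN[of y] by simp
  ultimately show ?thesis using that M by blast
qed

section \<open>The free *-algebra\<close>

text \<open>
  The elements of the free *-algebra as a type of their own, so that they can be an instance of the
  algebraic type classes.
\<close>

typedef 'g fpoly = "{f :: 'g free_poly. finite {w. f w \<noteq> 0}}"
  morphisms coeff Abs_fpoly
  by (rule exI[of _ "\<lambda>_. 0"]) simp

setup_lifting type_definition_fpoly

lemma fpoly_eqI: "(\<And>w. coeff x w = coeff y w) \<Longrightarrow> x = y"
  using coeff_inject by blast

abbreviation support :: "'g fpoly \<Rightarrow> ('g \<times> bool) list set" where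
  "support x \<equiv> {w. coeff x w \<noteq> 0}"

lemma finite_support [simp]: "finite (support x)"
  using coeff[of x] by simp

definition flip :: "('g \<times> bool) list \<Rightarrow> ('g \<times> bool) list" where
  "flip w = rev (map (\<lambda>(x, b). (x, \<not> b)) w)"

lemma flip_flip [simp]: "flip (flip w) = w"
  by (induction w) (auto simp: flip_def rev_map comp_def)

lemma flip_eq_iff: "flip v = w \<longleftrightarrow> v = flip w"
  by auto

lemma flip_append: "flip (v @ w) = flip w @ flip v"
  by (simp add: flip_def)

lemma fst_flip [simp]: "fst ` set (flip w) = fst ` set w"
  by (force simp: flip_def)

lemma finite_convolution_support:
  fixes f g :: "'g free_poly"
  assumes "finite {w. f w \<noteq> 0}" "finite {w. g w \<noteq> 0}"
  shows "finite {w. (\<Sum>l\<le>length w. f (take l w) * g (drop l w)) \<noteq> 0}"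
proof (rule finite_subset)
  show "{w. (\<Sum>l\<le>length w. f (take l w) * g (drop l w)) \<noteq> 0}
    \<subseteq> (\<lambda>(u, v). u @ v) ` ({w. f w \<noteq> 0} \<times> {w. g w \<noteq> 0})"
  proof
    fix w assume "w \<in> {w. (\<Sum>l\<le>length w. f (take l w) * g (drop l w)) \<noteq> 0}"
    then obtain l where "f (take l w) * g (drop l w) \<noteq> 0"
      by (auto elim: sum.not_neutral_contains_not_neutral)
    then show "w \<in> (\<lambda>(u, v). u @ v) ` ({w. f w \<noteq> 0} \<times> {w. g w \<noteq> 0})"
      by (intro image_eqI[of _ _ "(take l w, drop l w)"]) auto
  qed
qed (use assms in simp)

lemma finite_nonzero_flip:
  assumes "finite {w. f w \<noteq> (0::complex)}"
  shows "finite {w. cnj (f (flip w)) \<noteq> 0}"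
proof (rule finite_subset)
  show "{w. cnj (f (flip w)) \<noteq> 0} \<subseteq> flip ` {w. f w \<noteq> 0}"
    by (auto intro: image_eqI[of _ flip, OF flip_flip[symmetric]])
qed (use assms in simp)

lift_definition monomial :: "('g \<times> bool) list \<Rightarrow> 'g fpoly" is "\<lambda>u w. if w = u then 1 else 0"
  by simp

lift_definition scaleC :: "complex \<Rightarrow> 'g fpoly \<Rightarrow> 'g fpoly" is "\<lambda>c f w. c * f w"
  by (erule rev_finite_subset) auto

text \<open>
  The *-homomorphism that sends all letters outside \<open>X\<close> to \<open>0\<close>. It turns a seminorm on the polynomials over \<open>X\<close>
  into a seminorm on the whole type.
\<close>

lift_definition restrict_letters :: "'g set \<Rightarrow> 'g fpoly \<Rightarrow> 'g fpoly" is
  "\<lambda>X f w. if fst ` set w \<subseteq> X then f w else 0"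
  by (erule rev_finite_subset) auto

instantiation fpoly :: (type) "{ab_group_add, scaleR, times, one}"
begin

lift_definition zero_fpoly :: "'a fpoly" is "\<lambda>w. 0" by simp
lift_definition plus_fpoly :: "'a fpoly \<Rightarrow> 'a fpoly \<Rightarrow> 'a fpoly" is "\<lambda>f g w. f w + g w"
  subgoal for f g by (rule finite_subset[of _ "{w. f w \<noteq> 0} \<union> {w. g w \<noteq> 0}"]) auto
  done
lift_definition uminus_fpoly :: "'a fpoly \<Rightarrow> 'a fpoly" is "\<lambda>f w. - f w" by simp
lift_definition minus_fpoly :: "'a fpoly \<Rightarrow> 'a fpoly \<Rightarrow> 'a fpoly" is "\<lambda>f g w. f w - g w"
  subgoal for f g by (rule finite_subset[of _ "{w. f w \<noteq> 0} \<union> {w. g w \<noteq> 0}"]) auto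
  done
lift_definition times_fpoly :: "'a fpoly \<Rightarrow> 'a fpoly \<Rightarrow> 'a fpoly" is
  "\<lambda>f g w. \<Sum>l\<le>length w. f (take l w) * g (drop l w)" by (rule finite_convolution_support)
definition one_fpoly :: "'a fpoly" where "one_fpoly = monomial []"
definition scaleR_fpoly :: "real \<Rightarrow> 'a fpoly \<Rightarrow> 'a fpoly" where "scaleR_fpoly r = scaleC (of_real r)"

instance by standard (transfer; force)+

end

lemma coeff_simps [simp]:
  "coeff 0 w = 0" "coeff (x + y) w = coeff x w + coeff y w" "coeff (- x) w = - coeff x w"
  "coeff (x - y) w = coeff x w - coeff y w" "coeff (scaleC c x) w = c * coeff x w"
  "coeff (monomial u) w = (if w = u then 1 else 0)" "coeff 1 w = (if w = [] then 1 else 0)"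
  "coeff (restrict_letters X x) w = (if fst ` set w \<subseteq> X then coeff x w else 0)"
  by (simp_all add: zero_fpoly.rep_eq plus_fpoly.rep_eq uminus_fpoly.rep_eq minus_fpoly.rep_eq
      scaleC.rep_eq monomial.rep_eq one_fpoly_def restrict_letters.rep_eq)

lemma coeff_times: "coeff (x * y) w = (\<Sum>l\<le>length w. coeff x (take l w) * coeff y (drop l w))"
  by (simp add: times_fpoly.rep_eq)

lemma coeff_sum [simp]: "coeff (sum f I) w = (\<Sum>i\<in>I. coeff (f i) w)"
  by (induction I rule: infinite_finite_induct) auto

lemma scaleC_simps [simp]:
  "scaleC c (x + y) = scaleC c x + scaleC c y" "scaleC (a + b) x = scaleC a x + scaleC b x"
  "scaleC a (scaleC b x) = scaleC (a * b) x" "scaleC 1 x = x" "scaleC 0 x = 0" "scaleC c 0 = 0"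
  by (auto intro!: fpoly_eqI simp: algebra_simps)

lemma times_scaleC [simp]:
  "scaleC c x * y = scaleC c (x * y)" "x * scaleC c y = scaleC c (x * y)"
  by (auto intro!: fpoly_eqI sum.cong simp: coeff_times sum_distrib_left ac_simps)

lemma times_add: "(x + y) * z = x * z + y * z" "z * (x + y) = z * x + z * (y::'g fpoly)"
  by (auto intro!: fpoly_eqI simp: coeff_times sum.distrib algebra_simps)

lemma fpoly_expansion: "x = (\<Sum>w\<in>support x. scaleC (coeff x w) (monomial w))"
proof (rule fpoly_eqI)
  fix w
  have "coeff (\<Sum>w\<in>support x. scaleC (coeff x w) (monomial w)) w
      = (\<Sum>v\<in>support x. if v = w then coeff x v else 0)"
    unfolding coeff_sum by (intro sum.cong refl) auto
  also have "\<dots> = (if w \<in> support x then coeff x w else 0)" by (rule sum.delta) simp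
  finally show "coeff x w = coeff (\<Sum>w\<in>support x. scaleC (coeff x w) (monomial w)) w"
    by simp
qed

text \<open>
  Multilinear identities, such as associativity, need only be checked on words.
\<close>

lemma fpoly_induct [case_names monomial add]:
  assumes "\<And>c w. P (scaleC c (monomial w))" "\<And>x y. P x \<Longrightarrow> P y \<Longrightarrow> P (x + y)"
  shows "P x"
proof -
  have "P (sum f I)" if "\<And>i. i \<in> I \<Longrightarrow> P (f i)" for f and I :: "('a \<times> bool) list set"
    using that
  proof (induction I rule: infinite_finite_induct)
    case (insert i I)
    then show ?case using assms(2) by simp
  qed (use assms(1)[of 0] in simp_all)
  from this[of "support x" "\<lambda>w. scaleC (coeff x w) (monomial w)"] assms(1) show ?thesis
    using fpoly_expansion[of x] by simp
qed

lemma mono_mult: "monomial u * monomial v = monomial (u @ v)"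
proof (rule fpoly_eqI)
  fix w
  have "coeff (monomial u * monomial v) w = (\<Sum>l\<le>length w. if l = length u \<and> w = u @ v then 1 else 0)"
    unfolding coeff_times
  proof (intro sum.cong refl)
    fix l assume "l \<in> {..length w}"
    then have "take l w = u \<and> drop l w = v \<longleftrightarrow> l = length u \<and> w = u @ v"
      by (auto simp: append_eq_conv_conj)
    then show "coeff (monomial u) (take l w) * coeff (monomial v) (drop l w)
      = (if l = length u \<and> w = u @ v then 1 else 0)" by auto
  qed
  also have "\<dots> = coeff (monomial (u @ v)) w" by auto
  finally show "coeff (monomial u * monomial v) w = coeff (monomial (u @ v)) w" .
qed

lemma times_assoc: "x * y * z = x * (y * (z::'g fpoly))"
proof (induction x rule: fpoly_induct)
  case (monomial a u)
  show ?case
  proof (induction y rule: fpoly_induct)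
    case (monomial b v)
    show ?case
      by (induction z rule: fpoly_induct) (simp_all add: mono_mult times_add ac_simps)
  qed (simp_all add: times_add)
qed (simp_all add: times_add)

lemma one_mult: "1 * x = x" "x * 1 = (x::'g fpoly)"
  by (induction x rule: fpoly_induct) (simp_all add: one_fpoly_def mono_mult times_add)

instantiation fpoly :: (type) complex_star_algebra
begin

lift_definition star_fpoly :: "'a fpoly \<Rightarrow> 'a fpoly" is "\<lambda>f w. cnj (f (flip w))"
  by (rule finite_nonzero_flip)
definition iunit_fpoly :: "'a fpoly" where "iunit_fpoly = scaleC \<i> 1"

lemma coeff_star: "coeff (star x) w = cnj (coeff x (flip w))"
  by (simp add: star_fpoly.rep_eq)

lemma star_mono: "star (scaleC c (monomial w) :: 'a fpoly) = scaleC (cnj c) (monomial (flip w))"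
  by (rule fpoly_eqI) (simp add: coeff_star flip_eq_iff)

lemma star_add_fpoly: "star (x + y) = star x + star (y :: 'a fpoly)"
  by (rule fpoly_eqI) (simp add: coeff_star)

instance
proof
  fix x y z :: "'a fpoly" and r s :: real
  show "x * y * z = x * (y * z)" by (rule times_assoc)
  show "1 * x = x" "x * 1 = x" by (rule one_mult)+
  show "(x + y) * z = x * z + y * z" "x * (y + z) = x * y + x * z" by (rule times_add)+
  show "(0::'a fpoly) \<noteq> 1" by (metis coeff_simps(1,7) zero_neq_one)
  show "r *\<^sub>R (x + y) = r *\<^sub>R x + r *\<^sub>R y" "(r + s) *\<^sub>R x = r *\<^sub>R x + s *\<^sub>R x"
    "r *\<^sub>R s *\<^sub>R x = (r * s) *\<^sub>R x" "1 *\<^sub>R x = x"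
    "r *\<^sub>R x * y = r *\<^sub>R (x * y)" "x * r *\<^sub>R y = r *\<^sub>R (x * y)"
    by (simp_all add: scaleR_fpoly_def)
  show "star (x + y) = star x + star y" by (rule star_add_fpoly)
  show "star (star x) = x" by (rule fpoly_eqI) (simp add: coeff_star)
  show "star (r *\<^sub>R x) = r *\<^sub>R star x" by (rule fpoly_eqI) (simp add: coeff_star scaleR_fpoly_def)
  show "iunit * iunit = (- 1 :: 'a fpoly)"
    by (rule fpoly_eqI) (simp add: iunit_fpoly_def one_mult)
  show "iunit * x = x * iunit" by (simp add: iunit_fpoly_def one_mult)
  show "star iunit = (- iunit :: 'a fpoly)"
    by (rule fpoly_eqI) (auto simp: iunit_fpoly_def coeff_star flip_def)
  show "star (x * y) = star y * star x"
  proof (induction x rule: fpoly_induct)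
    case (monomial a u)
    show ?case
      by (induction y rule: fpoly_induct)
        (simp_all add: mono_mult star_mono times_add star_add_fpoly flip_append ac_simps)
  qed (simp_all add: times_add star_add_fpoly)
qed

end

lemma star_scaleC: "star (scaleC c x) = scaleC (cnj c) (star x)"
  by (rule fpoly_eqI) (simp add: coeff_star)

lemma scaleC_of_real: "scaleC (of_real r) x = r *\<^sub>R x"
  by (simp add: scaleR_fpoly_def)

text \<open>
  The C*-identity for \<open>c x\<close> reduces this to the real scalar \<open>\<bar>c\<bar>\<^sup>2\<close>.
\<close>

lemma cstar_seminorm_scaleC:
  assumes "cstar_seminorm N"
  shows "N (scaleC c x) = cmod c * N x"
proof -
  interpret cstar_seminorm N by fact
  have "star (scaleC c x) * scaleC c x = (cmod c)\<^sup>2 *\<^sub>R (star x * x)"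
    by (simp add: star_scaleC scaleC_of_real[symmetric] complex_norm_square[symmetric] mult.commute[of "cnj c"] del: of_real_power)
  then have "(N (scaleC c x))\<^sup>2 = (cmod c * N x)\<^sup>2"
    by (metis cstar scale power_mult_distrib abs_power2)
  then show ?thesis by (simp add: power2_eq_iff_nonneg)
qed

definition gen :: "'g \<Rightarrow> 'g fpoly" where
  "gen x = monomial [(x, False)]"

lemma star_gen: "star (gen x) = monomial [(x, True)]"
  using star_mono[of 1 "[(x, False)]"] by (simp add: gen_def flip_def)

lemma coeff_gen: "coeff (gen x) = free_gen x"
  by (auto simp: gen_def free_gen_def)

definition poly_on :: "'g set \<Rightarrow> 'g fpoly set" where
  "poly_on X = {x. \<forall>w. coeff x w \<noteq> 0 \<longrightarrow> fst ` set w \<subseteq> X}"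

lemma restrict_letters_in: "restrict_letters X x \<in> poly_on X"
  by (auto simp: poly_on_def split: if_splits)

lemma restrict_letters_id [simp]: "x \<in> poly_on X \<Longrightarrow> restrict_letters X x = x"
  by (rule fpoly_eqI) (auto simp: poly_on_def)

lemma poly_on_iff: "x \<in> poly_on X \<longleftrightarrow> restrict_letters X x = x"
  using restrict_letters_in[of X x] by auto

lemma restrict_letters_hom:
  "restrict_letters X (x + y) = restrict_letters X x + restrict_letters X y"
  "restrict_letters X (x - y) = restrict_letters X x - restrict_letters X y"
  "restrict_letters X (- x) = - restrict_letters X x"
  "restrict_letters X (scaleC c x) = scaleC c (restrict_letters X x)"
  "restrict_letters X (r *\<^sub>R x) = r *\<^sub>R restrict_letters X x"
  "restrict_letters X (star x) = star (restrict_letters X x)"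
  "restrict_letters X 0 = 0" "restrict_letters X 1 = 1"
  by (auto intro!: fpoly_eqI simp: coeff_star scaleR_fpoly_def)

lemma restrict_letters_mult:
  fixes x y :: "'a fpoly"
  shows "restrict_letters X (x * y) = restrict_letters X x * restrict_letters X y"
proof (rule fpoly_eqI)
  fix w :: "('a \<times> bool) list"
  have *: "fst ` set w \<subseteq> X \<longleftrightarrow> fst ` set (take l w) \<subseteq> X \<and> fst ` set (drop l w) \<subseteq> X" for l
    by (metis append_take_drop_id image_Un le_sup_iff set_append)
  show "coeff (restrict_letters X (x * y)) w = coeff (restrict_letters X x * restrict_letters X y) w"
  proof (cases "fst ` set w \<subseteq> X")
    case True
    then show ?thesis using * by (auto simp: coeff_times intro!: sum.cong)
  next
    case False
    then have "coeff (restrict_letters X x) (take l w) * coeff (restrict_letters X y) (drop l w) = 0" for l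
      using *[of l] by auto
    then show ?thesis using False unfolding coeff_times by (simp only: sum.neutral_const coeff_simps(8) if_False)
  qed
qed

lemma poly_on_closed:
  "0 \<in> poly_on X" "1 \<in> poly_on X" "x \<in> poly_on X \<Longrightarrow> y \<in> poly_on X \<Longrightarrow> x + y \<in> poly_on X"
  "x \<in> poly_on X \<Longrightarrow> y \<in> poly_on X \<Longrightarrow> x - y \<in> poly_on X" "x \<in> poly_on X \<Longrightarrow> - x \<in> poly_on X"
  "x \<in> poly_on X \<Longrightarrow> y \<in> poly_on X \<Longrightarrow> x * y \<in> poly_on X" "x \<in> poly_on X \<Longrightarrow> star x \<in> poly_on X"
  "x \<in> poly_on X \<Longrightarrow> scaleC c x \<in> poly_on X" "x \<in> poly_on X \<Longrightarrow> r *\<^sub>R x \<in> poly_on X"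
  by (simp_all add: poly_on_iff restrict_letters_hom restrict_letters_mult)

lemma poly_on_sum: "(\<And>i. i \<in> I \<Longrightarrow> f i \<in> poly_on X) \<Longrightarrow> sum f I \<in> poly_on X"
  by (induction I rule: infinite_finite_induct) (auto intro: poly_on_closed)

lemma gen_poly_on: "x \<in> X \<Longrightarrow> gen x \<in> poly_on X"
  by (auto simp: poly_on_def gen_def split: if_splits)

lemma poly_on_mono: "X \<subseteq> Y \<Longrightarrow> poly_on X \<subseteq> poly_on Y"
  unfolding poly_on_def by blast

definition letter :: "'g \<times> bool \<Rightarrow> 'g fpoly" where
  "letter l = monomial [l]"

lemma mono_Cons: "monomial (l # w) = letter l * monomial w"
  by (simp add: letter_def mono_mult)

lemma mono_Nil: "monomial [] = 1"
  by (simp add: one_fpoly_def)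

lemma cstar_l1_bound:
  assumes "cstar_seminorm N" "\<And>x. x \<in> X \<Longrightarrow> N (gen x) \<le> 1" "x \<in> poly_on X"
  shows "N x \<le> (\<Sum>w\<in>support x. cmod (coeff x w))"
proof -
  interpret cstar_seminorm N by fact
  have monomial: "N (monomial w) \<le> 1" if "fst ` set w \<subseteq> X" for w
    using that
  proof (induction w)
    case (Cons l w)
    have "letter l = gen (fst l) \<or> letter l = star (gen (fst l))"
      unfolding star_gen by (cases l; cases "snd l") (auto simp: letter_def gen_def)
    then have "N (letter l) = N (gen (fst l))" using star_eq by metis
    then have "N (letter l) \<le> 1" using assms(2) Cons.prems by auto
    then show ?case using submult[of "letter l" "monomial w"] Cons mult_mono[of "N (letter l)" 1 "N (monomial w)" 1]
      by (simp add: mono_Cons)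
  qed (simp add: mono_Nil one_le)
  have sum_le: "N (sum f I) \<le> (\<Sum>i\<in>I. N (f i))" for f and I :: "('a \<times> bool) list set"
    by (induction I rule: infinite_finite_induct) (auto intro: order_trans[OF triangle])
  have "N x \<le> (\<Sum>w\<in>support x. N (scaleC (coeff x w) (monomial w)))"
    by (subst fpoly_expansion[of x]) (rule sum_le)
  also have "\<dots> \<le> (\<Sum>w\<in>support x. cmod (coeff x w))"
    using assms(3) monomial by (intro sum_mono) (auto simp: cstar_seminorm_scaleC[OF assms(1)] poly_on_def mult_left_le)
  finally show ?thesis .
qed

text \<open>
  The character with real values \<open>\<phi>\<close> at the letters. A letter and its adjoint have the same value.
\<close>

definition eval_at :: "('g \<Rightarrow> real) \<Rightarrow> 'g fpoly \<Rightarrow> complex" where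
  "eval_at \<phi> x = (\<Sum>w\<in>support x. coeff x w * of_real (\<Prod>l\<leftarrow>w. \<phi> (fst l)))"

lemma eval_at_superset:
  "finite A \<Longrightarrow> support x \<subseteq> A \<Longrightarrow> eval_at \<phi> x = (\<Sum>w\<in>A. coeff x w * of_real (\<Prod>l\<leftarrow>w. \<phi> (fst l)))"
  unfolding eval_at_def by (rule sum.mono_neutral_left) auto

lemma eval_at_add: "eval_at \<phi> (x + y) = eval_at \<phi> x + eval_at \<phi> y"
proof -
  have "support (x + y) \<subseteq> support x \<union> support y" by auto
  then show ?thesis
    using eval_at_superset[of "support x \<union> support y" "x + y" \<phi>]
      eval_at_superset[of "support x \<union> support y" x \<phi>] eval_at_superset[of "support x \<union> support y" y \<phi>]
    by (simp add: sum.distrib distrib_right)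
qed

lemma eval_at_scaleC: "eval_at \<phi> (scaleC c x) = c * eval_at \<phi> x"
  using eval_at_superset[of "support x" "scaleC c x" \<phi>] eval_at_superset[of "support x" x \<phi>]
  by (auto simp: sum_distrib_left mult.assoc)

lemma eval_at_mono: "eval_at \<phi> (monomial w) = of_real (\<Prod>l\<leftarrow>w. \<phi> (fst l))"
  using eval_at_superset[of "{w}" "monomial w" \<phi>] by (auto split: if_splits)

lemma eval_at_zero: "eval_at \<phi> 0 = 0"
  by (simp add: eval_at_def)

lemma eval_at_one: "eval_at \<phi> 1 = 1"
  using eval_at_mono[of \<phi> "[]"] by (simp add: mono_Nil)

lemma eval_at_gen: "eval_at \<phi> (gen x) = of_real (\<phi> x)"
  by (simp add: gen_def eval_at_mono)

lemma eval_at_diff: "eval_at \<phi> (x - y) = eval_at \<phi> x - eval_at \<phi> y"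
  using eval_at_add[of \<phi> "x - y" y] by simp

lemma eval_at_sum: "eval_at \<phi> (sum f I) = (\<Sum>i\<in>I. eval_at \<phi> (f i))"
  by (induction I rule: infinite_finite_induct) (auto simp: eval_at_add eval_at_zero)

lemma eval_at_mult: "eval_at \<phi> (x * y) = eval_at \<phi> x * eval_at \<phi> y"
proof (induction x rule: fpoly_induct)
  case (monomial a u)
  have "eval_at \<phi> (monomial u * y) = eval_at \<phi> (monomial u) * eval_at \<phi> y"
    by (induction y rule: fpoly_induct)
      (simp_all add: mono_mult eval_at_mono eval_at_scaleC eval_at_add distrib_left)
  then show ?case by (simp add: eval_at_scaleC)
qed (simp add: eval_at_add distrib_right)

lemma eval_at_star: "eval_at \<phi> (star x) = cnj (eval_at \<phi> x)"
proof (induction x rule: fpoly_induct)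
  case (monomial c w)
  have "(\<Prod>l\<leftarrow>flip w. \<phi> (fst l)) = (\<Prod>l\<leftarrow>w. \<phi> (fst l))"
    by (simp add: flip_def rev_map[symmetric] comp_def case_prod_beta prod_list.rev)
  then show ?case by (simp add: star_mono eval_at_scaleC eval_at_mono)
qed (simp add: eval_at_add star_add)

lemma eval_at_cong:
  assumes "x \<in> poly_on X" "\<And>a. a \<in> X \<Longrightarrow> \<phi> a = \<psi> a"
  shows "eval_at \<phi> x = eval_at \<psi> x"
proof -
  have "map (\<lambda>l. \<phi> (fst l)) w = map (\<lambda>l. \<psi> (fst l)) w" if "w \<in> support x" for w
    using assms that by (auto simp: poly_on_def)
  then show ?thesis unfolding eval_at_def by (intro sum.cong refl) metis
qed

lemma cstar_eval_at: "cstar_seminorm (\<lambda>x. cmod (eval_at \<phi> x))"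
  by standard
    (simp_all add: eval_at_add norm_triangle_ineq scaleR_fpoly_def eval_at_scaleC eval_at_mult norm_mult
      eval_at_star power2_eq_square)

text \<open>
  Once the generators are scalars modulo null elements, so is every polynomial.
\<close>

lemma scalar_point_eval:
  assumes "cstar_seminorm M" "x \<in> poly_on X"
    and "\<And>a. a \<in> X \<Longrightarrow> M (gen a - \<phi> a *\<^sub>R 1) = 0"
  shows "M (x - scaleC (eval_at \<phi> x) 1) = 0"
proof -
  interpret cstar_seminorm M by fact
  have gen: "null_eq (gen a) (\<phi> a *\<^sub>R 1)" if "a \<in> X" for a using assms(3)[OF that] by (simp add: null_eq_def)
  have letter: "null_eq (letter l) (\<phi> (fst l) *\<^sub>R 1)" if "fst l \<in> X" for l
    using gen[OF that] null_eq_star[OF gen[OF that]]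
    by (cases l; cases "snd l") (auto simp: letter_def gen_def star_gen[unfolded gen_def] star_scaleR)
  have monomial: "null_eq (monomial w) ((\<Prod>l\<leftarrow>w. \<phi> (fst l)) *\<^sub>R 1)" if "fst ` set w \<subseteq> X" for w
    using that
  proof (induction w)
    case (Cons l w)
    then show ?case
      using null_eq_mult[OF letter[of l] Cons.IH] by (simp add: mono_Cons mult.commute)
  qed (simp add: mono_Nil)
  have "null_eq (\<Sum>w\<in>support x. scaleC (coeff x w) (monomial w))
    (\<Sum>w\<in>support x. scaleC (coeff x w * of_real (\<Prod>l\<leftarrow>w. \<phi> (fst l))) 1)"
  proof (rule null_eq_sum)
    fix w assume w: "w \<in> support x"
    then have "null_eq (scaleC (coeff x w) 1 * monomial w) (scaleC (coeff x w) 1 * (\<Prod>l\<leftarrow>w. \<phi> (fst l)) *\<^sub>R 1)"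
      using assms(2) by (intro null_eq_mult monomial null_eq_refl) (auto simp: poly_on_def)
    then show "null_eq (scaleC (coeff x w) (monomial w)) (scaleC (coeff x w * of_real (\<Prod>l\<leftarrow>w. \<phi> (fst l))) 1)"
      by (simp add: scaleR_fpoly_def one_mult mult.commute)
  qed
  moreover have "(\<Sum>w\<in>A. scaleC (h w) (1 :: 'a fpoly)) = scaleC (\<Sum>w\<in>A. h w) 1" for h and A :: "('a \<times> bool) list set"
    by (induction A rule: infinite_finite_induct) auto
  ultimately show ?thesis
    unfolding fpoly_expansion[symmetric] eval_at_def null_eq_def by simp
qed

section \<open>Completions of the free *-algebra\<close>

lemma carrier_free: "carrier (free_star_algebra X s) = coeff ` poly_on X"
proof (intro equalityI subsetI)
  fix f assume "f \<in> carrier (free_star_algebra X s)"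
  then have f: "finite {w. f w \<noteq> 0}" "\<forall>w. f w \<noteq> 0 \<longrightarrow> fst ` set w \<subseteq> X"
    by (simp_all add: free_star_algebra_def)
  then have "coeff (Abs_fpoly f) = f" by (simp add: Abs_fpoly_inverse)
  then show "f \<in> coeff ` poly_on X"
    using f(2) by (intro image_eqI[of _ _ "Abs_fpoly f"]) (simp_all add: poly_on_def)
next
  fix f :: "'a free_poly" assume "f \<in> coeff ` poly_on X"
  then obtain x where "f = coeff x" "x \<in> poly_on X" by blast
  then show "f \<in> carrier (free_star_algebra X s)"
    using finite_support[of x] by (auto simp: poly_on_def free_star_algebra_def)
qed

lemma free_ops:
  "coeff x \<otimes>\<^bsub>free_star_algebra X s\<^esub> coeff y = coeff (x * y)"
  "coeff x \<oplus>\<^bsub>free_star_algebra X s\<^esub> coeff y = coeff (x + y)"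
  "\<one>\<^bsub>free_star_algebra X s\<^esub> = coeff 1" "\<zero>\<^bsub>free_star_algebra X s\<^esub> = coeff 0"
  "c \<odot>\<^bsub>free_star_algebra X s\<^esub> coeff x = coeff (scaleC c x)"
  "adj (free_star_algebra X s) (coeff x) = coeff (star x)"
  "anorm (free_star_algebra X s) = s"
  by (auto simp: free_star_algebra_def coeff_times coeff_star flip_def intro!: ext)

lemma abelian_group_free: "abelian_group (free_star_algebra X s)"
proof (rule abelian_groupI)
  fix f assume "f \<in> carrier (free_star_algebra X s)"
  then obtain x where x: "f = coeff x" "x \<in> poly_on X" unfolding carrier_free by blast
  show "\<exists>g\<in>carrier (free_star_algebra X s). g \<oplus>\<^bsub>free_star_algebra X s\<^esub> f = \<zero>\<^bsub>free_star_algebra X s\<^esub>"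
    using x poly_on_closed(5)[of x X]
    by (intro bexI[of _ "coeff (- x)"]) (simp_all add: free_ops carrier_free)
qed (auto simp: carrier_free free_ops poly_on_closed algebra_simps intro!: imageI)

lemma free_minus:
  assumes "x \<in> poly_on X" "y \<in> poly_on X"
  shows "coeff x \<ominus>\<^bsub>free_star_algebra X s\<^esub> coeff y = coeff (x - y)"
proof -
  interpret abelian_group "free_star_algebra X s" by (rule abelian_group_free)
  have "\<ominus>\<^bsub>free_star_algebra X s\<^esub> coeff y = coeff (- y)"
    using assms by (intro minus_equality) (auto simp: carrier_free free_ops poly_on_closed)
  then show ?thesis by (simp add: a_minus_def free_ops)
qed

text \<open>
  Precomposition with \<open>restrict_letters\<close> makes this a C*-seminorm on all polynomials whenever \<open>s\<close> is one on the
  polynomials over \<open>X\<close>.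
\<close>

definition norm_on :: "'g set \<Rightarrow> ('g free_poly \<Rightarrow> real) \<Rightarrow> 'g fpoly \<Rightarrow> real" where
  "norm_on X s x = s (coeff (restrict_letters X x))"

lemma norm_on_eq: "x \<in> poly_on X \<Longrightarrow> norm_on X s x = s (coeff x)"
  by (simp add: norm_on_def)

lemma has_cstar_seminorm_freeD:
  assumes "has_cstar_seminorm (free_star_algebra X s)"
  shows "cstar_seminorm (norm_on X s)"
proof -
  note * = assms[unfolded has_cstar_seminorm_def carrier_free free_ops ball_simps free_ops, simplified free_ops]
  show ?thesis
  proof
    fix x y :: "'a fpoly" and r :: real
    have in_X: "restrict_letters X z \<in> poly_on X" for z :: "'a fpoly" by (rule restrict_letters_in)
    show "norm_on X s (x + y) \<le> norm_on X s x + norm_on X s y"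
      "norm_on X s (x * y) \<le> norm_on X s x * norm_on X s y"
      "norm_on X s (star x * x) = (norm_on X s x)\<^sup>2"
      using * in_X by (simp_all add: norm_on_def restrict_letters_hom restrict_letters_mult)
    have "s (coeff (scaleC (of_real r) (restrict_letters X x))) = cmod (of_real r) * s (coeff (restrict_letters X x))"
      using * in_X by blast
    then show "norm_on X s (r *\<^sub>R x) = \<bar>r\<bar> * norm_on X s x"
      by (simp add: norm_on_def restrict_letters_hom scaleC_of_real)
  qed
qed

lemma has_cstar_seminorm_freeI:
  assumes "cstar_seminorm N" "\<And>x. x \<in> poly_on X \<Longrightarrow> s (coeff x) = N x"
  shows "has_cstar_seminorm (free_star_algebra X s)"
proof -
  interpret cstar_seminorm N by fact
  show ?thesis
    unfolding has_cstar_seminorm_def carrier_free ball_simps free_ops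
    by (auto simp: free_ops assms(2) poly_on_closed triangle submult cstar cstar_seminorm_scaleC[OF assms(1)])
qed

text \<open>
  Elements of the completion are written \<open>cls x\<close> with \<open>x\<close> a Cauchy sequence of polynomials, on which the operations act
  termwise.
\<close>

locale free_cstar =
  fixes X :: "'g set" and s :: "'g free_poly \<Rightarrow> real"
  assumes has_cstar: "has_cstar_seminorm (free_star_algebra X s)"
begin

sublocale cstar_seminorm "norm_on X s"
  by (rule has_cstar_seminorm_freeD[OF has_cstar])

abbreviation A :: "'g free_poly star_algebra" where "A \<equiv> free_star_algebra X s"
abbreviation C :: "(nat \<Rightarrow> 'g free_poly) set star_algebra" where "C \<equiv> completion A"
abbreviation nrm :: "'g fpoly \<Rightarrow> real" where "nrm \<equiv> norm_on X s"

definition cseq :: "(nat \<Rightarrow> 'g fpoly) set" where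
  "cseq = {x. (\<forall>n. x n \<in> poly_on X) \<and> (\<forall>e>0. \<exists>M. \<forall>m\<ge>M. \<forall>n\<ge>M. nrm (x m - x n) < e)}"

definition cls :: "(nat \<Rightarrow> 'g fpoly) \<Rightarrow> (nat \<Rightarrow> 'g free_poly) set" where
  "cls x = cauchy_class A (\<lambda>n. coeff (x n))"

definition limnorm :: "(nat \<Rightarrow> 'g fpoly) \<Rightarrow> real" where
  "limnorm x = lim (\<lambda>n. nrm (x n))"

lemma cseq_poly_on: "x \<in> cseq \<Longrightarrow> x n \<in> poly_on X"
  by (simp add: cseq_def)

lemma abs_norm_diff: "\<bar>nrm x - nrm y\<bar> \<le> nrm (x - y)"
  using le_diff[of x y] le_diff[of y x] minus_commute[of x y] by simp

lemma cseq_norm_limit: "x \<in> cseq \<Longrightarrow> (\<lambda>n. nrm (x n)) \<longlonglongrightarrow> limnorm x"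
proof -
  assume x: "x \<in> cseq"
  have "Cauchy (\<lambda>n. nrm (x n))"
  proof (rule CauchyI)
    fix e :: real assume "0 < e"
    then obtain M where "\<forall>m\<ge>M. \<forall>n\<ge>M. nrm (x m - x n) < e" using x by (auto simp: cseq_def)
    then show "\<exists>M. \<forall>m\<ge>M. \<forall>n\<ge>M. norm (nrm (x m) - nrm (x n)) < e"
      by (intro exI[of _ M] allI impI) (auto intro: le_less_trans[OF abs_norm_diff])
  qed
  then show ?thesis by (simp add: limnorm_def Cauchy_convergent_iff convergent_LIMSEQ_iff)
qed

lemma limnorm_eqI: "x \<in> cseq \<Longrightarrow> (\<lambda>n. nrm (x n)) \<longlonglongrightarrow> r \<Longrightarrow> limnorm x = r"
  using LIMSEQ_unique cseq_norm_limit by blast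

lemma cseq_const: "x \<in> poly_on X \<Longrightarrow> (\<lambda>_. x) \<in> cseq"
  by (simp add: cseq_def)

lemma limnorm_const: "x \<in> poly_on X \<Longrightarrow> limnorm (\<lambda>_. x) = nrm x"
  by (rule limnorm_eqI) (simp_all add: cseq_const)

lemma cseqI_le:
  assumes "x \<in> cseq" "y \<in> cseq" "\<And>n. z n \<in> poly_on X" "0 \<le> K"
    "\<And>m n. nrm (z m - z n) \<le> K * (nrm (x m - x n) + nrm (y m - y n))"
  shows "z \<in> cseq"
  unfolding cseq_def
proof (intro CollectI conjI allI impI assms(3))
  fix e :: real assume e: "0 < e"
  \<comment> \<open>\<open>K + 1\<close> instead of \<open>K\<close>, which may be \<open>0\<close>\<close>
  define d where "d = e / (2 * (K + 1))"
  have d: "0 < d" "2 * K * d < e" using e assms(4) by (auto simp: d_def field_simps)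
  obtain M where M: "\<forall>m\<ge>M. \<forall>n\<ge>M. nrm (x m - x n) < d" using assms(1) d by (auto simp: cseq_def)
  obtain M' where M': "\<forall>m\<ge>M'. \<forall>n\<ge>M'. nrm (y m - y n) < d" using assms(2) d by (auto simp: cseq_def)
  show "\<exists>M. \<forall>m\<ge>M. \<forall>n\<ge>M. nrm (z m - z n) < e"
  proof (intro exI[of _ "max M M'"] allI impI)
    fix m n assume "max M M' \<le> m" "max M M' \<le> n"
    then have "nrm (x m - x n) < d" "nrm (y m - y n) < d" using M M' by simp_all
    then have "nrm (x m - x n) + nrm (y m - y n) \<le> 2 * d" by simp
    then have "K * (nrm (x m - x n) + nrm (y m - y n)) \<le> K * (2 * d)"
      by (rule mult_left_mono) (rule assms(4))
    also have "\<dots> < e" using d(2) by simp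
    finally show "nrm (z m - z n) < e" using assms(5)[of m n] by simp
  qed
qed

lemma cseq_bounded:
  assumes "x \<in> cseq"
  obtains K where "0 \<le> K" "\<And>n. nrm (x n) \<le> K"
proof -
  have "Bseq (\<lambda>n. nrm (x n))" using cseq_norm_limit[OF assms] convergentI convergent_imp_Bseq by blast
  then obtain K where "0 < K" "\<And>n. norm (nrm (x n)) \<le> K" by (rule BseqE) blast
  then show ?thesis using that[of K] by simp
qed

lemma cseq_add: "x \<in> cseq \<Longrightarrow> y \<in> cseq \<Longrightarrow> (\<lambda>n. x n + y n) \<in> cseq"
proof (rule cseqI_le[of x y _ 1])
  fix m n
  show "nrm (x m + y m - (x n + y n)) \<le> 1 * (nrm (x m - x n) + nrm (y m - y n))"
    using triangle[of "x m - x n" "y m - y n"] by (simp add: algebra_simps)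
qed (auto intro: poly_on_closed cseq_poly_on)

lemma cseq_mult:
  assumes "x \<in> cseq" "y \<in> cseq"
  shows "(\<lambda>n. x n * y n) \<in> cseq"
proof -
  obtain K where K: "0 \<le> K" "\<And>n. nrm (x n) \<le> K" by (rule cseq_bounded[OF assms(1)]) blast
  obtain L where L: "0 \<le> L" "\<And>n. nrm (y n) \<le> L" by (rule cseq_bounded[OF assms(2)]) blast
  show ?thesis
  proof (rule cseqI_le[OF assms, of _ "K + L"])
    fix m n
    have "x m * y m - x n * y n = x m * (y m - y n) + (x m - x n) * y n" by (simp add: algebra_simps)
    then have "nrm (x m * y m - x n * y n) \<le> nrm (x m) * nrm (y m - y n) + nrm (x m - x n) * nrm (y n)"
      using triangle[of "x m * (y m - y n)" "(x m - x n) * y n"] submult[of "x m" "y m - y n"]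
        submult[of "x m - x n" "y n"] by simp
    also have "\<dots> \<le> (K + L) * nrm (y m - y n) + nrm (x m - x n) * (K + L)"
      using K L by (intro add_mono mult_mono) (simp_all add: add_increasing add_increasing2)
    finally show "nrm (x m * y m - x n * y n) \<le> (K + L) * (nrm (x m - x n) + nrm (y m - y n))"
      by (simp add: algebra_simps)
  qed (use assms K L in \<open>auto intro: poly_on_closed cseq_poly_on\<close>)
qed

lemma cseq_scaleC: "x \<in> cseq \<Longrightarrow> (\<lambda>n. scaleC c (x n)) \<in> cseq"
  using cseq_mult[OF cseq_const[of "scaleC c 1"], of x] by (simp add: poly_on_closed)

lemma cseq_minus: "x \<in> cseq \<Longrightarrow> (\<lambda>n. - x n) \<in> cseq"
  using cseq_mult[OF cseq_const[of "- 1"], of x] by (simp add: poly_on_closed)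

lemma cseq_diff: "x \<in> cseq \<Longrightarrow> y \<in> cseq \<Longrightarrow> (\<lambda>n. x n - y n) \<in> cseq"
  using cseq_add[OF _ cseq_minus, of x y] by simp

lemma cseq_star: "x \<in> cseq \<Longrightarrow> (\<lambda>n. star (x n)) \<in> cseq"
  by (rule cseqI_le[of x x _ 1]) (auto intro: poly_on_closed cseq_poly_on simp: star_diff[symmetric])

lemmas cseq_ops = cseq_const cseq_add cseq_mult cseq_scaleC cseq_minus cseq_diff cseq_star

lemma cauchy_seqs_eq: "cauchy_seqs A = (\<lambda>x n. coeff (x n)) ` cseq"
proof (intro equalityI subsetI)
  fix F assume F: "F \<in> cauchy_seqs A"
  then have "\<forall>n. \<exists>x. F n = coeff x \<and> x \<in> poly_on X"
    unfolding cauchy_seqs_def carrier_free by blast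
  then obtain x where x: "\<And>n. F n = coeff (x n)" "\<And>n. x n \<in> poly_on X" by metis
  then have "x \<in> cseq"
    using F by (simp add: cauchy_seqs_def cseq_def free_minus free_ops norm_on_eq poly_on_closed)
  then show "F \<in> (\<lambda>x n. coeff (x n)) ` cseq" using x(1) by (intro image_eqI[of _ _ x]) auto
next
  fix F assume "F \<in> (\<lambda>x n. coeff (x n)) ` cseq"
  then obtain x where x: "F = (\<lambda>n. coeff (x n))" "x \<in> cseq" by blast
  then show "F \<in> cauchy_seqs A"
    by (auto simp: cauchy_seqs_def cseq_def free_minus free_ops norm_on_eq poly_on_closed carrier_free)
qed

lemma coeff_seq_eq_iff: "(\<lambda>n. coeff (x n)) = (\<lambda>n. coeff (y n)) \<longleftrightarrow> x = y"
  by (auto simp: fun_eq_iff intro!: ext fpoly_eqI)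

lemma cauchy_rel_iff:
  "((\<lambda>n. coeff (x n)), (\<lambda>n. coeff (y n))) \<in> cauchy_rel A \<longleftrightarrow>
     x \<in> cseq \<and> y \<in> cseq \<and> limnorm (\<lambda>n. x n - y n) = 0"
proof -
  have "(\<lambda>n. coeff (x n)) \<in> cauchy_seqs A \<longleftrightarrow> x \<in> cseq" for x
    unfolding cauchy_seqs_eq by (auto simp: coeff_seq_eq_iff)
  moreover have "(\<lambda>n. anorm A (coeff (x n) \<ominus>\<^bsub>A\<^esub> coeff (y n))) = (\<lambda>n. nrm (x n - y n))" if "x \<in> cseq" "y \<in> cseq"
    using that by (simp add: free_minus cseq_poly_on free_ops norm_on_eq poly_on_closed)
  moreover have "(\<lambda>n. nrm (x n - y n)) \<longlonglongrightarrow> 0 \<longleftrightarrow> limnorm (\<lambda>n. x n - y n) = 0" if "x \<in> cseq" "y \<in> cseq"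
    using cseq_norm_limit[OF cseq_diff[OF that]] limnorm_eqI[OF cseq_diff[OF that]] by metis
  ultimately show ?thesis unfolding cauchy_rel_def by auto
qed

lemma cls_alt: "cls x = {(\<lambda>n. coeff (y n)) | y. x \<in> cseq \<and> y \<in> cseq \<and> limnorm (\<lambda>n. x n - y n) = 0}"
proof -
  have "F \<in> cls x \<Longrightarrow> \<exists>y. F = (\<lambda>n. coeff (y n))" for F
    unfolding cls_def cauchy_rel_def cauchy_seqs_eq by auto
  then show ?thesis
    using cauchy_rel_iff[of x] unfolding cls_def by auto
qed

lemma limnorm_nonneg: "x \<in> cseq \<Longrightarrow> 0 \<le> limnorm x"
  by (rule LIMSEQ_le_const[OF cseq_norm_limit]) auto

lemma limnorm_add: "x \<in> cseq \<Longrightarrow> y \<in> cseq \<Longrightarrow> limnorm (\<lambda>n. x n + y n) \<le> limnorm x + limnorm y"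
  by (rule LIMSEQ_le[OF cseq_norm_limit[OF cseq_add] tendsto_add[OF cseq_norm_limit cseq_norm_limit]])
    (auto intro: triangle)

lemma limnorm_mult: "x \<in> cseq \<Longrightarrow> y \<in> cseq \<Longrightarrow> limnorm (\<lambda>n. x n * y n) \<le> limnorm x * limnorm y"
  by (rule LIMSEQ_le[OF cseq_norm_limit[OF cseq_mult] tendsto_mult[OF cseq_norm_limit cseq_norm_limit]])
    (auto intro: submult)

lemma limnorm_minus_commute: "limnorm (\<lambda>n. x n - y n) = limnorm (\<lambda>n. y n - x n)"
  unfolding limnorm_def by (subst minus_commute) (rule refl)

lemma limnorm_triangle:
  assumes "x \<in> cseq" "y \<in> cseq" "z \<in> cseq"
  shows "limnorm (\<lambda>n. x n - z n) \<le> limnorm (\<lambda>n. x n - y n) + limnorm (\<lambda>n. y n - z n)"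
  using limnorm_add[OF cseq_diff[OF assms(1,2)] cseq_diff[OF assms(2,3)]] by simp

lemma cls_eq_iff:
  assumes "x \<in> cseq" "y \<in> cseq"
  shows "cls x = cls y \<longleftrightarrow> limnorm (\<lambda>n. x n - y n) = 0"
proof
  assume "cls x = cls y"
  moreover have "(\<lambda>n. coeff (y n)) \<in> cls y"
    using assms limnorm_const[of 0] unfolding cls_alt by (auto simp: poly_on_closed)
  ultimately have "((\<lambda>n. coeff (x n)), (\<lambda>n. coeff (y n))) \<in> cauchy_rel A" by (auto simp: cls_def)
  then show "limnorm (\<lambda>n. x n - y n) = 0" by (simp add: cauchy_rel_iff)
next
  assume eq: "limnorm (\<lambda>n. x n - y n) = 0"
  have "limnorm (\<lambda>n. x n - z n) = 0 \<longleftrightarrow> limnorm (\<lambda>n. y n - z n) = 0" if z: "z \<in> cseq" for z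
    using limnorm_triangle[OF assms z] limnorm_triangle[OF assms(2,1) z] eq limnorm_minus_commute[of x y]
      limnorm_nonneg[OF cseq_diff[OF assms(1) z]] limnorm_nonneg[OF cseq_diff[OF assms(2) z]] by linarith
  then show "cls x = cls y" using assms unfolding cls_alt by blast
qed

lemma in_cls_iff: "x \<in> cseq \<Longrightarrow> F \<in> cls x \<longleftrightarrow> (\<exists>y\<in>cseq. F = (\<lambda>n. coeff (y n)) \<and> cls y = cls x)"
  using cls_eq_iff[of x] unfolding cls_alt[of x] by blast

lemma UN_cls:
  assumes "x \<in> cseq" "\<And>y. y \<in> cseq \<Longrightarrow> cls y = cls x \<Longrightarrow> f (\<lambda>n. coeff (y n)) = K"
  shows "(\<Union>F\<in>cls x. f F) = K"
proof -
  have "cls x \<noteq> {}" using in_cls_iff[OF assms(1)] assms(1) by blast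
  moreover have "f F = K" if F: "F \<in> cls x" for F
  proof -
    obtain y where "y \<in> cseq" "F = (\<lambda>n. coeff (y n))" "cls y = cls x"
      using F in_cls_iff[OF assms(1), of F] by blast
    then show ?thesis using assms(2)[of y] by simp
  qed
  ultimately show ?thesis by simp
qed

lemma completion_carrier: "carrier C = cls ` cseq"
  by (auto simp: completion_def quotient_def cauchy_seqs_eq cls_def)

lemma cls_add_cong:
  assumes "x \<in> cseq" "y \<in> cseq" "x' \<in> cseq" "y' \<in> cseq" "cls x' = cls x" "cls y' = cls y"
  shows "cls (\<lambda>n. x' n + y' n) = cls (\<lambda>n. x n + y n)"
proof -
  have "limnorm (\<lambda>n. (x' n - x n) + (y' n - y n)) \<le> 0"
    using limnorm_add[OF cseq_diff[OF assms(3,1)] cseq_diff[OF assms(4,2)]] assms cls_eq_iff by simp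
  then have "limnorm (\<lambda>n. (x' n + y' n) - (x n + y n)) = 0"
    using limnorm_nonneg[OF cseq_diff[OF cseq_add cseq_add], of x' y' x y] assms by (simp add: algebra_simps)
  then show ?thesis using assms by (subst cls_eq_iff) (auto intro: cseq_add)
qed

lemma cls_mult_cong:
  assumes "x \<in> cseq" "y \<in> cseq" "x' \<in> cseq" "y' \<in> cseq" "cls x' = cls x" "cls y' = cls y"
  shows "cls (\<lambda>n. x' n * y' n) = cls (\<lambda>n. x n * y n)"
proof -
  have "limnorm (\<lambda>n. x' n * (y' n - y n) + (x' n - x n) * y n)
      \<le> limnorm (\<lambda>n. x' n * (y' n - y n)) + limnorm (\<lambda>n. (x' n - x n) * y n)"
    using assms by (intro limnorm_add cseq_ops) auto
  also have "\<dots> \<le> limnorm x' * limnorm (\<lambda>n. y' n - y n) + limnorm (\<lambda>n. x' n - x n) * limnorm y"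
    using assms by (intro add_mono limnorm_mult cseq_ops) auto
  also have "\<dots> = 0" using assms cls_eq_iff by simp
  finally have "limnorm (\<lambda>n. x' n * y' n - x n * y n) = 0"
    using limnorm_nonneg[OF cseq_diff[OF cseq_mult cseq_mult], of x' y' x y] assms by (simp add: algebra_simps)
  then show ?thesis using assms by (subst cls_eq_iff) (auto intro: cseq_mult)
qed

lemma cls_star_cong:
  assumes "x \<in> cseq" "x' \<in> cseq" "cls x' = cls x"
  shows "cls (\<lambda>n. star (x' n)) = cls (\<lambda>n. star (x n))"
  using assms by (subst cls_eq_iff) (auto intro: cseq_star simp: star_diff[symmetric] cls_eq_iff limnorm_def)

lemma cls_scaleC_cong:
  assumes "x \<in> cseq" "x' \<in> cseq" "cls x' = cls x"
  shows "cls (\<lambda>n. scaleC c (x' n)) = cls (\<lambda>n. scaleC c (x n))"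
  using cls_mult_cong[OF cseq_const[of "scaleC c 1"] assms(1) cseq_const[of "scaleC c 1"] assms(2) refl assms(3)]
  by (simp add: poly_on_closed)

lemma completion_ops:
  assumes "x \<in> cseq" "y \<in> cseq"
  shows "cls x \<oplus>\<^bsub>C\<^esub> cls y = cls (\<lambda>n. x n + y n)"
    and "cls x \<otimes>\<^bsub>C\<^esub> cls y = cls (\<lambda>n. x n * y n)"
    and "c \<odot>\<^bsub>C\<^esub> cls x = cls (\<lambda>n. scaleC c (x n))"
    and "adj C (cls x) = cls (\<lambda>n. star (x n))"
    and "anorm C (cls x) = limnorm x"
proof -
  have "(\<Union>F\<in>cls x. \<Union>G\<in>cls y. cauchy_class A (\<lambda>n. F n \<oplus>\<^bsub>A\<^esub> G n)) = cls (\<lambda>n. x n + y n)"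
  proof (intro UN_cls assms)
    fix x' y' assume "x' \<in> cseq" "cls x' = cls x" "y' \<in> cseq" "cls y' = cls y"
    then show "cauchy_class A (\<lambda>n. coeff (x' n) \<oplus>\<^bsub>A\<^esub> coeff (y' n)) = cls (\<lambda>n. x n + y n)"
      using cls_add_cong[OF assms, of x' y'] by (simp only: free_ops cls_def[symmetric])
  qed
  then show "cls x \<oplus>\<^bsub>C\<^esub> cls y = cls (\<lambda>n. x n + y n)" by (simp add: completion_def)
  have "(\<Union>F\<in>cls x. \<Union>G\<in>cls y. cauchy_class A (\<lambda>n. F n \<otimes>\<^bsub>A\<^esub> G n)) = cls (\<lambda>n. x n * y n)"
  proof (intro UN_cls assms)
    fix x' y' assume "x' \<in> cseq" "cls x' = cls x" "y' \<in> cseq" "cls y' = cls y"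
    then show "cauchy_class A (\<lambda>n. coeff (x' n) \<otimes>\<^bsub>A\<^esub> coeff (y' n)) = cls (\<lambda>n. x n * y n)"
      using cls_mult_cong[OF assms, of x' y'] by (simp only: free_ops cls_def[symmetric])
  qed
  then show "cls x \<otimes>\<^bsub>C\<^esub> cls y = cls (\<lambda>n. x n * y n)" by (simp add: completion_def)
  have "(\<Union>F\<in>cls x. cauchy_class A (\<lambda>n. c \<odot>\<^bsub>A\<^esub> F n)) = cls (\<lambda>n. scaleC c (x n))"
  proof (intro UN_cls assms)
    fix x' assume "x' \<in> cseq" "cls x' = cls x"
    then show "cauchy_class A (\<lambda>n. c \<odot>\<^bsub>A\<^esub> coeff (x' n)) = cls (\<lambda>n. scaleC c (x n))"
      using cls_scaleC_cong[OF assms(1), of x' c] by (simp only: free_ops cls_def[symmetric])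
  qed
  then show "c \<odot>\<^bsub>C\<^esub> cls x = cls (\<lambda>n. scaleC c (x n))" by (simp add: completion_def)
  have "(\<Union>F\<in>cls x. cauchy_class A (\<lambda>n. adj A (F n))) = cls (\<lambda>n. star (x n))"
  proof (intro UN_cls assms)
    fix x' assume "x' \<in> cseq" "cls x' = cls x"
    then show "cauchy_class A (\<lambda>n. adj A (coeff (x' n))) = cls (\<lambda>n. star (x n))"
      using cls_star_cong[OF assms(1), of x'] by (simp only: free_ops cls_def[symmetric])
  qed
  then show "adj C (cls x) = cls (\<lambda>n. star (x n))" by (simp add: completion_def)
  have lim: "limnorm z = limnorm x" if "z \<in> cseq" "cls z = cls x" for z
    using that assms limnorm_add[OF cseq_diff[of z x], of x] limnorm_add[OF cseq_diff[of x z], of z]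
      limnorm_minus_commute[of z x] cls_eq_iff[of z x] by simp
  have "(THE r. \<exists>F\<in>cls x. (\<lambda>n. anorm A (F n)) \<longlonglongrightarrow> r) = limnorm x"
  proof (rule the_equality)
    have "(\<lambda>n. anorm A (coeff (x n))) = (\<lambda>n. nrm (x n))"
      using assms by (simp add: free_ops norm_on_eq cseq_poly_on)
    then show "\<exists>F\<in>cls x. (\<lambda>n. anorm A (F n)) \<longlonglongrightarrow> limnorm x"
      using cseq_norm_limit[OF assms(1)] in_cls_iff[OF assms(1)] assms(1)
      by (intro bexI[of _ "\<lambda>n. coeff (x n)"]) auto
  next
    fix r assume "\<exists>F\<in>cls x. (\<lambda>n. anorm A (F n)) \<longlonglongrightarrow> r"
    then obtain z where z: "z \<in> cseq" "cls z = cls x" "(\<lambda>n. anorm A (coeff (z n))) \<longlonglongrightarrow> r"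
      using in_cls_iff[OF assms(1)] by auto
    then have "(\<lambda>n. nrm (z n)) \<longlonglongrightarrow> r" by (simp add: free_ops norm_on_eq cseq_poly_on)
    then show "r = limnorm x" using lim z limnorm_eqI by blast
  qed
  then show "anorm C (cls x) = limnorm x" by (simp add: completion_def)
qed

lemma completion_unary_ops:
  assumes "x \<in> cseq"
  shows "c \<odot>\<^bsub>C\<^esub> cls x = cls (\<lambda>n. scaleC c (x n))"
    and "adj C (cls x) = cls (\<lambda>n. star (x n))"
    and "anorm C (cls x) = limnorm x"
  using completion_ops(3-5)[OF assms assms] by simp_all

lemma completion_one_zero: "\<one>\<^bsub>C\<^esub> = cls (\<lambda>_. 1)" "\<zero>\<^bsub>C\<^esub> = cls (\<lambda>_. 0)"
  by (simp_all add: completion_def free_ops cls_def)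

lemma ring_completion: "ring C"
proof (rule ringI)
  show "abelian_group C"
  proof (rule abelian_groupI)
    fix U assume "U \<in> carrier C"
    then obtain x where x: "U = cls x" "x \<in> cseq" unfolding completion_carrier by blast
    show "\<exists>V\<in>carrier C. V \<oplus>\<^bsub>C\<^esub> U = \<zero>\<^bsub>C\<^esub>"
      using x cseq_minus[of x]
      by (intro bexI[of _ "cls (\<lambda>n. - x n)"]) (simp_all add: completion_ops completion_one_zero completion_carrier)
  qed (auto simp: completion_carrier completion_ops completion_one_zero cseq_ops poly_on_closed algebra_simps)
  show "Group.monoid C"
    by (rule monoidI) (auto simp: completion_carrier completion_ops completion_one_zero cseq_ops poly_on_closed algebra_simps)
qed (auto simp: completion_carrier completion_ops cseq_ops algebra_simps)

lemma completion_neg: "x \<in> cseq \<Longrightarrow> \<ominus>\<^bsub>C\<^esub> cls x = cls (\<lambda>n. - x n)"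
proof -
  assume x: "x \<in> cseq"
  interpret C: ring C by (rule ring_completion)
  show ?thesis
    using x by (intro C.minus_equality)
      (auto simp: completion_ops completion_one_zero cseq_ops completion_carrier)
qed

lemma completion_minus: "x \<in> cseq \<Longrightarrow> y \<in> cseq \<Longrightarrow> cls x \<ominus>\<^bsub>C\<^esub> cls y = cls (\<lambda>n. x n - y n)"
  by (simp add: a_minus_def completion_neg completion_ops cseq_ops)

lemma completion_finsum:
  assumes "finite I" "\<And>i. i \<in> I \<Longrightarrow> f i \<in> poly_on X"
  shows "(\<Oplus>\<^bsub>C\<^esub>i\<in>I. cls (\<lambda>_. f i)) = cls (\<lambda>_. \<Sum>i\<in>I. f i)"
proof -
  interpret C: ring C by (rule ring_completion)
  show ?thesis using assms
  proof (induction I rule: finite_induct)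
    case empty
    then show ?case by (simp add: completion_one_zero)
  next
    case (insert i I)
    then have "(\<Oplus>\<^bsub>C\<^esub>i\<in>insert i I. cls (\<lambda>_. f i)) = cls (\<lambda>_. f i) \<oplus>\<^bsub>C\<^esub> (\<Oplus>\<^bsub>C\<^esub>i\<in>I. cls (\<lambda>_. f i))"
      by (intro C.finsum_insert) (auto simp: completion_carrier cseq_ops)
    then show ?case using insert by (simp add: completion_ops cseq_const poly_on_sum)
  qed
qed

lemma const_eq_iff: "x \<in> poly_on X \<Longrightarrow> y \<in> poly_on X \<Longrightarrow> cls (\<lambda>_. x) = cls (\<lambda>_. y) \<longleftrightarrow> nrm (x - y) = 0"
  by (simp add: cls_eq_iff cseq_const limnorm_const poly_on_closed)

lemma completion_dense:
  assumes "x \<in> cseq" "0 < e"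
  obtains y where "y \<in> poly_on X" "limnorm (\<lambda>n. x n - y) < e"
proof -
  obtain M where M: "\<forall>m\<ge>M. \<forall>n\<ge>M. nrm (x m - x n) < e/2"
    using assms by (auto simp: cseq_def dest: spec[of _ "e/2"])
  have "limnorm (\<lambda>n. x n - x M) \<le> e/2"
    using M assms(1)
    by (intro LIMSEQ_le_const2[OF cseq_norm_limit[OF cseq_diff[OF assms(1) cseq_const]]])
      (auto simp: cseq_poly_on intro!: exI[of _ M] less_imp_le)
  then show ?thesis using that[of "x M"] assms by (simp add: cseq_poly_on)
qed

end

section \<open>Defining relations and universal C*-seminorms\<close>

abbreviation ent :: "nat \<Rightarrow> nat \<Rightarrow> entry fpoly" where
  "ent i j \<equiv> gen (i, j)"

text \<open>
  The relations between the entries of a matrix become sets of polynomials that have to vanish. That a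
  family of generators satisfies them is then a statement about null elements of a seminorm, which passes to
  suprema of seminorms and can be tested at characters.
\<close>

definition hermitian_rel :: "nat set \<Rightarrow> nat set \<Rightarrow> entry fpoly set" where
  "hermitian_rel I J = {star (ent i j) - ent i j | i j. i \<in> I \<and> j \<in> J}"
definition row_rel :: "nat set \<Rightarrow> nat set \<Rightarrow> entry fpoly set" where
  "row_rel I J = {(\<Sum>j\<in>J. ent i j * ent l j) - (if i = l then 1 else 0) | i l. i \<in> I \<and> l \<in> I}"
definition col_rel :: "nat set \<Rightarrow> nat set \<Rightarrow> entry fpoly set" where
  "col_rel I J = {(\<Sum>i\<in>I. ent i j * ent i l) - (if j = l then 1 else 0) | j l. j \<in> J \<and> l \<in> J}"
definition idem_rel :: "nat set \<Rightarrow> nat set \<Rightarrow> entry fpoly set" where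
  "idem_rel I J = {ent i j * ent i j - ent i j | i j. i \<in> I \<and> j \<in> J}"
definition row_disjoint_rel :: "nat set \<Rightarrow> nat set \<Rightarrow> entry fpoly set" where
  "row_disjoint_rel I J = {ent i j * ent i l | i j l. i \<in> I \<and> j \<in> J \<and> l \<in> J \<and> j \<noteq> l}"
definition col_disjoint_rel :: "nat set \<Rightarrow> nat set \<Rightarrow> entry fpoly set" where
  "col_disjoint_rel I J = {ent i j * ent l j | i l j. i \<in> I \<and> l \<in> I \<and> j \<in> J \<and> i \<noteq> l}"
definition row_sum_rel :: "nat set \<Rightarrow> nat set \<Rightarrow> entry fpoly set" where
  "row_sum_rel I J = {(\<Sum>j\<in>J. ent i j) - 1 | i. i \<in> I}"
definition col_sum_rel :: "nat set \<Rightarrow> nat set \<Rightarrow> entry fpoly set" where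
  "col_sum_rel I J = {(\<Sum>i\<in>I. ent i j) - 1 | j. j \<in> J}"

lemmas rel_defs = hermitian_rel_def row_rel_def col_rel_def idem_rel_def row_disjoint_rel_def
  col_disjoint_rel_def row_sum_rel_def col_sum_rel_def

abbreviation orthogonal_rel :: "nat \<Rightarrow> entry fpoly set" where
  "orthogonal_rel n \<equiv> hermitian_rel {1..n} {1..n} \<union> row_rel {1..n} {1..n} \<union> col_rel {1..n} {1..n}"

abbreviation orthogonal_isometry_rel :: "nat \<Rightarrow> nat \<Rightarrow> entry fpoly set" where
  "orthogonal_isometry_rel k n \<equiv> hermitian_rel {k<..n} {1..n} \<union> row_rel {k<..n} {1..n}"

fun group_rel :: "quantum_family \<Rightarrow> nat \<Rightarrow> entry fpoly set" where
  "group_rel O_plus n = orthogonal_rel n"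
| "group_rel S_plus n = orthogonal_rel n \<union> idem_rel {1..n} {1..n}"
| "group_rel H_plus n = orthogonal_rel n \<union> row_disjoint_rel {1..n} {1..n} \<union> col_disjoint_rel {1..n} {1..n}"
| "group_rel B_plus n = orthogonal_rel n \<union> row_sum_rel {1..n} {1..n} \<union> col_sum_rel {1..n} {1..n}"

fun isometry_rel :: "quantum_family \<Rightarrow> nat \<Rightarrow> nat \<Rightarrow> entry fpoly set" where
  "isometry_rel O_plus k n = orthogonal_isometry_rel k n"
| "isometry_rel S_plus k n = orthogonal_isometry_rel k n \<union> idem_rel {k<..n} {1..n} \<union> col_disjoint_rel {k<..n} {1..n}"
| "isometry_rel H_plus k n = orthogonal_isometry_rel k n \<union> row_disjoint_rel {k<..n} {1..n}"
| "isometry_rel B_plus k n = orthogonal_isometry_rel k n \<union> row_sum_rel {k<..n} {1..n}"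

lemma rel_poly_on:
  assumes "r \<in> hermitian_rel I J \<union> row_rel I J \<union> col_rel I J \<union> idem_rel I J \<union> row_disjoint_rel I J
    \<union> col_disjoint_rel I J \<union> row_sum_rel I J \<union> col_sum_rel I J"
  shows "r \<in> poly_on (I \<times> J)"
  using assms unfolding rel_defs
  by (auto intro!: poly_on_closed poly_on_sum gen_poly_on)

lemma group_rel_poly_on: "group_rel G n \<subseteq> poly_on ({1..n} \<times> {1..n})"
  using rel_poly_on[of _ "{1..n}" "{1..n}"] by (cases G) auto

lemma isometry_rel_poly_on: "isometry_rel G k n \<subseteq> poly_on ({k<..n} \<times> {1..n})"
  using rel_poly_on[of _ "{k<..n}" "{1..n}"] by (cases G) auto

locale free_cstar_matrix = free_cstar "I \<times> J" s
  for I J :: "nat set" and s :: "entry free_poly \<Rightarrow> real" +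
  assumes fin: "finite I" "finite J"
begin

abbreviation u :: "nat \<Rightarrow> nat \<Rightarrow> ualg" where
  "u \<equiv> generator_matrix (I \<times> J) s"

lemma u_eq: "u i j = cls (\<lambda>_. ent i j)"
  by (simp add: generator_matrix_def completion_embed_def cls_def coeff_gen)

lemma ent_in: "i \<in> I \<Longrightarrow> j \<in> J \<Longrightarrow> ent i j \<in> poly_on (I \<times> J)"
  by (simp add: gen_poly_on)

lemma one_zero_if: "(if b then \<one>\<^bsub>C\<^esub> else \<zero>\<^bsub>C\<^esub>) = cls (\<lambda>_. if b then 1 else 0)"
  by (simp add: completion_one_zero)

lemma one_zero_in: "(if b then 1 else 0) \<in> poly_on (I \<times> J)"
  by (simp add: poly_on_closed)

lemma u_carrier: "i \<in> I \<Longrightarrow> j \<in> J \<Longrightarrow> u i j \<in> carrier C"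
  by (simp add: u_eq completion_carrier cseq_const ent_in)

lemma hermitian_iff: "(\<forall>i\<in>I. \<forall>j\<in>J. adj C (u i j) = u i j) \<longleftrightarrow> (\<forall>r\<in>hermitian_rel I J. nrm r = 0)"
proof -
  have "adj C (u i j) = u i j \<longleftrightarrow> nrm (star (ent i j) - ent i j) = 0" if "i \<in> I" "j \<in> J" for i j
    using const_eq_iff[of "star (ent i j)" "ent i j"] ent_in[OF that]
    by (simp add: u_eq completion_unary_ops cseq_const poly_on_closed)
  then show ?thesis unfolding hermitian_rel_def by blast
qed

lemma u_mult: "i \<in> I \<Longrightarrow> j \<in> J \<Longrightarrow> i' \<in> I \<Longrightarrow> j' \<in> J \<Longrightarrow>
    u i j \<otimes>\<^bsub>C\<^esub> u i' j' = cls (\<lambda>_. ent i j * ent i' j')"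
  by (simp add: u_eq completion_ops cseq_const ent_in)

lemma finsum_cong: "(\<And>i. i \<in> K \<Longrightarrow> f i = cls (\<lambda>_. h i)) \<Longrightarrow> finite K \<Longrightarrow>
    (\<And>i. i \<in> K \<Longrightarrow> h i \<in> poly_on (I \<times> J)) \<Longrightarrow> (\<Oplus>\<^bsub>C\<^esub>i\<in>K. f i) = cls (\<lambda>_. \<Sum>i\<in>K. h i)"
proof -
  assume h: "\<And>i. i \<in> K \<Longrightarrow> f i = cls (\<lambda>_. h i)" "finite K" "\<And>i. i \<in> K \<Longrightarrow> h i \<in> poly_on (I \<times> J)"
  interpret C: ring C by (rule ring_completion)
  have "(\<Oplus>\<^bsub>C\<^esub>i\<in>K. f i) = (\<Oplus>\<^bsub>C\<^esub>i\<in>K. cls (\<lambda>_. h i))"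
    using h by (intro C.finsum_cong') (auto simp: completion_carrier cseq_const)
  then show ?thesis using h by (simp add: completion_finsum)
qed

lemma row_iff: "(\<forall>i\<in>I. \<forall>l\<in>I. (\<Oplus>\<^bsub>C\<^esub>j\<in>J. u i j \<otimes>\<^bsub>C\<^esub> u l j) = (if i = l then \<one>\<^bsub>C\<^esub> else \<zero>\<^bsub>C\<^esub>))
    \<longleftrightarrow> (\<forall>r\<in>row_rel I J. nrm r = 0)"
proof -
  have "(\<Oplus>\<^bsub>C\<^esub>j\<in>J. u i j \<otimes>\<^bsub>C\<^esub> u l j) = (if i = l then \<one>\<^bsub>C\<^esub> else \<zero>\<^bsub>C\<^esub>) \<longleftrightarrow>
      nrm ((\<Sum>j\<in>J. ent i j * ent l j) - (if i = l then 1 else 0)) = 0" if "i \<in> I" "l \<in> I" for i l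
  proof -
    have "(\<Oplus>\<^bsub>C\<^esub>j\<in>J. u i j \<otimes>\<^bsub>C\<^esub> u l j) = cls (\<lambda>_. \<Sum>j\<in>J. ent i j * ent l j)"
      using that by (intro finsum_cong u_mult fin poly_on_closed ent_in)
    moreover have "(\<Sum>j\<in>J. ent i j * ent l j) \<in> poly_on (I \<times> J)"
      using that by (intro poly_on_sum poly_on_closed ent_in)
    ultimately show ?thesis unfolding one_zero_if by (simp only: const_eq_iff one_zero_in)
  qed
  then show ?thesis unfolding row_rel_def by blast
qed

lemma col_iff: "(\<forall>j\<in>J. \<forall>l\<in>J. (\<Oplus>\<^bsub>C\<^esub>i\<in>I. u i j \<otimes>\<^bsub>C\<^esub> u i l) = (if j = l then \<one>\<^bsub>C\<^esub> else \<zero>\<^bsub>C\<^esub>))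
    \<longleftrightarrow> (\<forall>r\<in>col_rel I J. nrm r = 0)"
proof -
  have "(\<Oplus>\<^bsub>C\<^esub>i\<in>I. u i j \<otimes>\<^bsub>C\<^esub> u i l) = (if j = l then \<one>\<^bsub>C\<^esub> else \<zero>\<^bsub>C\<^esub>) \<longleftrightarrow>
      nrm ((\<Sum>i\<in>I. ent i j * ent i l) - (if j = l then 1 else 0)) = 0" if "j \<in> J" "l \<in> J" for j l
  proof -
    have "(\<Oplus>\<^bsub>C\<^esub>i\<in>I. u i j \<otimes>\<^bsub>C\<^esub> u i l) = cls (\<lambda>_. \<Sum>i\<in>I. ent i j * ent i l)"
      using that by (intro finsum_cong u_mult fin poly_on_closed ent_in)
    moreover have "(\<Sum>i\<in>I. ent i j * ent i l) \<in> poly_on (I \<times> J)"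
      using that by (intro poly_on_sum poly_on_closed ent_in)
    ultimately show ?thesis unfolding one_zero_if by (simp only: const_eq_iff one_zero_in)
  qed
  then show ?thesis unfolding col_rel_def by blast
qed

lemma idem_iff: "(\<forall>i\<in>I. \<forall>j\<in>J. u i j \<otimes>\<^bsub>C\<^esub> u i j = u i j) \<longleftrightarrow> (\<forall>r\<in>idem_rel I J. nrm r = 0)"
proof -
  have "u i j \<otimes>\<^bsub>C\<^esub> u i j = u i j \<longleftrightarrow> nrm (ent i j * ent i j - ent i j) = 0" if "i \<in> I" "j \<in> J" for i j
    unfolding u_mult[OF that that] using const_eq_iff[of "ent i j * ent i j" "ent i j"] ent_in[OF that]
    by (simp add: u_eq poly_on_closed)
  then show ?thesis unfolding idem_rel_def by blast
qed

lemma mult_zero_iff: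
  assumes "i \<in> I" "j \<in> J" "i' \<in> I" "j' \<in> J"
  shows "u i j \<otimes>\<^bsub>C\<^esub> u i' j' = \<zero>\<^bsub>C\<^esub> \<longleftrightarrow> nrm (ent i j * ent i' j') = 0"
  unfolding u_mult[OF assms] completion_one_zero
  using const_eq_iff[of "ent i j * ent i' j'" 0] assms by (simp add: poly_on_closed ent_in)

lemma row_disjoint_iff:
  "(\<forall>i\<in>I. \<forall>j\<in>J. \<forall>l\<in>J. j \<noteq> l \<longrightarrow> u i j \<otimes>\<^bsub>C\<^esub> u i l = \<zero>\<^bsub>C\<^esub>) \<longleftrightarrow> (\<forall>r\<in>row_disjoint_rel I J. nrm r = 0)"
  unfolding row_disjoint_rel_def using mult_zero_iff by blast

lemma col_disjoint_iff:
  "(\<forall>j\<in>J. \<forall>i\<in>I. \<forall>l\<in>I. i \<noteq> l \<longrightarrow> u i j \<otimes>\<^bsub>C\<^esub> u l j = \<zero>\<^bsub>C\<^esub>) \<longleftrightarrow> (\<forall>r\<in>col_disjoint_rel I J. nrm r = 0)"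
  unfolding col_disjoint_rel_def using mult_zero_iff by blast

lemma row_sum_iff: "(\<forall>i\<in>I. (\<Oplus>\<^bsub>C\<^esub>j\<in>J. u i j) = \<one>\<^bsub>C\<^esub>) \<longleftrightarrow> (\<forall>r\<in>row_sum_rel I J. nrm r = 0)"
proof -
  have "(\<Oplus>\<^bsub>C\<^esub>j\<in>J. u i j) = \<one>\<^bsub>C\<^esub> \<longleftrightarrow> nrm ((\<Sum>j\<in>J. ent i j) - 1) = 0" if "i \<in> I" for i
  proof -
    have "(\<Oplus>\<^bsub>C\<^esub>j\<in>J. u i j) = cls (\<lambda>_. \<Sum>j\<in>J. ent i j)"
      using that by (intro finsum_cong u_eq fin ent_in)
    moreover have "(\<Sum>j\<in>J. ent i j) \<in> poly_on (I \<times> J)" using that by (intro poly_on_sum ent_in)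
    ultimately show ?thesis unfolding completion_one_zero by (simp only: const_eq_iff poly_on_closed(2))
  qed
  then show ?thesis unfolding row_sum_rel_def by blast
qed

lemma col_sum_iff: "(\<forall>j\<in>J. (\<Oplus>\<^bsub>C\<^esub>i\<in>I. u i j) = \<one>\<^bsub>C\<^esub>) \<longleftrightarrow> (\<forall>r\<in>col_sum_rel I J. nrm r = 0)"
proof -
  have "(\<Oplus>\<^bsub>C\<^esub>i\<in>I. u i j) = \<one>\<^bsub>C\<^esub> \<longleftrightarrow> nrm ((\<Sum>i\<in>I. ent i j) - 1) = 0" if "j \<in> J" for j
  proof -
    have "(\<Oplus>\<^bsub>C\<^esub>i\<in>I. u i j) = cls (\<lambda>_. \<Sum>i\<in>I. ent i j)"
      using that by (intro finsum_cong u_eq fin ent_in)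
    moreover have "(\<Sum>i\<in>I. ent i j) \<in> poly_on (I \<times> J)" using that by (intro poly_on_sum ent_in)
    ultimately show ?thesis unfolding completion_one_zero by (simp only: const_eq_iff poly_on_closed(2))
  qed
  then show ?thesis unfolding col_sum_rel_def by blast
qed

end

lemma group_relations_iff:
  assumes "has_cstar_seminorm (free_star_algebra ({1..n} \<times> {1..n}) s)"
  shows "group_relations G n (completion (free_star_algebra ({1..n} \<times> {1..n}) s))
      (generator_matrix ({1..n} \<times> {1..n}) s)
    \<longleftrightarrow> (\<forall>r\<in>group_rel G n. norm_on ({1..n} \<times> {1..n}) s r = 0)"
proof -
  interpret free_cstar_matrix "{1..n}" "{1..n}" s
    using assms by unfold_locales simp_all
  have O: "orthogonal_matrix n C u \<longleftrightarrow> (\<forall>r\<in>group_rel O_plus n. nrm r = 0)"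
    unfolding orthogonal_matrix_def row_iff col_iff group_rel.simps ball_Un hermitian_iff[symmetric]
    using u_carrier by blast
  show ?thesis
  proof (cases G)
    case O_plus
    then show ?thesis using O by simp
  next
    case S_plus
    have "magic_matrix n C u \<longleftrightarrow> (\<forall>r\<in>group_rel S_plus n. nrm r = 0)"
      unfolding magic_matrix_def O group_rel.simps ball_Un idem_iff[symmetric] projection_def
      using u_carrier hermitian_iff by auto
    then show ?thesis using S_plus by simp
  next
    case H_plus
    have "cubic_matrix n C u \<longleftrightarrow> (\<forall>r\<in>group_rel H_plus n. nrm r = 0)"
      unfolding cubic_matrix_def O group_rel.simps ball_Un row_disjoint_iff[symmetric] col_disjoint_iff[symmetric]
      by blast
    then show ?thesis using H_plus by simp
  next
    case B_plus
    have "bistochastic_matrix n C u \<longleftrightarrow> (\<forall>r\<in>group_rel B_plus n. nrm r = 0)"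
      unfolding bistochastic_matrix_def O group_rel.simps ball_Un row_sum_iff[symmetric] col_sum_iff[symmetric]
      by blast
    then show ?thesis using B_plus by simp
  qed
qed

lemma isometry_relations_iff:
  assumes "has_cstar_seminorm (free_star_algebra ({k<..n} \<times> {1..n}) s)"
  shows "isometry_relations G k n (completion (free_star_algebra ({k<..n} \<times> {1..n}) s))
      (generator_matrix ({k<..n} \<times> {1..n}) s)
    \<longleftrightarrow> (\<forall>r\<in>isometry_rel G k n. norm_on ({k<..n} \<times> {1..n}) s r = 0)"
proof -
  interpret free_cstar_matrix "{k<..n}" "{1..n}" s
    using assms by unfold_locales simp_all
  have O: "transposed_orthogonal_isometry k n C u \<longleftrightarrow> (\<forall>r\<in>isometry_rel O_plus k n. nrm r = 0)"
    unfolding transposed_orthogonal_isometry_def row_iff isometry_rel.simps ball_Un hermitian_iff[symmetric]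
    using u_carrier by blast
  show ?thesis
  proof (cases G)
    case O_plus
    then show ?thesis using O by simp
  next
    case S_plus
    have "transposed_magic_isometry k n C u \<longleftrightarrow> (\<forall>r\<in>isometry_rel S_plus k n. nrm r = 0)"
      unfolding transposed_magic_isometry_def O isometry_rel.simps ball_Un idem_iff[symmetric]
        col_disjoint_iff[symmetric] projection_def
      using u_carrier hermitian_iff by auto
    then show ?thesis using S_plus by simp
  next
    case H_plus
    have "transposed_cubic_isometry k n C u \<longleftrightarrow> (\<forall>r\<in>isometry_rel H_plus k n. nrm r = 0)"
      unfolding transposed_cubic_isometry_def O isometry_rel.simps ball_Un row_disjoint_iff[symmetric] ..
    then show ?thesis using H_plus by simp
  next
    case B_plus
    have "transposed_stochastic_isometry k n C u \<longleftrightarrow> (\<forall>r\<in>isometry_rel B_plus k n. nrm r = 0)"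
      unfolding transposed_stochastic_isometry_def O isometry_rel.simps ball_Un row_sum_iff[symmetric] ..
    then show ?thesis using B_plus by simp
  qed
qed

lemma hermitian_row_bound:
  assumes "cstar_seminorm N" "\<forall>r\<in>hermitian_rel I J \<union> row_rel I J. N r = 0" "finite J" "a \<in> I \<times> J"
  shows "N (gen a) \<le> 1"
proof -
  interpret cstar_seminorm N by fact
  obtain i j where a: "a = (i, j)" "i \<in> I" "j \<in> J" using assms(4) by auto
  have herm: "star (ent i j) \<approx> ent i j" if "j \<in> J" for j
    using assms(2) a(2) that unfolding null_eq_def hermitian_rel_def by blast
  have "(\<Sum>j\<in>J. ent i j * ent i j) - (if i = i then 1 else 0) \<in> row_rel I J"
    unfolding row_rel_def using a(2) by blast
  then have "(\<Sum>j\<in>J. ent i j * ent i j) \<approx> 1" using assms(2) unfolding null_eq_def by auto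
  then show ?thesis using generator_le_one[of J "ent i" j] assms(3) herm a by simp
qed

lemma group_rel_bound:
  assumes "cstar_seminorm N" "\<forall>r\<in>group_rel G n. N r = 0" "a \<in> {1..n} \<times> {1..n}"
  shows "N (gen a) \<le> 1"
  using assms by (intro hermitian_row_bound[of N "{1..n}" "{1..n}"]) (cases G; auto)+

lemma isometry_rel_bound:
  assumes "cstar_seminorm N" "\<forall>r\<in>isometry_rel G k n. N r = 0" "a \<in> {k<..n} \<times> {1..n}"
  shows "N (gen a) \<le> 1"
  using assms by (intro hermitian_row_bound[of N "{k<..n}" "{1..n}"]) (cases G; auto)+

text \<open>
  Relations that are given by polynomials and that bound the generators. The supremum in the definition
  of the universal seminorm is then finite, and it is again a C*-seminorm that satisfies the relations.
\<close>

locale universal_cstar =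
  fixes X :: "entry set" and P :: matrix_relations and rels :: "entry fpoly set"
  assumes rels_iff: "\<And>s. has_cstar_seminorm (free_star_algebra X s) \<Longrightarrow>
      P (completion (free_star_algebra X s)) (generator_matrix X s) \<longleftrightarrow> (\<forall>r\<in>rels. norm_on X s r = 0)"
    and rels_poly_on: "rels \<subseteq> poly_on X"
    and rels_bound: "\<And>N a. cstar_seminorm N \<Longrightarrow> \<forall>r\<in>rels. N r = 0 \<Longrightarrow> a \<in> X \<Longrightarrow> N (gen a) \<le> 1"
begin

definition admissible :: "(entry free_poly \<Rightarrow> real) set" where
  "admissible = {s. has_cstar_seminorm (free_star_algebra X s) \<and> (\<forall>r\<in>rels. norm_on X s r = 0)}"

abbreviation unorm :: "entry free_poly \<Rightarrow> real" where "unorm \<equiv> universal_norm X P"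

lemma unorm_eq: "unorm f = (SUP s\<in>admissible. s f)"
proof -
  have "{s f | s. has_cstar_seminorm (free_star_algebra X s) \<and>
      P (completion (free_star_algebra X s)) (generator_matrix X s)} = (\<lambda>s. s f) ` admissible"
    unfolding admissible_def using rels_iff by blast
  then show ?thesis by (simp add: universal_norm_def)
qed

lemma admissible_from_seminorm:
  assumes "cstar_seminorm N" "\<forall>r\<in>rels. N r = 0"
  shows "(\<lambda>f. N (Abs_fpoly f)) \<in> admissible"
proof -
  have eq: "N (Abs_fpoly (coeff x)) = N x" for x by (simp add: coeff_inverse)
  have "has_cstar_seminorm (free_star_algebra X (\<lambda>f. N (Abs_fpoly f)))"
    by (rule has_cstar_seminorm_freeI[OF assms(1)]) (rule eq)
  then show ?thesis using assms(2) rels_poly_on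
    by (auto simp: admissible_def norm_on_eq eq subsetD)
qed

lemma admissible_nonempty: "admissible \<noteq> {}"
proof -
  \<comment> \<open>The zero seminorm satisfies all relations.\<close>
  have "cstar_seminorm (\<lambda>x :: entry fpoly. 0)" by standard simp_all
  then have "(\<lambda>f. 0) \<in> admissible" by (rule admissible_from_seminorm) simp
  then show ?thesis by blast
qed

text \<open>
  As the generators have norm at most \<open>1\<close>, the sum of the absolute values of the coefficients is a bound.
\<close>

lemma admissible_bounded:
  assumes "x \<in> poly_on X"
  shows "bdd_above ((\<lambda>s. s (coeff x)) ` admissible)"
proof (rule bdd_aboveI2)
  fix s assume s: "s \<in> admissible"
  then have N: "cstar_seminorm (norm_on X s)" by (simp add: admissible_def has_cstar_seminorm_freeD)
  have "norm_on X s x \<le> (\<Sum>w\<in>support x. cmod (coeff x w))"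
    using s by (intro cstar_l1_bound[OF N _ assms] rels_bound[OF N]) (auto simp: admissible_def)
  then show "s (coeff x) \<le> (\<Sum>w\<in>support x. cmod (coeff x w))" using assms by (simp add: norm_on_eq)
qed

lemma unorm_upper: "x \<in> poly_on X \<Longrightarrow> s \<in> admissible \<Longrightarrow> s (coeff x) \<le> unorm (coeff x)"
  unfolding unorm_eq by (rule cSUP_upper) (auto intro: admissible_bounded)

lemma unorm_least: "(\<And>s. s \<in> admissible \<Longrightarrow> s (coeff x) \<le> r) \<Longrightarrow> unorm (coeff x) \<le> r"
  unfolding unorm_eq by (rule cSUP_least[OF admissible_nonempty])

lemma admissibleD: "s \<in> admissible \<Longrightarrow> cstar_seminorm (norm_on X s)"
  by (simp add: admissible_def has_cstar_seminorm_freeD)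

lemma cstar_unorm: "cstar_seminorm (norm_on X unorm)"
proof
  let ?N = "norm_on X unorm"
  have upper: "norm_on X s x \<le> ?N x" if "s \<in> admissible" for s x
    unfolding norm_on_def by (intro unorm_upper restrict_letters_in that)
  have least: "?N x \<le> r" if "\<And>s. s \<in> admissible \<Longrightarrow> norm_on X s x \<le> r" for x r
    unfolding norm_on_def by (rule unorm_least) (use that in \<open>simp add: norm_on_def\<close>)
  have nn: "0 \<le> norm_on X s x" if "s \<in> admissible" for s x
    using cstar_seminorm.nonneg[OF admissibleD[OF that]] .
  have nonneg: "0 \<le> ?N x" for x
    using admissible_nonempty nn upper order_trans by blast
  fix x y :: "entry fpoly" and r :: real
  show "?N (x + y) \<le> ?N x + ?N y"
    using cstar_seminorm.triangle[OF admissibleD] upper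
    by (intro least) (meson add_mono order_trans)
  show "?N (x * y) \<le> ?N x * ?N y"
    using cstar_seminorm.submult[OF admissibleD] upper nn nonneg
    by (intro least) (meson mult_mono order_trans)
  have scale_le: "?N (r *\<^sub>R x) \<le> \<bar>r\<bar> * ?N x" for r x
    using cstar_seminorm.scale[OF admissibleD] upper
    by (intro least) (simp add: mult_left_mono)
  show "?N (r *\<^sub>R x) = \<bar>r\<bar> * ?N x"
  proof (cases "r = 0")
    case True
    then show ?thesis using scale_le[of 0 x] nonneg[of 0] by simp
  next
    case False
    have "\<bar>r\<bar> * ?N x \<le> \<bar>r\<bar> * (\<bar>1/r\<bar> * ?N (r *\<^sub>R x))"
      using scale_le[of "1/r" "r *\<^sub>R x"] False by (intro mult_left_mono) simp_all
    also have "\<dots> = ?N (r *\<^sub>R x)" using False by simp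
    finally show ?thesis using scale_le[of r x] by simp
  qed
  show "?N (star x * x) = (?N x)\<^sup>2"
  proof (rule antisym)
    show "?N (star x * x) \<le> (?N x)\<^sup>2"
      using cstar_seminorm.cstar[OF admissibleD] upper nn
      by (intro least) (simp add: power_mono)
    have "?N x \<le> sqrt (?N (star x * x))"
    proof (rule least)
      fix s assume s: "s \<in> admissible"
      have "(norm_on X s x)\<^sup>2 \<le> ?N (star x * x)"
        using cstar_seminorm.cstar[OF admissibleD[OF s], of x] upper[OF s, of "star x * x"] by simp
      then show "norm_on X s x \<le> sqrt (?N (star x * x))" by (rule real_le_rsqrt)
    qed
    then have "(?N x)\<^sup>2 \<le> (sqrt (?N (star x * x)))\<^sup>2" by (intro power_mono nonneg)
    then show "(?N x)\<^sup>2 \<le> ?N (star x * x)" using nonneg by simp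
  qed
qed

lemma has_cstar_unorm: "has_cstar_seminorm (free_star_algebra X unorm)"
  by (rule has_cstar_seminorm_freeI[OF cstar_unorm]) (simp add: norm_on_eq)

lemma unorm_rels:
  assumes "r \<in> rels"
  shows "norm_on X unorm r = 0"
proof -
  have r: "r \<in> poly_on X" using assms rels_poly_on by blast
  have "unorm (coeff r) \<le> 0"
    using assms r by (intro unorm_least) (auto simp: admissible_def norm_on_eq)
  then show ?thesis using cstar_seminorm.nonneg[OF cstar_unorm, of r] r by (simp add: norm_on_eq)
qed

lemma unorm_greatest:
  assumes "cstar_seminorm N" "\<forall>r\<in>rels. N r = 0" "x \<in> poly_on X"
  shows "N x \<le> norm_on X unorm x"
  using unorm_upper[OF assms(3) admissible_from_seminorm[OF assms(1,2)]] assms(3)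
  by (simp add: norm_on_eq coeff_inverse)

end

lemma universal_group:
  "universal_cstar ({1..n} \<times> {1..n}) (group_relations G n) (group_rel G n)"
  by unfold_locales (fact group_relations_iff group_rel_poly_on group_rel_bound)+

lemma universal_isometry:
  "universal_cstar ({k<..n} \<times> {1..n}) (isometry_relations G k n) (isometry_rel G k n)"
  by unfold_locales (fact isometry_relations_iff isometry_rel_poly_on isometry_rel_bound)+

text \<open>
  Most isometry relations are literally relations of the group. The exception is the orthogonality of the entries in
  a column of a magic matrix: they are projections with sum \<open>1\<close>.
\<close>

lemma isometry_rel_if_group_rel:
  assumes "cstar_seminorm N" "\<forall>r\<in>group_rel G n. N r = 0" "r \<in> isometry_rel G k n"
  shows "N r = 0"
proof -
  interpret cstar_seminorm N by fact
  have sub: "{k<..n} \<subseteq> {1..n}" by auto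
  have mono: "hermitian_rel {k<..n} {1..n} \<subseteq> hermitian_rel {1..n} {1..n}"
    "row_rel {k<..n} {1..n} \<subseteq> row_rel {1..n} {1..n}"
    "idem_rel {k<..n} {1..n} \<subseteq> idem_rel {1..n} {1..n}"
    "row_disjoint_rel {k<..n} {1..n} \<subseteq> row_disjoint_rel {1..n} {1..n}"
    "row_sum_rel {k<..n} {1..n} \<subseteq> row_sum_rel {1..n} {1..n}"
    unfolding rel_defs using sub by blast+
  have disj: "N r = 0" if G: "G = S_plus" and r: "r \<in> col_disjoint_rel {k<..n} {1..n}"
  proof -
    obtain i l j where r: "r = ent i j * ent l j" "i \<in> {1..n}" "l \<in> {1..n}" "j \<in> {1..n}" "i \<noteq> l"
      using r sub unfolding col_disjoint_rel_def by blast
    have h: "star (ent i j) \<approx> ent i j" "ent i j * ent i j \<approx> ent i j" if "i \<in> {1..n}" for i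
    proof -
      have "star (ent i j) - ent i j \<in> group_rel G n" "ent i j * ent i j - ent i j \<in> group_rel G n"
        using that r(4) unfolding G group_rel.simps hermitian_rel_def idem_rel_def by blast+
      then show "star (ent i j) \<approx> ent i j" "ent i j * ent i j \<approx> ent i j"
        using assms(2) by (auto simp: null_eq_def)
    qed
    have "(\<Sum>i\<in>{1..n}. ent i j * ent i j) - (if j = j then 1 else 0) \<in> group_rel G n"
      using r(4) unfolding G group_rel.simps col_rel_def by blast
    then have squares: "(\<Sum>i\<in>{1..n}. ent i j * ent i j) \<approx> 1" using assms(2) by (auto simp: null_eq_def)
    have sum: "(\<Sum>i\<in>{1..n}. ent i j) \<approx> 1"
      by (rule null_eq_trans[OF null_eq_sum squares]) (rule null_eq_sym[OF h(2)])
    have "ent i j * ent l j \<approx> 0"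
      by (rule projections_orthogonal[of "{1..n}" "\<lambda>i. ent i j" i l])
        (simp_all only: h sum r finite_atLeastAtMost not_False_eq_True)
    then show ?thesis by (simp add: r null_eq_def)
  qed
  show ?thesis using assms(2,3) mono disj by (cases G) (auto simp: subset_eq)
qed

section \<open>Completing real isometries to group matrices\<close>

definition ip :: "nat \<Rightarrow> (nat \<Rightarrow> real) \<Rightarrow> (nat \<Rightarrow> real) \<Rightarrow> real" where
  "ip n v w = (\<Sum>j\<in>{1..n}. v j * w j)"

definition orthonormal_rows :: "nat \<Rightarrow> nat set \<Rightarrow> (nat \<Rightarrow> nat \<Rightarrow> real) \<Rightarrow> bool" where
  "orthonormal_rows n R a \<longleftrightarrow> (\<forall>i\<in>R. \<forall>l\<in>R. ip n (a i) (a l) = (if i = l then 1 else 0))"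

lemma ip_commute: "ip n v w = ip n w v"
  by (simp add: ip_def mult.commute)

lemma ip_linear:
  "ip n (\<lambda>j. v j + v' j) w = ip n v w + ip n v' w" "ip n (\<lambda>j. v j - v' j) w = ip n v w - ip n v' w"
  "ip n (\<lambda>j. c * v j) w = c * ip n v w" "ip n (\<lambda>j. \<Sum>i\<in>R. f i j) w = (\<Sum>i\<in>R. ip n (f i) w)"
  by (simp_all add: ip_def sum.distrib sum_subtractf sum_distrib_left algebra_simps)
    (subst sum.swap, simp add: sum_distrib_left sum_distrib_right mult.commute)

lemma ip_nonneg: "0 \<le> ip n v v"
  by (simp add: ip_def sum_nonneg)

lemma ip_zero: "ip n v v = 0 \<Longrightarrow> j \<in> {1..n} \<Longrightarrow> v j = 0"
  using sum_nonneg_eq_0_iff[of "{1..n}" "\<lambda>j. v j * v j"] by (auto simp: ip_def)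

definition residual :: "nat \<Rightarrow> nat set \<Rightarrow> (nat \<Rightarrow> nat \<Rightarrow> real) \<Rightarrow> (nat \<Rightarrow> real) \<Rightarrow> nat \<Rightarrow> real" where
  "residual n R a x = (\<lambda>j. x j - (\<Sum>i\<in>R. ip n x (a i) * a i j))"

lemma ip_residual: "ip n (residual n R a x) y = ip n x y - (\<Sum>i\<in>R. ip n x (a i) * ip n (a i) y)"
  by (simp add: residual_def ip_linear)

lemma residual_orthogonal:
  assumes "finite R" "orthonormal_rows n R a" "l \<in> R"
  shows "ip n (residual n R a x) (a l) = 0"
proof -
  note ip_residual
  also have "(\<Sum>i\<in>R. ip n x (a i) * ip n (a i) (a l)) = (\<Sum>i\<in>R. if i = l then ip n x (a l) else 0)"
    using assms by (intro sum.cong) (auto simp: orthonormal_rows_def)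
  also have "\<dots> = ip n x (a l)" using assms by simp
  finally show ?thesis by simp
qed

lemma residual_norm:
  assumes "finite R" "orthonormal_rows n R a"
  shows "ip n (residual n R a x) (residual n R a x) = ip n x x - (\<Sum>i\<in>R. (ip n x (a i))\<^sup>2)"
    and "ip n (residual n R a x) x = ip n x x - (\<Sum>i\<in>R. (ip n x (a i))\<^sup>2)"
proof -
  let ?w = "residual n R a x"
  show eq: "ip n ?w x = ip n x x - (\<Sum>i\<in>R. (ip n x (a i))\<^sup>2)"
    unfolding ip_residual power2_eq_square ip_commute[of n x "a _"] ..
  have "ip n ?w ?w = ip n x ?w - (\<Sum>i\<in>R. ip n x (a i) * ip n (a i) ?w)"
    by (rule ip_residual)
  also have "\<dots> = ip n ?w x - (\<Sum>i\<in>R. ip n x (a i) * ip n ?w (a i))"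
    unfolding ip_commute[of n _ ?w] ..
  also have "(\<Sum>i\<in>R. ip n x (a i) * ip n ?w (a i)) = 0"
    using assms by (intro sum.neutral) (simp add: residual_orthogonal)
  finally show "ip n ?w ?w = ip n x x - (\<Sum>i\<in>R. (ip n x (a i))\<^sup>2)" using eq by simp
qed

definition unit_vec :: "nat \<Rightarrow> nat \<Rightarrow> real" where
  "unit_vec m = (\<lambda>j. if j = m then 1 else 0)"

lemma ip_unit_vec: "m \<in> {1..n} \<Longrightarrow> ip n (unit_vec m) v = v m"
  unfolding ip_def unit_vec_def by (subst sum.cong[OF refl, of _ _ "\<lambda>j. if j = m then v j else 0"]) auto

lemma residual_unit_vec_norm:
  assumes "finite R" "orthonormal_rows n R a" "m \<in> {1..n}"
  shows "ip n (residual n R a (unit_vec m)) (residual n R a (unit_vec m)) = 1 - (\<Sum>i\<in>R. (a i m)\<^sup>2)"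
  using assms by (simp add: residual_norm ip_unit_vec) (simp add: unit_vec_def)

text \<open>
  Trace of the projection to the orthogonal complement of the rows, computed in the standard basis.
\<close>

lemma sum_all_squares:
  assumes "finite R" "orthonormal_rows n R a"
  shows "(\<Sum>m\<in>{1..n}. 1 - (\<Sum>i\<in>R. (a i m)\<^sup>2)) = real n - real (card R)"
proof -
  have "(\<Sum>m\<in>{1..n}. \<Sum>i\<in>R. (a i m)\<^sup>2) = (\<Sum>i\<in>R. ip n (a i) (a i))"
    unfolding ip_def power2_eq_square by (rule sum.swap)
  also have "\<dots> = real (card R)" using assms(2) by (simp add: orthonormal_rows_def)
  finally show ?thesis by (simp add: sum_subtractf)
qed

lemma deficient_column:
  assumes "finite R" "orthonormal_rows n R a" "card R < n"
  obtains m where "m \<in> {1..n}" "(\<Sum>i\<in>R. (a i m)\<^sup>2) < 1"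
proof (rule ccontr)
  assume "\<not> thesis"
  then have "(\<Sum>m\<in>{1..n}. 1 - (\<Sum>i\<in>R. (a i m)\<^sup>2)) \<le> 0"
    using that by (intro sum_nonpos) (meson diff_le_0_iff_le not_less)
  then show False using sum_all_squares[OF assms(1,2)] assms(3) by simp
qed

lemma orthogonal_unit_vector:
  assumes "finite R" "orthonormal_rows n R a" "card R < n"
  obtains v where "ip n v v = 1" "\<And>i. i \<in> R \<Longrightarrow> ip n v (a i) = 0"
proof -
  obtain m where m: "m \<in> {1..n}" "(\<Sum>i\<in>R. (a i m)\<^sup>2) < 1"
    using deficient_column[OF assms] .
  define w where "w = residual n R a (unit_vec m)"
  define c where "c = 1 / sqrt (ip n w w)"
  have pos: "0 < ip n w w" using m residual_unit_vec_norm[OF assms(1,2) m(1)] by (simp add: w_def)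
  have "ip n (\<lambda>j. c * w j) (\<lambda>j. c * w j) = c * c * ip n w w"
    by (simp add: ip_def sum_distrib_left algebra_simps)
  also have "\<dots> = 1" using pos by (simp add: c_def)
  finally have "ip n (\<lambda>j. c * w j) (\<lambda>j. c * w j) = 1" .
  moreover have "ip n (\<lambda>j. c * w j) (a i) = 0" if "i \<in> R" for i
    using residual_orthogonal[OF assms(1,2) that] by (simp add: ip_linear w_def)
  ultimately show ?thesis using that by blast
qed

text \<open>
  For \<open>n\<close> orthonormal rows the trace is \<open>0\<close>, so all standard basis vectors have residual \<open>0\<close>.
\<close>

lemma columns_orthonormal:
  assumes "orthonormal_rows n {1..n} a" "j \<in> {1..n}" "l \<in> {1..n}"
  shows "(\<Sum>i\<in>{1..n}. a i j * a i l) = (if j = l then 1 else 0)"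
proof -
  have "(\<Sum>m\<in>{1..n}. ip n (residual n {1..n} a (unit_vec m)) (residual n {1..n} a (unit_vec m))) = 0"
    using sum_all_squares[OF _ assms(1)] residual_unit_vec_norm[OF _ assms(1)] by simp
  then have "ip n (residual n {1..n} a (unit_vec j)) (residual n {1..n} a (unit_vec j)) = 0"
    using assms(2) ip_nonneg by (simp add: sum_nonneg_eq_0_iff)
  then have "residual n {1..n} a (unit_vec j) l = 0" using assms(3) by (rule ip_zero)
  then have "(\<Sum>i\<in>{1..n}. a i j * a i l) = unit_vec j l"
    using assms(2) by (simp add: residual_def ip_unit_vec)
  then show ?thesis by (auto simp: unit_vec_def)
qed

lemma residual_ones:
  assumes "finite R" "orthonormal_rows n R a" "\<And>i. i \<in> R \<Longrightarrow> (\<Sum>j\<in>{1..n}. a i j) = 1"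
  defines "w \<equiv> residual n R a (\<lambda>_. 1)"
  shows "ip n w w = real n - real (card R)" "ip n w (\<lambda>_. 1) = real n - real (card R)"
    "w = (\<lambda>j. 1 - (\<Sum>i\<in>R. a i j))"
proof -
  have one: "ip n (\<lambda>_. 1) (a i) = 1" if "i \<in> R" for i using assms(3)[OF that] by (simp add: ip_def)
  have "(\<Sum>i\<in>R. (ip n (\<lambda>_. 1) (a i))\<^sup>2) = real (card R)" using one by simp
  then show "ip n w w = real n - real (card R)" "ip n w (\<lambda>_. 1) = real n - real (card R)"
    unfolding w_def residual_norm[OF assms(1,2)] by (simp_all add: ip_def)
  show "w = (\<lambda>j. 1 - (\<Sum>i\<in>R. a i j))"
    using one by (auto simp: w_def residual_def intro!: ext sum.cong)
qed

text \<open>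
  Let \<open>w\<close> be the component of \<open>(1, \<dots>, 1)\<close> orthogonal to the rows and \<open>q = \<parallel>w\<parallel>\<^sup>2 = n - card R\<close>. A vector \<open>v\<close>
  orthogonal to the rows has sum \<open>\<langle>v, w\<rangle>\<close>, so \<open>v = w/q + c z\<close> works for a unit vector \<open>z\<close> orthogonal to the
  rows and to \<open>w\<close>, with \<open>c\<^sup>2 = 1 - 1/q\<close>. No \<open>z\<close> exists if \<open>q = 1\<close>, but then \<open>v = w\<close>.
\<close>

lemma orthogonal_unit_vector_sum_one:
  assumes "finite R" "R \<subseteq> {1..n}" "orthonormal_rows n R a" "card R < n"
    "\<And>i. i \<in> R \<Longrightarrow> (\<Sum>j\<in>{1..n}. a i j) = 1"
  obtains v where "ip n v v = 1" "\<And>i. i \<in> R \<Longrightarrow> ip n v (a i) = 0" "(\<Sum>j\<in>{1..n}. v j) = 1"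
proof -
  define w where "w = residual n R a (\<lambda>_. 1)"
  define q where "q = real n - real (card R)"
  have q: "1 \<le> q" using assms(4) by (simp add: q_def)
  note ones = residual_ones[OF assms(1,3,5), folded w_def q_def]
  have worth: "ip n w (a i) = 0" if "i \<in> R" for i
    unfolding w_def using residual_orthogonal[OF assms(1,3) that] .
  show ?thesis
  proof (cases "card R + 1 = n")
    case True
    then have "q = 1" by (simp add: q_def)
    then show ?thesis using that[of w] ones worth by (simp add: ip_def)
  next
    case False
    \<comment> \<open>\<open>w/\<surd>q\<close> is added to the rows at an index \<open>l\<close> that is not in use.\<close>
    obtain l where l: "l \<in> {1..n}" "l \<notin> R" using assms(2,4) by (metis card_atLeastAtMost diff_Suc_1 less_irrefl subset_antisym subsetI)
    define b where "b = a(l := (\<lambda>j. 1 / sqrt q * w j))"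
    have bl: "ip n (b l) (b l) = 1"
    proof -
      have "ip n (b l) (b l) = 1 / sqrt q * (1 / sqrt q * ip n w w)"
        by (simp add: b_def ip_def sum_distrib_left algebra_simps)
      then show ?thesis using q ones(1) by simp
    qed
    have bi: "b i = a i" if "i \<in> R" for i using that l by (auto simp: b_def)
    have bli: "ip n (b l) (a i) = 0" if "i \<in> R" for i
      using worth[OF that] ip_linear(3)[of n "1 / sqrt q" w "a i"] by (simp add: b_def)
    have "orthonormal_rows n (insert l R) b"
      using assms(3) bl bli bi l ip_commute[of n] unfolding orthonormal_rows_def by (auto simp: ip_commute)
    moreover have "card (insert l R) < n" using False assms(1,4) l by simp
    ultimately obtain z where z: "ip n z z = 1" "\<And>i. i \<in> insert l R \<Longrightarrow> ip n z (b i) = 0"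
      using orthogonal_unit_vector[of "insert l R" n b] assms(1) by blast
    have zi: "ip n z (a i) = 0" if "i \<in> R" for i using z(2)[of i] bi that by simp
    have "ip n z (b l) = 1 / sqrt q * ip n z w"
      by (simp add: b_def ip_def sum_distrib_left algebra_simps)
    then have zw: "ip n z w = 0" using z(2)[of l] q by simp
    have "(\<lambda>_. 1) = (\<lambda>j. w j + (\<Sum>i\<in>R. a i j))" using fun_cong[OF ones(3)] by simp
    then have "ip n (\<lambda>_. 1) z = ip n w z + (\<Sum>i\<in>R. ip n (a i) z)" by (simp only: ip_linear)
    then have z1: "(\<Sum>j\<in>{1..n}. z j) = 0" using zw zi by (simp add: ip_commute[of n _ z]) (simp add: ip_def)
    define c where "c = sqrt (1 - 1 / q)"
    have c: "c * c = 1 - 1 / q" using q by (simp add: c_def)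
    define v where "v = (\<lambda>j. 1 / q * w j + c * z j)"
    have v_ip: "ip n v x = 1 / q * ip n w x + c * ip n z x" for x
      unfolding v_def by (simp only: ip_linear)
    have "ip n w v = 1" "ip n z v = c"
      using v_ip[of w] v_ip[of z] zw z(1) ones(1) q by (simp_all add: ip_commute[of n _ v] ip_commute[of n w z])
    then have "ip n v v = 1" using v_ip[of v] c by simp
    moreover have "ip n v (a i) = 0" if "i \<in> R" for i using v_ip[of "a i"] worth zi that by simp
    moreover have "(\<Sum>j\<in>{1..n}. v j) = 1"
      using v_ip[of "\<lambda>_. 1"] ones(2) z1 q by (simp add: ip_def)
    ultimately show ?thesis using that by blast
  qed
qed

lemma complete_rows:
  assumes step: "\<And>R a. R \<subseteq> {1..n} \<Longrightarrow> card R < n \<Longrightarrow> orthonormal_rows n R a \<Longrightarrow> \<forall>i\<in>R. Q (a i) \<Longrightarrow>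
      \<exists>v. Q v \<and> ip n v v = 1 \<and> (\<forall>i\<in>R. ip n v (a i) = 0)"
    and "k \<le> n" "orthonormal_rows n {k<..n} a" "\<forall>i\<in>{k<..n}. Q (a i)"
  shows "\<exists>b. orthonormal_rows n {1..n} b \<and> (\<forall>i\<in>{1..n}. Q (b i)) \<and> (\<forall>i\<in>{k<..n}. b i = a i)"
  using assms(2-)
proof (induction k arbitrary: a)
  case 0
  have "{0<..n} = {1..n}" by auto
  then show ?case using 0 by auto
next
  case (Suc k)
  obtain v where v: "Q v" "ip n v v = 1" "\<forall>i\<in>{Suc k<..n}. ip n v (a i) = 0"
  proof -
    have "{Suc k<..n} \<subseteq> {1..n}" "card {Suc k<..n} < n" using Suc.prems(1) by auto
    then show ?thesis using step[of "{Suc k<..n}" a] Suc.prems(2,3) that by blast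
  qed
  define a' where "a' = a(Suc k := v)"
  have eq: "{k<..n} = insert (Suc k) {Suc k<..n}" using Suc.prems(1) by auto
  have "orthonormal_rows n {k<..n} a'"
    using Suc.prems(2) v ip_commute[of n] unfolding eq orthonormal_rows_def a'_def by auto
  moreover have "\<forall>i\<in>{k<..n}. Q (a' i)" using Suc.prems(3) v(1) unfolding eq a'_def by auto
  ultimately obtain b where "orthonormal_rows n {1..n} b" "\<forall>i\<in>{1..n}. Q (b i)" "\<forall>i\<in>{k<..n}. b i = a' i"
    using Suc.IH[of a'] Suc.prems(1) by auto
  then show ?case by (intro exI[of _ b]) (auto simp: a'_def)
qed

definition monomial_row :: "nat \<Rightarrow> (nat \<Rightarrow> real) \<Rightarrow> bool" where
  "monomial_row n v \<longleftrightarrow> (\<forall>j\<in>{1..n}. \<forall>l\<in>{1..n}. j \<noteq> l \<longrightarrow> v j * v l = 0)"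

lemma monomial_row_values:
  assumes "monomial_row n v" "ip n v v = 1" "j \<in> {1..n}" "v j \<noteq> 0"
  shows "(v j)\<^sup>2 = 1"
proof -
  have "v l * v l = (if l = j then (v j)\<^sup>2 else 0)" if "l \<in> {1..n}" for l
  proof (cases "l = j")
    case False
    then have "v j * v l = 0" using assms(1,3) that unfolding monomial_row_def by metis
    then show ?thesis using assms(4) False by simp
  qed (simp add: power2_eq_square)
  then have "ip n v v = (\<Sum>l\<in>{1..n}. if l = j then (v j)\<^sup>2 else 0)"
    unfolding ip_def by (rule sum.cong[OF refl])
  then show ?thesis using assms(2,3) by simp
qed

text \<open>
  Some column has norm less than \<open>1\<close>, while its entries are \<open>0\<close> or \<open>\<plusminus>1\<close>.
\<close>

lemma unused_column:
  assumes "finite R" "orthonormal_rows n R a" "card R < n" "\<forall>i\<in>R. monomial_row n (a i)"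
  obtains m where "m \<in> {1..n}" "\<And>i. i \<in> R \<Longrightarrow> a i m = 0"
proof -
  obtain m where m: "m \<in> {1..n}" "(\<Sum>i\<in>R. (a i m)\<^sup>2) < 1"
    using deficient_column[OF assms(1-3)] .
  have "a i m = 0" if "i \<in> R" for i
  proof (rule ccontr)
    assume "a i m \<noteq> 0"
    then have "(a i m)\<^sup>2 = 1"
      using monomial_row_values[of n "a i" m] assms(2,4) that m(1) by (simp add: orthonormal_rows_def)
    then show False using m(2) member_le_sum[of i R "\<lambda>i. (a i m)\<^sup>2"] that assms(1) by simp
  qed
  then show ?thesis using that m(1) by blast
qed

lemma monomial_columns:
  assumes "orthonormal_rows n {1..n} a" "\<forall>i\<in>{1..n}. monomial_row n (a i)"
    "i \<in> {1..n}" "l \<in> {1..n}" "j \<in> {1..n}" "i \<noteq> l"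
  shows "a i j * a l j = 0"
proof (rule ccontr)
  assume nz: "a i j * a l j \<noteq> 0"
  have "a i m * a l m = (if m = j then a i j * a l j else 0)" if "m \<in> {1..n}" for m
  proof (cases "m = j")
    case False
    then have "a i j * a i m = 0" using assms(2,3,5) that unfolding monomial_row_def by metis
    then show ?thesis using nz False by simp
  qed simp
  then have "ip n (a i) (a l) = (\<Sum>m\<in>{1..n}. if m = j then a i j * a l j else 0)"
    unfolding ip_def by (rule sum.cong[OF refl])
  then show False using assms(1,3-6) nz by (simp add: orthonormal_rows_def)
qed

text \<open>
  A condition on single rows that, together with orthonormality of the rows, characterises the real matrices
  satisfying the isometry relations. For the magic and cubic families it makes the rows signed standard
  basis vectors.
\<close>

fun row_condition :: "quantum_family \<Rightarrow> nat \<Rightarrow> (nat \<Rightarrow> real) \<Rightarrow> bool" where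
  "row_condition O_plus n v = True"
| "row_condition S_plus n v = (monomial_row n v \<and> (\<forall>j\<in>{1..n}. v j * v j = v j))"
| "row_condition H_plus n v = monomial_row n v"
| "row_condition B_plus n v = ((\<Sum>j\<in>{1..n}. v j) = 1)"

text \<open>
  For the magic and cubic families the new row is the standard basis vector of an unused column.
\<close>

lemma row_condition_step:
  assumes "R \<subseteq> {1..n}" "card R < n" "orthonormal_rows n R a" "\<forall>i\<in>R. row_condition G n (a i)"
  shows "\<exists>v. row_condition G n v \<and> ip n v v = 1 \<and> (\<forall>i\<in>R. ip n v (a i) = 0)"
proof -
  have fin: "finite R" using assms(1) finite_subset by blast
  show ?thesis
  proof (cases "G = O_plus \<or> G = B_plus")
    case True
    then show ?thesis
    proof
      assume "G = O_plus"
      moreover obtain v where "ip n v v = 1" "\<And>i. i \<in> R \<Longrightarrow> ip n v (a i) = 0"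
        by (rule orthogonal_unit_vector[OF fin assms(3,2)]) blast
      ultimately show ?thesis by auto
    next
      assume G: "G = B_plus"
      obtain v where "ip n v v = 1" "\<And>i. i \<in> R \<Longrightarrow> ip n v (a i) = 0" "(\<Sum>j\<in>{1..n}. v j) = 1"
        by (rule orthogonal_unit_vector_sum_one[OF fin assms(1,3,2)]) (use assms(4) G in auto)
      then show ?thesis using G by auto
    qed
  next
    case False
    then have "\<forall>i\<in>R. monomial_row n (a i)" using assms(4) by (cases G) auto
    then obtain m where m: "m \<in> {1..n}" "\<And>i. i \<in> R \<Longrightarrow> a i m = 0"
      using unused_column[OF fin assms(3,2)] by blast
    have "row_condition G n (unit_vec m)" using False
      by (cases G) (auto simp: monomial_row_def unit_vec_def)
    moreover have "ip n (unit_vec m) (unit_vec m) = 1" using ip_unit_vec[OF m(1), of "unit_vec m"] by (simp add: unit_vec_def)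
    ultimately show ?thesis using m ip_unit_vec by (intro exI[of _ "unit_vec m"]) simp
  qed
qed

lemma isometry_point_rows:
  assumes "\<forall>r\<in>isometry_rel G k n. eval_at \<phi> r = 0"
  shows "orthonormal_rows n {k<..n} (\<lambda>i j. \<phi> (i, j))"
    and "\<forall>i\<in>{k<..n}. row_condition G n (\<lambda>j. \<phi> (i, j))"
proof -
  have row: "row_rel {k<..n} {1..n} \<subseteq> isometry_rel G k n" by (cases G) auto
  have ip1: "ip n (\<lambda>j. \<phi> (i, j)) (\<lambda>j. \<phi> (l, j)) = (if i = l then 1 else 0)"
    if "i \<in> {k<..n}" "l \<in> {k<..n}" for i l
  proof -
    have "(\<Sum>j\<in>{1..n}. ent i j * ent l j) - (if i = l then 1 else 0) \<in> row_rel {k<..n} {1..n}"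
      unfolding row_rel_def using that by blast
    then have "eval_at \<phi> ((\<Sum>j\<in>{1..n}. ent i j * ent l j) - (if i = l then 1 else 0)) = 0"
      using assms row by blast
    then have "complex_of_real (ip n (\<lambda>j. \<phi> (i, j)) (\<lambda>j. \<phi> (l, j))) = of_real (if i = l then 1 else 0)"
      by (auto simp: eval_at_diff eval_at_sum eval_at_mult eval_at_gen eval_at_one eval_at_zero ip_def)
    then show ?thesis unfolding of_real_eq_iff .
  qed
  then show "orthonormal_rows n {k<..n} (\<lambda>i j. \<phi> (i, j))" by (simp add: orthonormal_rows_def)
  show "\<forall>i\<in>{k<..n}. row_condition G n (\<lambda>j. \<phi> (i, j))"
  proof
    fix i assume i: "i \<in> {k<..n}"
    show "row_condition G n (\<lambda>j. \<phi> (i, j))"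
    proof (cases G)
      case O_plus
      then show ?thesis by simp
    next
      case S_plus
      have idem: "\<phi> (i, j) * \<phi> (i, j) = \<phi> (i, j)" if "j \<in> {1..n}" for j
      proof -
        have "ent i j * ent i j - ent i j \<in> isometry_rel G k n"
          unfolding S_plus isometry_rel.simps idem_rel_def using i that by blast
        then have "complex_of_real (\<phi> (i, j) * \<phi> (i, j)) = of_real (\<phi> (i, j))"
          using assms by (fastforce simp: eval_at_diff eval_at_mult eval_at_gen)
        then show ?thesis unfolding of_real_eq_iff .
      qed
      have "\<phi> (i, j) * \<phi> (i, l) = 0" if jl: "j \<in> {1..n}" "l \<in> {1..n}" "j \<noteq> l" for j l
      proof (rule ccontr)
        assume "\<phi> (i, j) * \<phi> (i, l) \<noteq> 0"
        then have "\<phi> (i, j) = 1" "\<phi> (i, l) = 1" using idem jl by auto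
        then have "2 = (\<Sum>m\<in>{j, l}. \<phi> (i, m) * \<phi> (i, m))" using jl(3) by simp
        also have "\<dots> \<le> (\<Sum>m\<in>{1..n}. \<phi> (i, m) * \<phi> (i, m))"
          using jl by (intro sum_mono2) auto
        also have "\<dots> = 1" using ip1[OF i i] by (simp add: ip_def)
        finally show False by simp
      qed
      then show ?thesis using idem S_plus by (simp add: monomial_row_def)
    next
      case H_plus
      have "\<phi> (i, j) * \<phi> (i, l) = 0" if "j \<in> {1..n}" "l \<in> {1..n}" "j \<noteq> l" for j l
      proof -
        have "ent i j * ent i l \<in> isometry_rel G k n"
          unfolding H_plus isometry_rel.simps row_disjoint_rel_def using i that by blast
        then show ?thesis using assms by (fastforce simp: eval_at_mult eval_at_gen)
      qed
      then show ?thesis using H_plus by (simp add: monomial_row_def)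
    next
      case B_plus
      have "(\<Sum>j\<in>{1..n}. ent i j) - 1 \<in> isometry_rel G k n"
        unfolding B_plus isometry_rel.simps row_sum_rel_def using i by blast
      then have "complex_of_real (\<Sum>j\<in>{1..n}. \<phi> (i, j)) = of_real 1"
        using assms by (fastforce simp: eval_at_diff eval_at_sum eval_at_gen eval_at_one)
      then show ?thesis unfolding of_real_eq_iff B_plus by simp
    qed
  qed
qed

text \<open>
  The rows satisfy their relations by assumption. The relations between columns come for free: a square
  matrix with orthonormal rows has orthonormal columns, orthogonal monomial rows have disjoint supports, and
  if the rows are orthonormal with sum \<open>1\<close> each, then \<open>(1, \<dots>, 1)\<close> is the sum of the rows.
\<close>

lemma group_point:
  assumes b: "orthonormal_rows n {1..n} b" "\<forall>i\<in>{1..n}. row_condition G n (b i)"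
    and r: "r \<in> group_rel G n"
  shows "eval_at (\<lambda>(i, j). b i j) r = 0"
proof -
  let ?e = "eval_at (\<lambda>(i, j). b i j)"
  note ev = eval_at_diff eval_at_sum eval_at_mult eval_at_gen eval_at_one eval_at_zero eval_at_star
  have rows: "(\<Sum>j\<in>{1..n}. b i j * b l j) = (if i = l then 1 else 0)" if "i \<in> {1..n}" "l \<in> {1..n}" for i l
    using b(1) that by (simp add: orthonormal_rows_def ip_def)
  note cols = columns_orthonormal[OF b(1)]
  have O: "?e r = 0" if rO: "r \<in> orthogonal_rel n"
  proof -
    consider (h) i j where "r = star (ent i j) - ent i j"
      | (r) i l where "i \<in> {1..n}" "l \<in> {1..n}" "r = (\<Sum>j\<in>{1..n}. ent i j * ent l j) - (if i = l then 1 else 0)"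
      | (c) j l where "j \<in> {1..n}" "l \<in> {1..n}" "r = (\<Sum>i\<in>{1..n}. ent i j * ent i l) - (if j = l then 1 else 0)"
      using rO unfolding hermitian_rel_def row_rel_def col_rel_def by blast
    then show ?thesis
    proof cases
      case h
      then show ?thesis by (simp add: ev)
    next
      case r
      have "?e r = of_real (\<Sum>j\<in>{1..n}. b i j * b l j) - of_real (if i = l then 1 else 0)"
        unfolding r(3) by (auto simp: ev)
      then show ?thesis unfolding rows[OF r(1,2)] by simp
    next
      case c
      have "?e r = of_real (\<Sum>i\<in>{1..n}. b i j * b i l) - of_real (if j = l then 1 else 0)"
        unfolding c(3) by (auto simp: ev)
      then show ?thesis unfolding cols[OF c(1,2)] by simp
    qed
  qed
  show ?thesis
  proof (cases G)
    case O_plus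
    then show ?thesis using O r by simp
  next
    case S_plus
    have "?e r = 0" if "r \<in> idem_rel {1..n} {1..n}"
      using that b(2) unfolding idem_rel_def S_plus by (auto simp: ev of_real_mult[symmetric] simp del: of_real_mult)
    then show ?thesis using O r S_plus by auto
  next
    case H_plus
    have m: "\<forall>i\<in>{1..n}. monomial_row n (b i)" using b(2) H_plus by simp
    have "?e r = 0" if "r \<in> row_disjoint_rel {1..n} {1..n}"
      using that m unfolding row_disjoint_rel_def monomial_row_def
      by (auto simp: ev of_real_mult[symmetric] simp del: of_real_mult mult_eq_0_iff)
    moreover have "?e r = 0" if "r \<in> col_disjoint_rel {1..n} {1..n}"
      using that monomial_columns[OF b(1) m] unfolding col_disjoint_rel_def
      by (auto simp: ev of_real_mult[symmetric] simp del: of_real_mult mult_eq_0_iff)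
    ultimately show ?thesis using O r H_plus by auto
  next
    case B_plus
    have sum1: "(\<Sum>j\<in>{1..n}. b i j) = 1" if "i \<in> {1..n}" for i using b(2) B_plus that by simp
    define w where "w = residual n {1..n} b (\<lambda>_. 1)"
    note ones = residual_ones[OF _ b(1) sum1, folded w_def]
    have "w j = 0" if "j \<in> {1..n}" for j using ones(1) ip_zero[of n w] that by simp
    then have col1: "(\<Sum>i\<in>{1..n}. b i j) = 1" if "j \<in> {1..n}" for j
      using that ones(3) by simp
    have "?e r = 0" if rr: "r \<in> row_sum_rel {1..n} {1..n}"
    proof -
      obtain i where i: "i \<in> {1..n}" "r = (\<Sum>j\<in>{1..n}. ent i j) - 1" using rr unfolding row_sum_rel_def by blast
      then have "?e r = of_real (\<Sum>j\<in>{1..n}. b i j) - 1" by (simp add: ev)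
      then show ?thesis unfolding sum1[OF i(1)] by simp
    qed
    moreover have "?e r = 0" if rr: "r \<in> col_sum_rel {1..n} {1..n}"
    proof -
      obtain j where j: "j \<in> {1..n}" "r = (\<Sum>i\<in>{1..n}. ent i j) - 1" using rr unfolding col_sum_rel_def by blast
      then have "?e r = of_real (\<Sum>i\<in>{1..n}. b i j) - 1" by (simp add: ev)
      then show ?thesis unfolding col1[OF j(1)] by simp
    qed
    ultimately show ?thesis using O r B_plus by auto
  qed
qed

theorem extend_isometry_point:
  assumes "k \<le> n" "\<forall>r\<in>isometry_rel G k n. eval_at \<phi> r = 0"
  obtains \<psi> where "\<forall>r\<in>group_rel G n. eval_at \<psi> r = 0" "\<And>a. a \<in> {k<..n} \<times> {1..n} \<Longrightarrow> \<psi> a = \<phi> a"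
proof -
  note rows = isometry_point_rows[OF assms(2)]
  obtain b where b: "orthonormal_rows n {1..n} b" "\<forall>i\<in>{1..n}. row_condition G n (b i)"
    "\<forall>i\<in>{k<..n}. b i = (\<lambda>j. \<phi> (i, j))"
    using complete_rows[of n "row_condition G n" k, OF row_condition_step assms(1) rows] by blast
  show ?thesis
    by (rule that[of "\<lambda>(i, j). b i j"]) (use group_point[OF b(1,2)] b(3) in auto)
qed

section \<open>The canonical map, its range and its quotients\<close>

text \<open>
  The isomorphism sends a coset to its image. All operations on cosets are unions over representatives, and
  images under a surjection respect such unions. The map is injective since the cosets upstairs are full
  preimages of the cosets downstairs.
\<close>

lemma quotient_isomorphic:
  fixes A :: "'a star_algebra" and B :: "'b star_algebra"
  assumes A: "ring A" and B: "ring B" and hom: "\<pi> \<in> star_hom A B"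
    and surj: "\<pi> ` carrier A = carrier B" and N: "N \<subseteq> carrier B"
    and smult: "\<And>c x. x \<in> carrier A \<Longrightarrow> c \<odot>\<^bsub>A\<^esub> x \<in> carrier A"
    and adj: "\<And>x. x \<in> carrier A \<Longrightarrow> adj A x \<in> carrier A"
  shows "cstar_isomorphic (quotient_star_algebra A {x \<in> carrier A. \<pi> x \<in> N}) (quotient_star_algebra B N)"
proof -
  interpret A: ring A by fact
  interpret B: ring B by fact
  define I where "I = {x \<in> carrier A. \<pi> x \<in> N}"
  have h: "\<pi> x \<in> carrier B" "\<pi> (x \<otimes>\<^bsub>A\<^esub> y) = \<pi> x \<otimes>\<^bsub>B\<^esub> \<pi> y" "\<pi> (x \<oplus>\<^bsub>A\<^esub> y) = \<pi> x \<oplus>\<^bsub>B\<^esub> \<pi> y"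
    "\<pi> (c \<odot>\<^bsub>A\<^esub> x) = c \<odot>\<^bsub>B\<^esub> \<pi> x" "\<pi> (adj A x) = adj B (\<pi> x)" "\<pi> \<one>\<^bsub>A\<^esub> = \<one>\<^bsub>B\<^esub>"
    if "x \<in> carrier A" "y \<in> carrier A" for x y c
    using hom that unfolding star_hom_def ring_hom_def by auto
  have coset: "\<pi> ` (I +>\<^bsub>A\<^esub> a) = N +>\<^bsub>B\<^esub> \<pi> a" if a: "a \<in> carrier A" for a
  proof -
    have NI: "N = \<pi> ` I" unfolding I_def using N[folded surj] by auto
    have "\<pi> ` (I +>\<^bsub>A\<^esub> a) = (\<lambda>x. \<pi> (x \<oplus>\<^bsub>A\<^esub> a)) ` I" unfolding a_r_coset_def' by auto
    also have "\<dots> = (\<lambda>x. \<pi> x \<oplus>\<^bsub>B\<^esub> \<pi> a) ` I"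
      by (intro image_cong refl h(3) a) (simp add: I_def)
    also have "\<dots> = N +>\<^bsub>B\<^esub> \<pi> a" unfolding NI a_r_coset_def' by auto
    finally show ?thesis .
  qed
  have coset_sub: "I +>\<^bsub>A\<^esub> a \<subseteq> carrier A" if "a \<in> carrier A" for a
    using that by (auto simp: a_r_coset_def' I_def)
  have coset_eq: "I +>\<^bsub>A\<^esub> a = {x \<in> carrier A. \<pi> x \<in> N +>\<^bsub>B\<^esub> \<pi> a}" if a: "a \<in> carrier A" for a
  proof (intro equalityI subsetI)
    fix x assume "x \<in> I +>\<^bsub>A\<^esub> a"
    then show "x \<in> {x \<in> carrier A. \<pi> x \<in> N +>\<^bsub>B\<^esub> \<pi> a}" using coset[OF a] coset_sub[OF a] by blast
  next
    fix x assume "x \<in> {x \<in> carrier A. \<pi> x \<in> N +>\<^bsub>B\<^esub> \<pi> a}"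
    then obtain m where x: "x \<in> carrier A" and m: "m \<in> N" "\<pi> x = m \<oplus>\<^bsub>B\<^esub> \<pi> a"
      by (auto simp: a_r_coset_def')
    define y where "y = x \<ominus>\<^bsub>A\<^esub> a"
    have y: "y \<in> carrier A" "y \<oplus>\<^bsub>A\<^esub> a = x"
      using x a by (simp_all add: y_def a_minus_def A.a_assoc A.l_neg)
    then have "\<pi> y \<oplus>\<^bsub>B\<^esub> \<pi> a = m \<oplus>\<^bsub>B\<^esub> \<pi> a" using h(3)[OF y(1) a] m(2) by simp
    then have "\<pi> y = m" using h(1)[OF y(1) y(1)] h(1)[OF a a] m(1) N by (simp add: subset_iff)
    then show "x \<in> I +>\<^bsub>A\<^esub> a" using y m(1) by (auto simp: a_r_coset_def' I_def)
  qed
  let ?Q = "quotient_star_algebra A I" and ?R = "quotient_star_algebra B N"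
  have carr: "carrier ?Q = (\<lambda>a. I +>\<^bsub>A\<^esub> a) ` carrier A" "carrier ?R = (\<lambda>b. N +>\<^bsub>B\<^esub> b) ` carrier B"
    by (auto simp: quotient_star_algebra_def FactRing_def A_RCOSETS_def RCOSETS_def a_r_coset_def)
  have sub: "U \<subseteq> carrier A" if "U \<in> carrier ?Q" for U using that coset_sub unfolding carr by blast
  have UN_image: "\<pi> ` (\<Union>x\<in>U. I +>\<^bsub>A\<^esub> f x) = (\<Union>y\<in>\<pi> ` U. N +>\<^bsub>B\<^esub> g y)"
    if "U \<subseteq> carrier A" "\<And>x. x \<in> U \<Longrightarrow> f x \<in> carrier A" "\<And>x. x \<in> U \<Longrightarrow> \<pi> (f x) = g (\<pi> x)" for U f g
    unfolding image_UN image_image using that(2,3) coset by (intro SUP_cong refl) simp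
  have "image \<pi> \<in> star_hom ?Q ?R"
  proof -
    have "\<pi> ` U \<in> carrier ?R" if "U \<in> carrier ?Q" for U
      using that coset h(1) unfolding carr by auto
    moreover have "\<pi> ` (U \<otimes>\<^bsub>?Q\<^esub> V) = \<pi> ` U \<otimes>\<^bsub>?R\<^esub> \<pi> ` V" if "U \<in> carrier ?Q" "V \<in> carrier ?Q" for U V
    proof -
      have *: "U \<subseteq> carrier A" "V \<subseteq> carrier A" using that sub by auto
      have "\<pi> ` (\<Union>a\<in>U. \<Union>b\<in>V. I +>\<^bsub>A\<^esub> (a \<otimes>\<^bsub>A\<^esub> b)) = (\<Union>a\<in>U. \<Union>b\<in>\<pi> ` V. N +>\<^bsub>B\<^esub> (\<pi> a \<otimes>\<^bsub>B\<^esub> b))"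
        unfolding image_UN[of \<pi> _ U]
        using h(1,2)[OF subsetD[OF *(1)] subsetD[OF *(2)]] *
        by (intro SUP_cong refl UN_image) (auto simp: subset_iff)
      then show ?thesis by (simp add: quotient_star_algebra_def FactRing_def rcoset_mult_def)
    qed
    moreover have "\<pi> ` (U \<oplus>\<^bsub>?Q\<^esub> V) = \<pi> ` U \<oplus>\<^bsub>?R\<^esub> \<pi> ` V" if "U \<in> carrier ?Q" "V \<in> carrier ?Q" for U V
    proof -
      have *: "U \<subseteq> carrier A" "V \<subseteq> carrier A" using that sub by auto
      have "\<pi> ` (\<Union>a\<in>U. \<Union>b\<in>V. {a \<oplus>\<^bsub>A\<^esub> b}) = (\<Union>a\<in>U. \<Union>b\<in>V. {\<pi> (a \<oplus>\<^bsub>A\<^esub> b)})" by auto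
      also have "\<dots> = (\<Union>a\<in>U. \<Union>b\<in>V. {\<pi> a \<oplus>\<^bsub>B\<^esub> \<pi> b})"
        using h(3)[OF subsetD[OF *(1)] subsetD[OF *(2)]] by (intro SUP_cong refl) simp
      also have "\<dots> = (\<Union>a\<in>\<pi> ` U. \<Union>b\<in>\<pi> ` V. {a \<oplus>\<^bsub>B\<^esub> b})" by auto
      finally have "\<pi> ` (\<Union>a\<in>U. \<Union>b\<in>V. {a \<oplus>\<^bsub>A\<^esub> b}) = (\<Union>a\<in>\<pi> ` U. \<Union>b\<in>\<pi> ` V. {a \<oplus>\<^bsub>B\<^esub> b})" .
      then show ?thesis by (simp add: quotient_star_algebra_def FactRing_def set_add_def set_mult_def)
    qed
    moreover have "\<pi> ` \<one>\<^bsub>?Q\<^esub> = \<one>\<^bsub>?R\<^esub>"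
      using coset[of "\<one>\<^bsub>A\<^esub>"] h(6)[OF A.one_closed A.one_closed] by (simp add: quotient_star_algebra_def FactRing_def)
    moreover have "\<pi> ` (c \<odot>\<^bsub>?Q\<^esub> U) = c \<odot>\<^bsub>?R\<^esub> \<pi> ` U" if "U \<in> carrier ?Q" for c U
    proof -
      have "\<pi> ` (\<Union>x\<in>U. I +>\<^bsub>A\<^esub> (c \<odot>\<^bsub>A\<^esub> x)) = (\<Union>y\<in>\<pi> ` U. N +>\<^bsub>B\<^esub> (c \<odot>\<^bsub>B\<^esub> y))"
        by (rule UN_image[OF sub[OF that]]) (use sub[OF that] smult h(4) in blast)+
      then show ?thesis by (simp add: quotient_star_algebra_def)
    qed
    moreover have "\<pi> ` (adj ?Q U) = adj ?R (\<pi> ` U)" if "U \<in> carrier ?Q" for U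
    proof -
      have "\<pi> ` (\<Union>x\<in>U. I +>\<^bsub>A\<^esub> adj A x) = (\<Union>y\<in>\<pi> ` U. N +>\<^bsub>B\<^esub> adj B y)"
        by (rule UN_image[OF sub[OF that]]) (use sub[OF that] adj h(5) in blast)+
      then show ?thesis by (simp add: quotient_star_algebra_def)
    qed
    ultimately show ?thesis unfolding star_hom_def ring_hom_def by auto
  qed
  moreover have "bij_betw (image \<pi>) (carrier ?Q) (carrier ?R)"
  proof (rule bij_betw_imageI)
    show "inj_on (image \<pi>) (carrier ?Q)"
      unfolding carr using coset coset_eq by (auto intro!: inj_onI)
    show "image \<pi> ` carrier ?Q = carrier ?R"
      unfolding carr surj[symmetric] image_image using coset by (auto intro!: image_cong)
  qed
  ultimately show ?thesis unfolding cstar_isomorphic_def I_def by blast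
qed

text \<open>
  The two-sided ideal generated by the commutators, before closure.
\<close>

inductive_set comm_ideal :: "'a::complex_star_algebra set" where
  zero: "0 \<in> comm_ideal"
| comm: "a * (x * y - y * x) * b \<in> comm_ideal"
| add: "x \<in> comm_ideal \<Longrightarrow> y \<in> comm_ideal \<Longrightarrow> x + y \<in> comm_ideal"

lemma star_ideal_comm_ideal: "star_ideal comm_ideal"
proof -
  have mult: "x * z \<in> comm_ideal \<and> z * x \<in> comm_ideal \<and> star x \<in> comm_ideal"
    if "x \<in> comm_ideal" for x z :: 'a
    using that
  proof induction
    case (comm a x y b)
    have "a * (x * y - y * x) * b * z = a * (x * y - y * x) * (b * z)"
      "z * (a * (x * y - y * x) * b) = (z * a) * (x * y - y * x) * b"
      "star (a * (x * y - y * x) * b) = star b * (star y * star x - star x * star y) * star a"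
      by (simp_all add: mult.assoc star_mult star_diff)
    then show ?case using comm_ideal.comm by metis
  qed (auto intro: comm_ideal.intros simp: distrib_left distrib_right star_add)
  show ?thesis unfolding star_ideal_def using mult by (auto intro: comm_ideal.intros)
qed

text \<open>
  The completion of the polynomials over \<open>X\<close> in \<open>s\<close> maps to the completion of those over \<open>Y\<close> in the smaller seminorm \<open>t\<close>.
\<close>

locale seminorm_map =
  P: free_cstar X s + U: free_cstar Y t
  for X Y :: "'g set" and s t :: "'g free_poly \<Rightarrow> real" +
  assumes XY: "X \<subseteq> Y"
    and le: "x \<in> poly_on X \<Longrightarrow> norm_on Y t x \<le> norm_on X s x"
begin

lemma poly_on_XY: "x \<in> poly_on X \<Longrightarrow> x \<in> poly_on Y"
  using poly_on_mono[OF XY] by blast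

lemma cseq_map: "x \<in> P.cseq \<Longrightarrow> x \<in> U.cseq"
proof -
  assume x: "x \<in> P.cseq"
  have nrm: "U.nrm (x m - x n) \<le> P.nrm (x m - x n)" for m n
    using x by (intro le poly_on_closed P.cseq_poly_on)
  show ?thesis unfolding U.cseq_def
  proof (intro CollectI conjI allI impI)
    show "x n \<in> poly_on Y" for n by (intro poly_on_XY P.cseq_poly_on x)
    fix e :: real assume "0 < e"
    then obtain M where "\<forall>m\<ge>M. \<forall>n\<ge>M. P.nrm (x m - x n) < e" using x by (auto simp: P.cseq_def)
    then show "\<exists>M. \<forall>m\<ge>M. \<forall>n\<ge>M. U.nrm (x m - x n) < e"
      by (intro exI[of _ M] allI impI) (auto intro: le_less_trans[OF nrm])
  qed
qed

lemma limnorm_le: "x \<in> P.cseq \<Longrightarrow> U.limnorm x \<le> P.limnorm x"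
  by (rule LIMSEQ_le[OF U.cseq_norm_limit[OF cseq_map] P.cseq_norm_limit])
    (auto intro!: le P.cseq_poly_on)

definition canon :: "(nat \<Rightarrow> 'g free_poly) set \<Rightarrow> (nat \<Rightarrow> 'g free_poly) set" where
  "canon V = U.cls (SOME x. x \<in> P.cseq \<and> P.cls x = V)"

lemma canon_cls:
  assumes "x \<in> P.cseq"
  shows "canon (P.cls x) = U.cls x"
proof -
  define y where "y = (SOME y. y \<in> P.cseq \<and> P.cls y = P.cls x)"
  have y: "y \<in> P.cseq" "P.cls y = P.cls x"
    unfolding y_def using someI[of "\<lambda>y. y \<in> P.cseq \<and> P.cls y = P.cls x" x] assms by auto
  then have "P.limnorm (\<lambda>n. y n - x n) = 0" using P.cls_eq_iff assms by simp
  then have "U.limnorm (\<lambda>n. y n - x n) = 0"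
    using limnorm_le[OF P.cseq_diff[OF y(1) assms]] U.limnorm_nonneg[OF U.cseq_diff[OF cseq_map cseq_map], of y x] y(1) assms
    by simp
  then have "U.cls y = U.cls x" using U.cls_eq_iff y(1) assms cseq_map by simp
  then show ?thesis by (simp add: canon_def y_def)
qed

definition canon_range :: "(nat \<Rightarrow> 'g free_poly) set set" where
  "canon_range = U.cls ` P.cseq"

lemma canon_image: "canon ` carrier P.C = canon_range"
  unfolding P.completion_carrier canon_range_def image_image using canon_cls by (auto intro!: image_cong)

lemma lift:
  assumes "x \<in> poly_on X" "norm_on Y t x \<le> d" "0 < d"
  obtains z where "z \<in> poly_on X" "P.nrm z \<le> 2 * d" "U.nrm (x - z) \<le> d/48"
proof -
  have eq: "norm_on X t x = U.nrm x" if "x \<in> poly_on X" for x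
    using that poly_on_XY by (simp add: norm_on_eq)
  have "has_cstar_seminorm (free_star_algebra X t)"
    by (rule has_cstar_seminorm_freeI[OF U.cstar_seminorm_axioms]) (simp add: norm_on_eq poly_on_XY)
  then have M: "cstar_seminorm (norm_on X t)" by (rule has_cstar_seminorm_freeD)
  have restrict: "norm_on X r x = norm_on X r (restrict_letters X x)" for r x
    by (simp add: norm_on_def restrict_letters_in)
  have "norm_on X t x \<le> P.nrm x" for x
    using le[OF restrict_letters_in] eq[OF restrict_letters_in] restrict by metis
  then obtain z where z: "P.nrm z \<le> 2 * d" "norm_on X t (x - z) \<le> d/48"
    using lift_scaled[OF P.cstar_seminorm_axioms M _ _ assms(3), of x] eq[OF assms(1)] assms(2) by auto
  have "norm_on X t (x - restrict_letters X z) = norm_on X t (x - z)"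
    using restrict[of t "x - z"] assms(1) by (simp add: restrict_letters_hom)
  moreover have "x - restrict_letters X z \<in> poly_on X"
    using assms(1) by (intro poly_on_closed restrict_letters_in)
  ultimately show ?thesis
    using that[of "restrict_letters X z"] z eq restrict[of s z] restrict_letters_in by metis
qed

text \<open>
  Successive approximation: a polynomial \<open>g\<close> at distance \<open>4\<^sup>-\<^sup>m\<close> from \<open>y\<close> is corrected by a polynomial that, by \<open>lift\<close>, is of
  order \<open>4\<^sup>-\<^sup>m\<close> also in \<open>s\<close>. So the approximants form a Cauchy sequence for \<open>s\<close>.
\<close>

lemma closed_range:
  assumes y: "y \<in> U.cseq" and approx: "\<And>e. 0 < e \<Longrightarrow> \<exists>x\<in>P.cseq. U.limnorm (\<lambda>n. y n - x n) < e"
  shows "U.cls y \<in> canon_range"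
proof -
  have approx_poly: "\<exists>f\<in>poly_on X. U.limnorm (\<lambda>n. y n - f) < e" if "0 < e" for e
  proof -
    obtain x where x: "x \<in> P.cseq" "U.limnorm (\<lambda>n. y n - x n) < e/2" using approx[of "e/2"] \<open>0 < e\<close> by auto
    obtain f where f: "f \<in> poly_on X" "P.limnorm (\<lambda>n. x n - f) < e/2"
      using P.completion_dense[OF x(1), of "e/2"] \<open>0 < e\<close> by auto
    have "U.limnorm (\<lambda>n. x n - f) < e/2"
      using limnorm_le[OF P.cseq_diff[OF x(1) P.cseq_const[OF f(1)]]] f(2) by simp
    then show ?thesis
      using U.limnorm_triangle[OF y cseq_map[OF x(1)] U.cseq_const[OF poly_on_XY[OF f(1)]]] x(2) f(1)
      by (intro bexI[of _ f]) simp_all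
  qed
  have "\<exists>g. \<forall>m. (g m \<in> poly_on X \<and> U.limnorm (\<lambda>n. y n - g m) \<le> (1/4)^m) \<and> P.nrm (g (Suc m) - g m) \<le> 4 * (1/4)^m"
  proof (rule dependent_nat_choice)
    show "\<exists>g. g \<in> poly_on X \<and> U.limnorm (\<lambda>n. y n - g) \<le> (1/4)^0"
      using approx_poly[of 1] by (auto intro: less_imp_le)
  next
    fix g m assume g: "g \<in> poly_on X \<and> U.limnorm (\<lambda>n. y n - g) \<le> (1/4)^m"
    \<comment> \<open>\<open>f - g\<close> has norm at most \<open>2d\<close>, so its lift \<open>z\<close> misses it by \<open>2d/48\<close>, and \<open>d/8 + 2d/48 \<le> d/4\<close>.\<close>
    define d :: real where "d = (1/4)^m"
    have d: "0 < d" by (simp add: d_def)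
    obtain f where f: "f \<in> poly_on X" "U.limnorm (\<lambda>n. y n - f) < d/8" using approx_poly[of "d/8"] d by auto
    have cg: "(\<lambda>_. g) \<in> U.cseq" "(\<lambda>_. f) \<in> U.cseq" using g f(1) poly_on_XY U.cseq_const by auto
    have "U.nrm (f - g) = U.limnorm (\<lambda>_. f - g)"
      using g f(1) by (intro U.limnorm_const[symmetric] poly_on_XY poly_on_closed) auto
    also have "\<dots> \<le> U.limnorm (\<lambda>n. f - y n) + U.limnorm (\<lambda>n. y n - g)"
      by (rule U.limnorm_triangle[OF cg(2) y cg(1)])
    also have "\<dots> \<le> 2 * d"
      using f(2) g U.limnorm_minus_commute[of "\<lambda>_. f" y] d by (simp add: d_def[symmetric])
    finally have fg: "U.nrm (f - g) \<le> 2 * d" .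
    have "f - g \<in> poly_on X" "0 < 2 * d" using g f(1) d by (simp_all add: poly_on_closed)
    then obtain z where z: "z \<in> poly_on X" "P.nrm z \<le> 2 * (2 * d)" "U.nrm (f - g - z) \<le> 2 * d/48"
      by (rule lift[OF _ fg]) blast
    have gz: "g + z \<in> poly_on X" using g z(1) by (simp add: poly_on_closed)
    have "U.limnorm (\<lambda>n. y n - (g + z)) \<le> U.limnorm (\<lambda>n. y n - f) + U.limnorm (\<lambda>_. f - (g + z))"
      using U.limnorm_triangle[OF y cg(2) U.cseq_const[OF poly_on_XY[OF gz]]] .
    also have "U.limnorm (\<lambda>_. f - (g + z)) = U.nrm (f - g - z)"
      using gz f(1) U.limnorm_const[OF poly_on_XY, of "f - (g + z)"] by (simp add: poly_on_closed algebra_simps)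
    finally have "U.limnorm (\<lambda>n. y n - (g + z)) \<le> (1/4)^Suc m"
      using f(2) z(3) d by (simp add: d_def[symmetric])
    then show "\<exists>g'. (g' \<in> poly_on X \<and> U.limnorm (\<lambda>n. y n - g') \<le> (1/4)^Suc m) \<and> P.nrm (g' - g) \<le> 4 * (1/4)^m"
      using gz z(2) by (intro exI[of _ "g + z"]) (simp add: d_def)
  qed
  then obtain g where g: "\<And>m. g m \<in> poly_on X" "\<And>m. U.limnorm (\<lambda>n. y n - g m) \<le> (1/4)^m"
    "\<And>m. P.nrm (g (Suc m) - g m) \<le> 4 * (1/4)^m" by blast
  have tail: "P.nrm (g (m + j) - g m) \<le> 16/3 * ((1/4)^m - (1/4)^(m + j))" for m j
  proof (induction j)
    case (Suc j)
    have "P.nrm (g (m + Suc j) - g m) \<le> P.nrm (g (Suc (m + j)) - g (m + j)) + P.nrm (g (m + j) - g m)"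
      using P.triangle[of "g (Suc (m + j)) - g (m + j)" "g (m + j) - g m"] by simp
    then show ?case using Suc g(3)[of "m + j"] by simp
  qed simp
  have tail6: "P.nrm (g n - g m) \<le> 6 * (1/4)^m" if "m \<le> n" for m n
  proof -
    have "16/3 * ((1/4)^m - (1/4)^n) \<le> 6 * (1/4::real)^m"
    proof -
      have "16/3 * (a - b) \<le> 6 * a" if "0 \<le> a" "0 \<le> b" for a b :: real
        using that by (simp add: field_simps)
      from this[of "(1/4)^m" "(1/4)^n"] show ?thesis by (simp only: zero_le_power zero_le_divide_1_iff zero_le_numeral)
    qed
    then show ?thesis using tail[of m "n - m"] that by simp
  qed
  have small: "\<exists>m. 7 * (1/4)^m < e" if "0 < e" for e :: real
    using real_arch_pow_inv[of "e/7" "1/4"] that by (auto simp: field_simps)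
  have gseq: "g \<in> P.cseq"
    unfolding P.cseq_def
  proof (intro CollectI conjI allI impI g(1))
    fix e :: real assume "0 < e"
    then obtain m where m: "7 * (1/4)^m < e / 2" using small[of "e/2"] by auto
    have "P.nrm (g a - g b) < e" if "m \<le> a" "m \<le> b" for a b
    proof -
      have "P.nrm (g a - g b) \<le> P.nrm (g a - g m) + P.nrm (g b - g m)"
        using P.triangle[of "g a - g m" "g m - g b"] P.minus_commute[of "g m" "g b"] by simp
      also have "\<dots> \<le> 6 * (1/4)^m + 6 * (1/4)^m" by (intro add_mono tail6 that)
      finally show ?thesis using m zero_le_power[of "1/4::real" m] by linarith
    qed
    then show "\<exists>M. \<forall>a\<ge>M. \<forall>b\<ge>M. P.nrm (g a - g b) < e" by blast
  qed
  have "U.limnorm (\<lambda>n. y n - g n) \<le> 7 * (1/4)^m" for m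
  proof -
    have cm: "(\<lambda>_. g m) \<in> P.cseq" by (rule P.cseq_const[OF g(1)])
    have "U.limnorm (\<lambda>n. g m - g n) \<le> P.limnorm (\<lambda>n. g m - g n)"
      by (rule limnorm_le[OF P.cseq_diff[OF cm gseq]])
    also have "\<dots> \<le> 6 * (1/4)^m"
      using tail6[of m] P.minus_commute
      by (intro LIMSEQ_le_const2[OF P.cseq_norm_limit[OF P.cseq_diff[OF cm gseq]]]) (metis)
    finally show ?thesis
      using U.limnorm_triangle[OF y cseq_map[OF cm] cseq_map[OF gseq]] g(2)[of m] by simp
  qed
  then have "U.limnorm (\<lambda>n. y n - g n) \<le> 0"
    using small by (meson leI less_le_trans order.strict_trans1 order_less_irrefl)
  then have "U.limnorm (\<lambda>n. y n - g n) = 0"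
    using U.limnorm_nonneg[OF U.cseq_diff[OF y cseq_map[OF gseq]]] by simp
  then have "U.cls y = U.cls g" using U.cls_eq_iff[OF y cseq_map[OF gseq]] by simp
  then show ?thesis using gseq by (simp add: canon_range_def)
qed

lemma canon_range_sub: "canon_range \<subseteq> carrier U.C"
  using cseq_map by (auto simp: canon_range_def U.completion_carrier)

lemma canon_range_ops:
  assumes "x \<in> P.cseq" "y \<in> P.cseq"
  shows "U.cls x \<oplus>\<^bsub>U.C\<^esub> U.cls y = U.cls (\<lambda>n. x n + y n)"
    "U.cls x \<otimes>\<^bsub>U.C\<^esub> U.cls y = U.cls (\<lambda>n. x n * y n)"
    "c \<odot>\<^bsub>U.C\<^esub> U.cls x = U.cls (\<lambda>n. scaleC c (x n))"
    "adj U.C (U.cls x) = U.cls (\<lambda>n. star (x n))"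
    "\<ominus>\<^bsub>U.C\<^esub> U.cls x = U.cls (\<lambda>n. - x n)"
    "U.cls x \<ominus>\<^bsub>U.C\<^esub> U.cls y = U.cls (\<lambda>n. x n - y n)"
  using cseq_map[OF assms(1)] cseq_map[OF assms(2)]
  by (simp_all add: U.completion_ops U.completion_unary_ops U.completion_neg U.completion_minus)

lemma one_in_canon_range: "\<one>\<^bsub>U.C\<^esub> \<in> canon_range"
  by (auto simp: canon_range_def U.completion_one_zero intro!: imageI P.cseq_const poly_on_closed)

lemma cstar_subalgebra_canon_range: "cstar_subalgebra U.C canon_range"
  unfolding cstar_subalgebra_def
proof (intro conjI)
  show "norm_closed U.C canon_range"
    unfolding norm_closed_def
  proof (intro ballI impI)
    fix V assume "V \<in> carrier U.C" and a: "\<forall>e>0. \<exists>y\<in>canon_range. anorm U.C (V \<ominus>\<^bsub>U.C\<^esub> y) < e"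
    then obtain y where y: "V = U.cls y" "y \<in> U.cseq" by (auto simp: U.completion_carrier)
    have "\<exists>x\<in>P.cseq. U.limnorm (\<lambda>n. y n - x n) < e" if "0 < e" for e
      using a[rule_format, OF that] y cseq_map
      by (auto simp: canon_range_def U.completion_minus U.completion_unary_ops U.cseq_diff)
    then show "V \<in> canon_range" using closed_range[OF y(2)] y(1) by simp
  qed
qed (use canon_range_sub one_in_canon_range in \<open>auto simp: canon_range_def canon_range_ops intro!: imageI P.cseq_ops\<close>)

text \<open>
  A closed *-subalgebra with the generators contains all words, then all polynomials, then all limits.
\<close>

lemma canon_range_least:
  assumes S: "cstar_subalgebra U.C S" and gens: "\<And>a. a \<in> X \<Longrightarrow> U.cls (\<lambda>_. gen a) \<in> S"
  shows "canon_range \<subseteq> S"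
proof -
  have cl: "V \<oplus>\<^bsub>U.C\<^esub> W \<in> S" "V \<otimes>\<^bsub>U.C\<^esub> W \<in> S" "c \<odot>\<^bsub>U.C\<^esub> V \<in> S" "adj U.C V \<in> S" if "V \<in> S" "W \<in> S" for V W c
    using S that unfolding cstar_subalgebra_def by auto
  have one: "\<one>\<^bsub>U.C\<^esub> \<in> S" and closed: "norm_closed U.C S" using S unfolding cstar_subalgebra_def by auto
  have word: "U.cls (\<lambda>_. monomial w) \<in> S" if "fst ` set w \<subseteq> X" for w
    using that
  proof (induction w)
    case (Cons l w)
    have "gen (fst l) \<in> poly_on Y" using Cons.prems XY by (intro gen_poly_on) auto
    moreover have "letter l = gen (fst l) \<or> letter l = star (gen (fst l))"
      unfolding star_gen by (cases l; cases "snd l") (auto simp: letter_def gen_def)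
    ultimately have "U.cls (\<lambda>_. letter l) \<in> S \<and> letter l \<in> poly_on Y"
      using gens[of "fst l"] Cons.prems cl(4)[of "U.cls (\<lambda>_. gen (fst l))"]
      by (auto simp: U.completion_unary_ops U.cseq_const poly_on_closed)
    moreover have "monomial w \<in> poly_on Y" using Cons.prems XY by (auto simp: poly_on_def split: if_splits)
    ultimately show ?case using Cons cl(2)[of "U.cls (\<lambda>_. letter l)" "U.cls (\<lambda>_. monomial w)"]
      by (simp add: mono_Cons U.completion_ops U.cseq_const)
  qed (use one in \<open>simp add: mono_Nil U.completion_one_zero\<close>)
  have zero: "U.cls (\<lambda>_. 0) \<in> S"
    using cl(3)[OF one one, of 0] by (simp add: U.completion_one_zero U.completion_unary_ops U.cseq_const poly_on_closed)
  have poly: "U.cls (\<lambda>_. f) \<in> S" if f: "f \<in> poly_on X" for f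
  proof -
    have "U.cls (\<lambda>_. \<Sum>w\<in>W. scaleC (coeff f w) (monomial w)) \<in> S" if "finite W" "W \<subseteq> support f" for W
      using that
    proof (induction W rule: finite_induct)
      case (insert w W)
      have w: "fst ` set v \<subseteq> X" if "v \<in> insert w W" for v using insert.prems f that by (auto simp: poly_on_def)
      have m: "scaleC (coeff f v) (monomial v) \<in> poly_on Y" "monomial v \<in> poly_on Y" if "v \<in> insert w W" for v
        using w[OF that] XY by (auto simp: poly_on_def split: if_splits)
      then have "(\<Sum>v\<in>W. scaleC (coeff f v) (monomial v)) \<in> poly_on Y" by (intro poly_on_sum) auto
      moreover have "U.cls (\<lambda>_. scaleC (coeff f w) (monomial w)) \<in> S"
        using cl(3)[OF word word, of w w "coeff f w"] w m(2) by (simp add: U.completion_unary_ops U.cseq_const)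
      ultimately show ?case
        using insert cl(1) m(1)[of w] by (fastforce simp: U.completion_ops U.cseq_const)
    qed (simp add: zero)
    from this[of "support f"] show ?thesis using fpoly_expansion[of f] by simp
  qed
  show ?thesis
  proof
    fix V assume "V \<in> canon_range"
    then obtain x where x: "V = U.cls x" "x \<in> P.cseq" by (auto simp: canon_range_def)
    have "\<exists>W\<in>S. anorm U.C (V \<ominus>\<^bsub>U.C\<^esub> W) < e" if e: "0 < e" for e
    proof -
      obtain f where f: "f \<in> poly_on X" "P.limnorm (\<lambda>n. x n - f) < e"
        by (rule P.completion_dense[OF x(2) e]) blast
      have fx: "(\<lambda>n. x n - f) \<in> P.cseq" by (intro P.cseq_ops x f)
      have "anorm U.C (V \<ominus>\<^bsub>U.C\<^esub> U.cls (\<lambda>_. f)) = U.limnorm (\<lambda>n. x n - f)"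
        using x cseq_map[OF fx] by (simp add: canon_range_ops P.cseq_const f(1) U.completion_unary_ops)
      then show ?thesis using limnorm_le[OF fx] f(2) poly[OF f(1)] by (intro bexI[of _ "U.cls (\<lambda>_. f)"]) simp_all
    qed
    then show "V \<in> S" using closed x cseq_map unfolding norm_closed_def
      by (auto simp: U.completion_carrier)
  qed
qed

abbreviation B :: "(nat \<Rightarrow> 'g free_poly) set star_algebra" where
  "B \<equiv> U.C\<lparr>carrier := canon_range\<rparr>"

lemma generated_eq_B: "generated_cstar_subalgebra U.C {U.cls (\<lambda>_. gen a) | a. a \<in> X} = B"
proof -
  have "U.cls (\<lambda>_. gen a) \<in> canon_range" if "a \<in> X" for a
    using that by (auto simp: canon_range_def intro!: imageI P.cseq_const gen_poly_on)
  then have "\<Inter>{S. cstar_subalgebra U.C S \<and> {U.cls (\<lambda>_. gen a) | a. a \<in> X} \<subseteq> S} = canon_range"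
    using cstar_subalgebra_canon_range canon_range_least by (intro equalityI) (blast, auto)
  then show ?thesis by (simp add: generated_cstar_subalgebra_def)
qed

lemma ring_B: "ring B"
proof (rule ringI)
  show "abelian_group B"
  proof (rule abelian_groupI)
    fix V assume "V \<in> carrier B"
    then obtain x where x: "V = U.cls x" "x \<in> P.cseq" by (auto simp: canon_range_def)
    then show "\<exists>W\<in>carrier B. W \<oplus>\<^bsub>B\<^esub> V = \<zero>\<^bsub>B\<^esub>"
      using P.cseq_minus[of x]
      by (intro bexI[of _ "U.cls (\<lambda>n. - x n)"]) (simp_all add: canon_range_ops U.completion_one_zero canon_range_def)
  qed (auto simp: canon_range_def canon_range_ops U.completion_one_zero P.cseq_ops poly_on_closed algebra_simps)
  show "Group.monoid B"
    by (rule monoidI) (auto simp: canon_range_def canon_range_ops U.completion_one_zero P.cseq_ops poly_on_closed algebra_simps)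
qed (auto simp: canon_range_def canon_range_ops P.cseq_ops algebra_simps)

lemma B_minus: "x \<in> P.cseq \<Longrightarrow> y \<in> P.cseq \<Longrightarrow> U.cls x \<ominus>\<^bsub>B\<^esub> U.cls y = U.cls (\<lambda>n. x n - y n)"
proof -
  assume xy: "x \<in> P.cseq" "y \<in> P.cseq"
  interpret B: ring B by (rule ring_B)
  have "\<ominus>\<^bsub>B\<^esub> U.cls y = U.cls (\<lambda>n. - y n)"
  proof (rule B.minus_equality)
    show "U.cls (\<lambda>n. - y n) \<oplus>\<^bsub>B\<^esub> U.cls y = \<zero>\<^bsub>B\<^esub>"
      using canon_range_ops(1)[OF P.cseq_minus[OF xy(2)] xy(2)] by (simp add: U.completion_one_zero)
  qed (use xy P.cseq_minus in \<open>auto simp: canon_range_def\<close>)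
  then show ?thesis using xy by (simp add: a_minus_def canon_range_ops P.cseq_minus)
qed

lemma canon_hom: "canon \<in> star_hom P.C B"
  unfolding star_hom_def ring_hom_def
  by (auto simp: P.completion_carrier canon_cls P.completion_ops P.completion_unary_ops P.completion_one_zero
      U.completion_one_zero canon_range_ops canon_range_def P.cseq_ops poly_on_closed intro!: imageI)

lemma canon_minus:
  assumes "V \<in> carrier P.C" "W \<in> carrier P.C"
  shows "canon (V \<ominus>\<^bsub>P.C\<^esub> W) = canon V \<ominus>\<^bsub>B\<^esub> canon W"
  using assms by (auto simp: P.completion_carrier P.completion_minus canon_cls B_minus P.cseq_diff)

lemma canon_image_B: "canon ` carrier P.C = carrier B"
  using canon_image by simp

lemma P_closed: "V \<in> carrier P.C \<Longrightarrow> c \<odot>\<^bsub>P.C\<^esub> V \<in> carrier P.C" "V \<in> carrier P.C \<Longrightarrow> adj P.C V \<in> carrier P.C"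
  by (auto simp: P.completion_carrier P.completion_unary_ops intro!: imageI P.cseq_ops)

lemma reduced_isomorphic:
  "cstar_isomorphic (reduced_version P.C (h \<circ> canon)) (reduced_version B h)"
proof -
  have "null_ideal P.C (h \<circ> canon) = {V \<in> carrier P.C. canon V \<in> null_ideal B h}"
    unfolding null_ideal_def using canon_image_B
    by (auto simp: P.completion_carrier canon_cls P.completion_ops P.completion_unary_ops canon_range_ops P.cseq_ops)
  then show ?thesis
    unfolding reduced_version_def
    using quotient_isomorphic[OF P.ring_completion ring_B canon_hom canon_image_B _ P_closed, of "null_ideal B h"]
    by (auto simp: null_ideal_def)
qed

end

text \<open>
  The assumption says that \<open>t\<close> sees all of \<open>s\<close> up to commutators. In the application it holds because enough
  characters of the source extend to the target.
\<close>

locale seminorm_map_points = seminorm_map +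
  assumes points: "x \<in> poly_on X \<Longrightarrow> cstar_seminorm.quotient_seminorm (norm_on X s) comm_ideal x \<le> norm_on Y t x"
begin

definition comm_closed :: "(nat \<Rightarrow> 'a free_poly) set star_algebra \<Rightarrow> (nat \<Rightarrow> 'a free_poly) set set \<Rightarrow> bool" where
  "comm_closed A I \<longleftrightarrow> ideal I A \<and> norm_closed A I \<and>
     (\<forall>x\<in>carrier A. \<forall>y\<in>carrier A. x \<otimes>\<^bsub>A\<^esub> y \<ominus>\<^bsub>A\<^esub> y \<otimes>\<^bsub>A\<^esub> x \<in> I)"

lemma commutator_ideal_alt: "commutator_ideal A = \<Inter>{I. comm_closed A I}"
  by (simp add: commutator_ideal_def comm_closed_def)

lemma comm_closed_carrier: "ring A \<Longrightarrow> comm_closed A (carrier A)"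
proof -
  assume "ring A"
  then interpret A: ring A .
  show ?thesis unfolding comm_closed_def norm_closed_def using A.oneideal by auto
qed

lemma comm_ideal_in:
  assumes I: "comm_closed P.C I" and c: "c \<in> comm_ideal"
  shows "P.cls (\<lambda>_. restrict_letters X c) \<in> I"
proof -
  have id: "ideal I P.C" using I by (simp add: comm_closed_def)
  interpret I: ideal I P.C by (rule id)
  note I_zero = additive_subgroup.zero_closed[OF ideal.axioms(1)[OF id]]
    and I_add = additive_subgroup.a_closed[OF ideal.axioms(1)[OF id]]
    and I_neg = additive_subgroup.a_inv_closed[OF ideal.axioms(1)[OF id]]
  have C: "(\<lambda>_. restrict_letters X z) \<in> P.cseq" for z by (intro P.cseq_const restrict_letters_in)
  have car: "P.cls (\<lambda>_. restrict_letters X z) \<in> carrier P.C" for z using C by (simp add: P.completion_carrier)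
  show ?thesis using c
  proof induction
    case zero
    then show ?case using I_zero by (simp add: P.completion_one_zero restrict_letters_hom)
  next
    case (comm a x y b)
    let ?r = "restrict_letters X"
    have "P.cls (\<lambda>_. ?r x) \<otimes>\<^bsub>P.C\<^esub> P.cls (\<lambda>_. ?r y) \<ominus>\<^bsub>P.C\<^esub> P.cls (\<lambda>_. ?r y) \<otimes>\<^bsub>P.C\<^esub> P.cls (\<lambda>_. ?r x) \<in> I"
      using I car[of x] car[of y] unfolding comm_closed_def by blast
    then have "P.cls (\<lambda>_. ?r x * ?r y - ?r y * ?r x) \<in> I"
      by (simp add: P.completion_ops P.completion_minus C P.cseq_mult)
    then have "P.cls (\<lambda>_. ?r a) \<otimes>\<^bsub>P.C\<^esub> P.cls (\<lambda>_. ?r x * ?r y - ?r y * ?r x) \<otimes>\<^bsub>P.C\<^esub> P.cls (\<lambda>_. ?r b) \<in> I"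
      using car by (intro I.I_l_closed I.I_r_closed)
    then show ?case
      by (simp add: P.completion_ops C P.cseq_ops restrict_letters_mult restrict_letters_hom)
  next
    case (add x y)
    then show ?case using I_add[OF add.IH] by (simp add: P.completion_ops C restrict_letters_hom)
  qed
qed

text \<open>
  If the image of \<open>a\<close> is approximated by images of elements of \<open>I\<close>, then \<open>a\<close> lies in \<open>I\<close>: the difference of \<open>a\<close> and an
  element of \<open>I\<close> is close to a polynomial of small \<open>t\<close>-norm, which by \<open>points\<close> can be made small for \<open>s\<close> by adding
  commutators. In particular \<open>I\<close> contains the kernel and its image is closed.
\<close>

lemma approx_in_ideal:
  assumes I: "comm_closed P.C I" and a: "a \<in> P.cseq"
    and approx: "\<And>e. 0 < e \<Longrightarrow> \<exists>b\<in>P.cseq. P.cls b \<in> I \<and> U.limnorm (\<lambda>n. a n - b n) < e"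
  shows "P.cls a \<in> I"
proof -
  have id: "ideal I P.C" and cl: "norm_closed P.C I" using I by (simp_all add: comm_closed_def)
  interpret I: ideal I P.C by (rule id)
  note I_zero = additive_subgroup.zero_closed[OF ideal.axioms(1)[OF id]]
    and I_add = additive_subgroup.a_closed[OF ideal.axioms(1)[OF id]]
    and I_neg = additive_subgroup.a_inv_closed[OF ideal.axioms(1)[OF id]]
  have "\<exists>W\<in>I. anorm P.C (P.cls a \<ominus>\<^bsub>P.C\<^esub> W) < e" if "0 < e" for e
  proof -
    define d where "d = e / 3"
    have d: "0 < d" using that by (simp add: d_def)
    obtain b where b: "b \<in> P.cseq" "P.cls b \<in> I" "U.limnorm (\<lambda>n. a n - b n) < d" using approx[OF d] by blast
    have ab: "(\<lambda>n. a n - b n) \<in> P.cseq" by (intro P.cseq_ops a b)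
    obtain f where f: "f \<in> poly_on X" "P.limnorm (\<lambda>n. a n - b n - f) < d"
      by (rule P.completion_dense[OF ab d]) blast
    have abf: "(\<lambda>n. a n - b n - f) \<in> P.cseq" by (intro P.cseq_ops ab f)
    have cf: "(\<lambda>_. f) \<in> P.cseq" by (rule P.cseq_const[OF f(1)])
    have "U.nrm f = U.limnorm (\<lambda>_. f)" using U.limnorm_const[OF poly_on_XY[OF f(1)]] by simp
    also have "\<dots> = U.limnorm (\<lambda>n. (a n - b n) + - (a n - b n - f))" by simp
    also have "\<dots> \<le> U.limnorm (\<lambda>n. a n - b n) + U.limnorm (\<lambda>n. - (a n - b n - f))"
      by (intro U.limnorm_add cseq_map ab P.cseq_minus abf)
    also have "U.limnorm (\<lambda>n. - (a n - b n - f)) = U.limnorm (\<lambda>n. a n - b n - f)"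
      unfolding U.limnorm_def by (simp only: U.minus)
    also have "\<dots> < d" using limnorm_le[OF abf] f(2) by simp
    finally have "U.nrm f < 2 * d" using b(3) by simp
    then have "P.quotient_seminorm comm_ideal f < 2 * d" using points[OF f(1)] by simp
    then obtain c where c: "c \<in> comm_ideal" "P.nrm (f + c) < 2 * d"
      using P.quotient_seminorm_witness[OF star_ideal_comm_ideal] by blast
    let ?c = "restrict_letters X c"
    have cc: "?c \<in> poly_on X" "(\<lambda>_. ?c) \<in> P.cseq" by (simp_all add: restrict_letters_in P.cseq_const)
    have "P.nrm (f + ?c) = P.nrm (f + c)"
      using f(1) cc(1) by (simp add: norm_on_def restrict_letters_hom)
    moreover have fc: "f + ?c \<in> poly_on X" using f(1) cc(1) by (simp add: poly_on_closed)
    moreover have "P.limnorm (\<lambda>n. (a n - b n - f) + (f + ?c)) \<le> P.limnorm (\<lambda>n. a n - b n - f) + P.limnorm (\<lambda>_. f + ?c)"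
      by (intro P.limnorm_add abf P.cseq_const fc)
    ultimately have "P.limnorm (\<lambda>n. a n - (b n - ?c)) < e"
      using f(2) c(2) P.limnorm_const[OF fc] by (simp add: d_def algebra_simps)
    moreover have bc: "(\<lambda>n. b n - ?c) \<in> P.cseq" by (intro P.cseq_ops b cc)
    ultimately have "anorm P.C (P.cls a \<ominus>\<^bsub>P.C\<^esub> P.cls (\<lambda>n. b n - ?c)) < e"
      using a by (simp add: P.completion_minus P.completion_unary_ops P.cseq_diff)
    moreover have "P.cls (\<lambda>n. b n - ?c) \<in> I"
      using I_add[OF b(2) I_neg[OF comm_ideal_in[OF I c(1)]]] b(1) cc(2)
      by (simp add: P.completion_neg P.completion_ops P.cseq_minus)
    ultimately show ?thesis by blast
  qed
  then show ?thesis using cl a unfolding norm_closed_def by (simp add: P.completion_carrier)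
qed

lemma preimage_comm_closed:
  assumes I: "comm_closed B I"
  shows "comm_closed P.C {V \<in> carrier P.C. canon V \<in> I}"
proof -
  interpret P': ring P.C by (rule P.ring_completion)
  interpret B': ring B by (rule ring_B)
  interpret ring_hom_ring P.C B canon
    using canon_hom by unfold_locales (simp add: star_hom_def)
  have id: "ideal I B" and cl: "norm_closed B I" using I by (simp_all add: comm_closed_def)
  have "norm_closed P.C {V \<in> carrier P.C. canon V \<in> I}"
    unfolding norm_closed_def
  proof (intro ballI impI CollectI conjI)
    fix V assume V: "V \<in> carrier P.C"
      and ap: "\<forall>e>0. \<exists>W\<in>{V \<in> carrier P.C. canon V \<in> I}. anorm P.C (V \<ominus>\<^bsub>P.C\<^esub> W) < e"
    obtain x where x: "V = P.cls x" "x \<in> P.cseq" using V by (auto simp: P.completion_carrier)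
    have "\<exists>W\<in>I. anorm B (canon V \<ominus>\<^bsub>B\<^esub> W) < e" if e: "0 < e" for e
    proof -
      obtain W where W: "W \<in> carrier P.C" "canon W \<in> I" "anorm P.C (V \<ominus>\<^bsub>P.C\<^esub> W) < e"
        using ap[rule_format, OF e] by blast
      then obtain y where y: "W = P.cls y" "y \<in> P.cseq" by (auto simp: P.completion_carrier)
      have xy: "(\<lambda>n. x n - y n) \<in> P.cseq" by (intro P.cseq_ops x y)
      have "anorm B (canon V \<ominus>\<^bsub>B\<^esub> canon W) = U.limnorm (\<lambda>n. x n - y n)"
        using x y cseq_map[OF xy] by (simp add: canon_cls B_minus U.completion_unary_ops)
      also have "\<dots> \<le> anorm P.C (V \<ominus>\<^bsub>P.C\<^esub> W)"
        using limnorm_le[OF xy] x y xy by (simp add: P.completion_minus P.completion_unary_ops)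
      finally show ?thesis using W by (intro bexI[of _ "canon W"]) simp_all
    qed
    moreover have "canon V \<in> carrier B" by (rule hom_closed[OF V])
    ultimately show "canon V \<in> I" using cl unfolding norm_closed_def by blast
  qed
  moreover have "V \<otimes>\<^bsub>P.C\<^esub> W \<ominus>\<^bsub>P.C\<^esub> W \<otimes>\<^bsub>P.C\<^esub> V \<in> {V \<in> carrier P.C. canon V \<in> I}"
    if "V \<in> carrier P.C" "W \<in> carrier P.C" for V W
  proof -
    have "canon (V \<otimes>\<^bsub>P.C\<^esub> W \<ominus>\<^bsub>P.C\<^esub> W \<otimes>\<^bsub>P.C\<^esub> V) = canon V \<otimes>\<^bsub>B\<^esub> canon W \<ominus>\<^bsub>B\<^esub> canon W \<otimes>\<^bsub>B\<^esub> canon V"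
      using that by (simp only: canon_minus hom_mult P'.m_closed)
    moreover have "canon V \<otimes>\<^bsub>B\<^esub> canon W \<ominus>\<^bsub>B\<^esub> canon W \<otimes>\<^bsub>B\<^esub> canon V \<in> I"
      using I hom_closed[OF that(1)] hom_closed[OF that(2)] unfolding comm_closed_def by blast
    moreover have "V \<otimes>\<^bsub>P.C\<^esub> W \<ominus>\<^bsub>P.C\<^esub> W \<otimes>\<^bsub>P.C\<^esub> V \<in> carrier P.C"
      using that by (intro P'.minus_closed P'.m_closed)
    ultimately show ?thesis by (simp only: mem_Collect_eq)
  qed
  ultimately show ?thesis using ideal_vimage[OF id] unfolding comm_closed_def by blast
qed

lemma image_comm_closed:
  assumes I: "comm_closed P.C I"
  shows "comm_closed B (canon ` I)"
proof -
  interpret P': ring P.C by (rule P.ring_completion)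
  interpret B': ring B by (rule ring_B)
  interpret ring_hom_ring P.C B canon
    using canon_hom by unfold_locales (simp add: star_hom_def)
  have id: "ideal I P.C" using I by (simp add: comm_closed_def)
  interpret I: ideal I P.C by (rule id)
  note I_zero = additive_subgroup.zero_closed[OF ideal.axioms(1)[OF id]]
    and I_add = additive_subgroup.a_closed[OF ideal.axioms(1)[OF id]]
    and I_neg = additive_subgroup.a_inv_closed[OF ideal.axioms(1)[OF id]]
  have IC: "V \<in> carrier P.C" if "V \<in> I" for V using that I.Icarr by blast
  have BC: "\<exists>V\<in>carrier P.C. W = canon V" if "W \<in> carrier B" for W using that canon_image_B by blast
  have "ideal (canon ` I) B"
  proof (rule idealI[OF ring_B])
    show "subgroup (canon ` I) (add_monoid B)"
    proof (rule B'.add.subgroupI)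
      show "canon ` I \<subseteq> carrier B" using IC hom_closed by blast
      show "canon ` I \<noteq> {}" using I_zero by blast
      show "\<ominus>\<^bsub>B\<^esub> W \<in> canon ` I" if W: "W \<in> canon ` I" for W
      proof -
        obtain V where V: "V \<in> I" "W = canon V" using W by blast
        then have "\<ominus>\<^bsub>B\<^esub> W = canon (\<ominus>\<^bsub>P.C\<^esub> V)" using hom_a_inv[OF IC] by simp
        then show ?thesis using I_neg[OF V(1)] by blast
      qed
      show "V \<oplus>\<^bsub>B\<^esub> W \<in> canon ` I" if VW: "V \<in> canon ` I" "W \<in> canon ` I" for V W
      proof -
        obtain v w where vw: "v \<in> I" "V = canon v" "w \<in> I" "W = canon w" using VW by blast
        then have "V \<oplus>\<^bsub>B\<^esub> W = canon (v \<oplus>\<^bsub>P.C\<^esub> w)" using hom_add[OF IC IC] by simp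
        then show ?thesis using I_add[OF vw(1,3)] by blast
      qed
    qed
    fix V W assume VW: "V \<in> canon ` I" "W \<in> carrier B"
    obtain v where v: "v \<in> I" "V = canon v" using VW(1) by blast
    obtain w where w: "w \<in> carrier P.C" "W = canon w" using BC[OF VW(2)] by blast
    have "W \<otimes>\<^bsub>B\<^esub> V = canon (w \<otimes>\<^bsub>P.C\<^esub> v)" "V \<otimes>\<^bsub>B\<^esub> W = canon (v \<otimes>\<^bsub>P.C\<^esub> w)"
      using hom_mult[OF w(1) IC[OF v(1)]] hom_mult[OF IC[OF v(1)] w(1)] v(2) w(2) by simp_all
    then show "W \<otimes>\<^bsub>B\<^esub> V \<in> canon ` I" "V \<otimes>\<^bsub>B\<^esub> W \<in> canon ` I"
      using I.I_l_closed[OF v(1) w(1)] I.I_r_closed[OF v(1) w(1)] by blast+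
  qed
  moreover have "norm_closed B (canon ` I)"
    unfolding norm_closed_def
  proof (intro ballI impI)
    fix W assume "W \<in> carrier B" and ap: "\<forall>e>0. \<exists>V\<in>canon ` I. anorm B (W \<ominus>\<^bsub>B\<^esub> V) < e"
    then obtain a where a: "W = U.cls a" "a \<in> P.cseq" by (auto simp: canon_range_def)
    have "\<exists>b\<in>P.cseq. P.cls b \<in> I \<and> U.limnorm (\<lambda>n. a n - b n) < e" if e: "0 < e" for e
    proof -
      obtain V where V: "V \<in> I" "anorm B (W \<ominus>\<^bsub>B\<^esub> canon V) < e" using ap e by blast
      then obtain b where b: "V = P.cls b" "b \<in> P.cseq" using IC by (auto simp: P.completion_carrier)
      have "(\<lambda>n. a n - b n) \<in> U.cseq" by (intro cseq_map P.cseq_ops a b)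
      then show ?thesis using V a b by (intro bexI[of _ b]) (simp_all add: canon_cls B_minus U.completion_unary_ops)
    qed
    then have "P.cls a \<in> I" by (rule approx_in_ideal[OF I a(2)])
    then show "W \<in> canon ` I" using canon_cls[OF a(2)] a(1) by (metis imageI)
  qed
  moreover have "V \<otimes>\<^bsub>B\<^esub> W \<ominus>\<^bsub>B\<^esub> W \<otimes>\<^bsub>B\<^esub> V \<in> canon ` I" if VW: "V \<in> carrier B" "W \<in> carrier B" for V W
  proof -
    obtain v w where v: "v \<in> carrier P.C" "V = canon v" and w: "w \<in> carrier P.C" "W = canon w"
      using BC VW by blast
    have "canon (v \<otimes>\<^bsub>P.C\<^esub> w \<ominus>\<^bsub>P.C\<^esub> w \<otimes>\<^bsub>P.C\<^esub> v) = V \<otimes>\<^bsub>B\<^esub> W \<ominus>\<^bsub>B\<^esub> W \<otimes>\<^bsub>B\<^esub> V"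
      unfolding v(2) w(2) using v(1) w(1) by (simp only: canon_minus hom_mult P'.m_closed)
    moreover have "v \<otimes>\<^bsub>P.C\<^esub> w \<ominus>\<^bsub>P.C\<^esub> w \<otimes>\<^bsub>P.C\<^esub> v \<in> I"
      using I v(1) w(1) unfolding comm_closed_def by blast
    ultimately show ?thesis by (metis imageI)
  qed
  ultimately show ?thesis unfolding comm_closed_def by blast
qed

lemma canon_in_image_iff:
  assumes I: "comm_closed P.C I" and V: "V \<in> carrier P.C"
  shows "canon V \<in> canon ` I \<longleftrightarrow> V \<in> I"
proof
  assume "canon V \<in> canon ` I"
  then obtain W where W: "canon V = canon W" "W \<in> I" by (rule imageE)
  have "ideal I P.C" using I by (simp add: comm_closed_def)
  then have "W \<in> carrier P.C" using W(2) by (rule ideal.Icarr)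
  then obtain a b where a: "V = P.cls a" "a \<in> P.cseq" and b: "W = P.cls b" "b \<in> P.cseq"
    using V by (auto simp: P.completion_carrier)
  have "U.cls a = U.cls b"
    using W(1) unfolding a(1) b(1) canon_cls[OF a(2)] canon_cls[OF b(2)] .
  then have "U.limnorm (\<lambda>n. a n - b n) = 0"
    using U.cls_eq_iff[OF cseq_map[OF a(2)] cseq_map[OF b(2)]] by simp
  moreover have "P.cls b \<in> I" using W(2) b(1) by simp
  ultimately have "\<exists>b\<in>P.cseq. P.cls b \<in> I \<and> U.limnorm (\<lambda>n. a n - b n) < e" if "0 < e" for e
    using b(2) that by (intro bexI[of _ b] conjI) (simp_all only:)
  then show "V \<in> I" unfolding a(1) by (rule approx_in_ideal[OF I a(2)])
qed (rule imageI)

lemma commutator_ideal_preimage: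
  "commutator_ideal P.C = {V \<in> carrier P.C. canon V \<in> commutator_ideal B}"
proof (intro equalityI subsetI)
  fix V assume V: "V \<in> commutator_ideal P.C"
  have "canon V \<in> I" "V \<in> carrier P.C" if "comm_closed B I" for I
    using preimage_comm_closed[OF that] V unfolding commutator_ideal_alt by blast+
  then show "V \<in> {V \<in> carrier P.C. canon V \<in> commutator_ideal B}"
    using comm_closed_carrier[OF ring_B] unfolding commutator_ideal_alt by blast
next
  fix V assume V: "V \<in> {V \<in> carrier P.C. canon V \<in> commutator_ideal B}"
  have "V \<in> I" if "comm_closed P.C I" for I
    using image_comm_closed[OF that] V canon_in_image_iff[OF that] unfolding commutator_ideal_alt by blast
  then show "V \<in> commutator_ideal P.C" unfolding commutator_ideal_alt by blast
qed

lemma abelianization_isomorphic: "cstar_isomorphic (abelianization P.C) (abelianization B)"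
proof -
  have "commutator_ideal B \<subseteq> carrier B"
    unfolding commutator_ideal_alt using comm_closed_carrier[OF ring_B] by blast
  then show ?thesis
    unfolding abelianization_def commutator_ideal_preimage
    by (intro quotient_isomorphic[OF P.ring_completion ring_B canon_hom canon_image_B _ P_closed])
qed

end

section \<open>Comparison of the two homogeneous spaces\<close>

text \<open>
  The step in which the quantum groups enter. A character that norms \<open>x\<close> in the abelianization is a real isometry;
  completed to a real group matrix it is a character on the polynomials in all entries, and those are bounded
  by the universal norm of the group.
\<close>

lemma quotient_le_universal_norm:
  assumes kn: "k \<le> n" and x: "x \<in> poly_on ({k<..n} \<times> {1..n})"
  shows "cstar_seminorm.quotient_seminorm
      (norm_on ({k<..n} \<times> {1..n}) (universal_norm ({k<..n} \<times> {1..n}) (isometry_relations G k n))) comm_ideal x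
    \<le> norm_on ({1..n} \<times> {1..n}) (universal_norm ({1..n} \<times> {1..n}) (group_relations G n)) x"
proof -
  let ?X = "{k<..n} \<times> {1..n}" and ?Y = "{1..n} \<times> {1..n}"
  interpret P: universal_cstar ?X "isometry_relations G k n" "isometry_rel G k n" by (rule universal_isometry)
  interpret U: universal_cstar ?Y "group_relations G n" "group_rel G n" by (rule universal_group)
  interpret N: cstar_seminorm "norm_on ?X P.unorm" by (rule P.cstar_unorm)
  interpret T: cstar_seminorm "norm_on ?Y U.unorm" by (rule U.cstar_unorm)
  define Q where "Q = N.quotient_seminorm comm_ideal"
  have Q: "cstar_seminorm Q" unfolding Q_def by (rule N.cstar_quotient_seminorm[OF star_ideal_comm_ideal])
  interpret Q: cstar_seminorm Q by (rule Q)
  have QN: "Q z \<le> norm_on ?X P.unorm z" for z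
    unfolding Q_def by (rule N.quotient_seminorm_le_self[OF star_ideal_comm_ideal])
  have comm: "Q.commutes"
    unfolding Q.commutes_def Q.null_eq_def
  proof (intro allI)
    fix a b :: "entry fpoly"
    have "a * b - b * a \<in> comm_ideal" using comm_ideal.comm[of 1 a b 1] by simp
    then show "Q (a * b - b * a) = 0"
      unfolding Q_def by (rule N.quotient_seminorm_null[OF star_ideal_comm_ideal])
  qed
  have "Q x \<le> norm_on ?Y U.unorm x"
  proof (cases "Q x = 0")
    case True
    then show ?thesis using T.nonneg by simp
  next
    case False
    \<comment> \<open>The letters are self-adjoint only modulo null elements, so their self-adjoint parts are made scalar.\<close>
    define h :: "entry \<Rightarrow> entry fpoly" where "h a = (1/2) *\<^sub>R (gen a + star (gen a))" for a
    have "finite (h ` ?X)" "\<forall>z\<in>h ` ?X. star z = z"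
      by (simp, auto simp: h_def star_scaleR star_add add.commute)
    then obtain M r where M: "cstar_seminorm M" "\<And>z. M z \<le> Q z" "M 1 = 1" "M x = Q x"
      "\<And>z. z \<in> h ` ?X \<Longrightarrow> M (z - r z *\<^sub>R 1) = 0"
      using norming_scalar_points[OF Q comm False] by blast
    interpret M: cstar_seminorm M by (rule M(1))
    have MN: "M z \<le> norm_on ?X P.unorm z" for z using M(2)[of z] QN[of z] by simp
    have rel: "M z = 0" if "z \<in> isometry_rel G k n" for z
      using MN[of z] P.unorm_rels[OF that] M.nonneg[of z] by linarith
    define \<phi> where "\<phi> a = r (h a)" for a
    have point: "M (gen a - \<phi> a *\<^sub>R 1) = 0" if a: "a \<in> ?X" for a
    proof -
      obtain i j where ij: "a = (i, j)" "i \<in> {k<..n}" "j \<in> {1..n}" using a by auto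
      have "star (gen a) - gen a \<in> hermitian_rel {k<..n} {1..n}"
        unfolding hermitian_rel_def using ij by blast
      moreover have "hermitian_rel {k<..n} {1..n} \<subseteq> isometry_rel G k n" by (cases G) auto
      ultimately have "M.null_eq (star (gen a)) (gen a)" using rel unfolding M.null_eq_def by blast
      then have "M.null_eq (h a) ((1/2) *\<^sub>R (gen a + gen a))"
        unfolding h_def by (intro M.null_eq_scaleR M.null_eq_add M.null_eq_refl)
      then have "M.null_eq (h a) (gen a)" by (simp add: scaleR_2[symmetric])
      moreover have "M.null_eq (h a) (\<phi> a *\<^sub>R 1)" using M(5)[of "h a"] a by (simp add: M.null_eq_def \<phi>_def)
      ultimately have "M.null_eq (gen a) (\<phi> a *\<^sub>R 1)" using M.null_eq_sym M.null_eq_trans by blast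
      then show ?thesis by (simp add: M.null_eq_def)
    qed
    have value_at: "M z = cmod (eval_at \<phi> z)" if "z \<in> poly_on ?X" for z
      using M.eq_if_null_diff[OF scalar_point_eval[OF M(1) that point]]
        cstar_seminorm_scaleC[OF M(1), of "eval_at \<phi> z" 1] M(3) by simp
    have "\<forall>z\<in>isometry_rel G k n. eval_at \<phi> z = 0"
      using rel value_at isometry_rel_poly_on[of G k n] by fastforce
    then obtain \<psi> where \<psi>: "\<forall>z\<in>group_rel G n. eval_at \<psi> z = 0" "\<And>a. a \<in> ?X \<Longrightarrow> \<psi> a = \<phi> a"
      using extend_isometry_point[OF kn] by blast
    have "?X \<subseteq> ?Y" by auto
    then have xY: "x \<in> poly_on ?Y" using x poly_on_mono by blast
    have "Q x = cmod (eval_at \<phi> x)" using M(4) value_at[OF x] by simp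
    also have "eval_at \<phi> x = eval_at \<psi> x" using \<psi>(2) by (intro eval_at_cong[OF x]) simp
    also have "cmod (eval_at \<psi> x) \<le> norm_on ?Y U.unorm x"
      using \<psi>(1) by (intro U.unorm_greatest[OF cstar_eval_at _ xY]) simp
    finally show ?thesis .
  qed
  then show ?thesis by (simp add: Q_def)
qed

theorem theoremC:
  fixes G :: quantum_family and n k :: nat
  assumes "k \<le> n"
  shows "cstar_isomorphic (abelianization (C_plus G n k)) (abelianization (C_times G n k)) \<and>
    (\<exists>\<pi>. canonical_surjection G n k \<pi> \<and>
       (\<forall>h. haar_state G n h \<longrightarrow>
          cstar_isomorphic (reduced_version (C_plus G n k) (h \<circ> \<pi>))
                           (reduced_version (C_times G n k) h)))"
proof -
  let ?X = "{k<..n} \<times> {1..n}" and ?Y = "{1..n} \<times> {1..n}"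
  let ?s = "universal_norm ?X (isometry_relations G k n)" and ?t = "universal_norm ?Y (group_relations G n)"
  interpret PU: universal_cstar ?X "isometry_relations G k n" "isometry_rel G k n" by (rule universal_isometry)
  interpret UU: universal_cstar ?Y "group_relations G n" "group_rel G n" by (rule universal_group)
  interpret seminorm_map_points ?X ?Y ?s ?t
  proof unfold_locales
    show "has_cstar_seminorm (free_star_algebra ?X ?s)" by (rule PU.has_cstar_unorm)
    show "has_cstar_seminorm (free_star_algebra ?Y ?t)" by (rule UU.has_cstar_unorm)
    show "?X \<subseteq> ?Y" by auto
    show "norm_on ?Y ?t x \<le> norm_on ?X ?s x" if "x \<in> poly_on ?X" for x
      using isometry_rel_if_group_rel[OF UU.cstar_unorm, of G n _ k] UU.unorm_rels
      by (intro PU.unorm_greatest[OF UU.cstar_unorm _ that]) blast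
    show "cstar_seminorm.quotient_seminorm (norm_on ?X ?s) comm_ideal x \<le> norm_on ?Y ?t x"
      if "x \<in> poly_on ?X" for x
      by (rule quotient_le_universal_norm[OF assms that])
  qed
  have plus: "C_plus G n k = P.C" by (simp add: C_plus_def universal_cstar_algebra_def)
  have group: "C_group G n = U.C" by (simp add: C_group_def universal_cstar_algebra_def)
  have p: "p_mat G n k i j = P.cls (\<lambda>_. ent i j)" for i j
    unfolding p_mat_def universal_matrix_def generator_matrix_def completion_embed_def P.cls_def coeff_gen ..
  have u: "u_mat G n i j = U.cls (\<lambda>_. ent i j)" for i j
    unfolding u_mat_def universal_matrix_def generator_matrix_def completion_embed_def U.cls_def coeff_gen ..
  have "{u_mat G n i j | i j. i \<in> {k<..n} \<and> j \<in> {1..n}} = {U.cls (\<lambda>_. gen a) | a. a \<in> ?X}"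
    unfolding u by blast
  then have times: "C_times G n k = B" by (simp only: C_times_def group generated_eq_B)
  have "canon (p_mat G n k i j) = u_mat G n i j" if "i \<in> {k<..n}" "j \<in> {1..n}" for i j
    unfolding p u using that by (intro canon_cls P.cseq_const gen_poly_on) simp
  then have "canonical_surjection G n k canon"
    unfolding canonical_surjection_def plus times using canon_hom canon_image_B by blast
  moreover have "cstar_isomorphic (reduced_version (C_plus G n k) (h \<circ> canon)) (reduced_version (C_times G n k) h)" for h
    unfolding plus times by (rule reduced_isomorphic)
  moreover have "cstar_isomorphic (abelianization (C_plus G n k)) (abelianization (C_times G n k))"
    unfolding plus times by (rule abelianization_isomorphic)
  ultimately show ?thesis by blast
qed

end
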